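(* Let $n,k,N\ge 1$ be integers. Then the integral $$I_k(n;N):=\int_{U(N)}\big|[u^n]\det(I+uU)^k\big|^2\,dU$$ is equal to the number of $k\times k$ matrices with nonnegative integer entries whose sum (of all entries) is $n$ and whose longest SE-chain has length $\le N$.
   Context: $U(N)$ is the group of $N\times N$ complex unitary matrices with Haar probability measure $dU$, and $[u^n]F(u)$ denotes the coefficient of $u^n$ in the polynomial $F(u)$. For a matrix with nonnegative integer entries, an SE-chain is a sequence of entries (at distinct positions) in which each entry is located weakly to the right of and weakly below the preceding entry; its length is the sum of the entries in it. "Longest" means of maximal length. *)

theory Defs
  imports
    "Jordan_Normal_Form.Matrix"
    "HOL-Computational_Algebra.Polynomial"
    "HOL-Probability.Probability"
begin

text \<open>
  Two matrix types occur. The unitary matrices have type \<open>complex^'n^'n\<close>, which carries the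
  topology needed for the Borel sigma-algebra. The integer matrices have type \<open>nat mat\<close>,
  whose size is a natural number and whose positions are linearly ordered.
\<close>

hide_const (open) Matrix.mat

subsection \<open>The unitary group and its Haar probability measure\<close>

definition conj_transpose :: "complex^'n^'m \<Rightarrow> complex^'m^'n" where
  "conj_transpose A = map_matrix cnj (transpose A)"

definition unitary_group :: "(complex^'n^'n) set" where
  "unitary_group = {U. conj_transpose U ** U = mat 1 \<and> U ** conj_transpose U = mat 1}"

text \<open>
  Left invariance suffices: on a compact group it determines a Borel probability measure
  uniquely and implies right invariance. Regularity is automatic, since the group is a
  compact metric space.
\<close>

definition haar_prob_measure :: "(complex^'n^'n) measure \<Rightarrow> bool" where
  "haar_prob_measure M \<longleftrightarrow>
     prob_space M \<and>
     space M = unitary_group \<and>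
     sets M = sets (restrict_space borel unitary_group) \<and>
     (\<forall>V\<in>unitary_group. distr M M (\<lambda>U. V ** U) = M)"

subsection \<open>The determinant as a polynomial\<close>

text \<open>The matrix \<open>I + uU\<close> has entries in the polynomial ring in \<open>u\<close>; \<open>monom z 1\<close> is \<open>z u\<close>.\<close>

definition det_poly :: "complex^'n^'n \<Rightarrow> complex poly" where
  "det_poly U = det (mat 1 + map_matrix (\<lambda>z. monom z 1) U)"

subsection \<open>SE-chains\<close>

text \<open>
  A chain is given by the list of its positions \<open>(i, j)\<close>, with row \<open>i\<close> counted downwards and
  column \<open>j\<close> counted to the right. The empty list is included; it has length \<open>0\<close>, so it does
  not affect the maximum, because entries are nonnegative.
\<close>

definition SE_chain :: "nat mat \<Rightarrow> (nat \<times> nat) list \<Rightarrow> bool" where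
  "SE_chain A ps \<longleftrightarrow>
     set ps \<subseteq> {..<dim_row A} \<times> {..<dim_col A} \<and>
     distinct ps \<and>
     successively (\<lambda>(i, j) (i', j'). i \<le> i' \<and> j \<le> j') ps"

definition SE_length :: "nat mat \<Rightarrow> (nat \<times> nat) list \<Rightarrow> nat" where
  "SE_length A ps = (\<Sum>p\<leftarrow>ps. A $$ p)"

text \<open>The maximum is over a finite nonempty set, since chains are lists of distinct positions.\<close>

definition longest_SE_chain :: "nat mat \<Rightarrow> nat" where
  "longest_SE_chain A = Max {SE_length A ps | ps. SE_chain A ps}"

end

theory Submission
  imports Defs
begin

text \<open>
  For words \<open>g\<close> and \<open>s\<close> on the cells of \<open>[k] \<times> [N]\<close> with letters in \<open>[k]\<close> and \<open>[N]\<close>, let \<open>eps g s\<close> be the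
  sign of \<open>i \<mapsto> (g i, s i)\<close> if this is a permutation, and \<open>0\<close> otherwise. By left invariance, the
  columns of the matrix of moments \<open>E(conj (det U)^k \<Prod>i. U(s i, t i))\<close> are multiplied by \<open>det^k\<close> under
  tensor powers of unitary matrices, hence under tensor powers of all matrices. The kernel
  \<open>K(s, t) = \<Sum>g. eps g s eps g t\<close> is a linear combination of tensor powers, so it acts on such columns as
  a scalar \<open>c\<close>, and the moments turn out to be \<open>K(s, t) / c\<close>.

  On the unitary group the conjugate of the coefficient of \<open>u^n\<close> in \<open>det (I + u U)^k\<close> is \<open>conj (det U)^k\<close>
  times the coefficient of \<open>u^(N k - n)\<close>. Expanding both coefficients into products of \<open>2 k\<close>
  coefficients of \<open>det (I + u U)\<close> writes the integral as a sum of traces of projections, that is, of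
  dimensions of spans of the vectors \<open>eps g\<close>, symmetrised over the positions of equal color. Such a span
  has a basis indexed by the matrices with given margins whose SE-chains have length at most \<open>N\<close>:
  permuting \<open>g\<close> over more than \<open>N\<close> positions gives a linear relation, because \<open>s\<close> repeats a letter there,
  and along a long SE-chain this relation rewrites \<open>eps g\<close> in terms of smaller vectors; conversely a matrix
  without long chains splits into \<open>N\<close> antichains, which give a word \<open>s\<close> witnessing triangularity.
\<close>

unbundle no m_inv_syntax
no_notation vec_index (infixl "$" 100)

section \<open>The sign of a pair of words\<close>

context
  fixes k :: nat
begin

text \<open>The degrees of the two coefficients add up to \<open>k * CARD('n)\<close>, the degree of
  \<open>det U ^ k\<close>. Hence one set of that many cells carries the whole product: each of its
  2k factors becomes a color, and the number of cells of a color is the degree of that factor.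

  Covariance alone fixes a column of moments only up to a factor. The factor comes from pairing with
  \<open>eps g\<close>: there the determinant cancels its conjugate and the total mass 1 enters. The
  scalar c is never computed. It divides the moments and multiplies the trace, so only c \<noteq> 0
  matters.

  How the margins arise: a word g amounts to a 2k by k table that counts cells by color and letter.
  If its vector is nonzero, every column of the table sums to N. Straightening makes the upper half
  of the table diagonal, so an upper color x with a cells leaves N - a cells of letter x for the
  lower half. Thus the sizes of the upper colors prescribe the column sums of the lower half, and
  the sizes of the lower colors prescribe its row sums. Summing over all sizes, only the total n
  remains prescribed.\<close>

definition cells :: "(nat \<times> 'n::finite) set" where
  "cells = {..<k} \<times> UNIV"

definition row_words :: "(nat \<times> 'n::finite \<Rightarrow> nat) set" where
  "row_words = cells \<rightarrow>\<^sub>E {..<k}"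

definition col_words :: "(nat \<times> 'n::finite \<Rightarrow> 'n) set" where
  "col_words = cells \<rightarrow>\<^sub>E UNIV"

text \<open>The identity outside the cells makes \<open>permutes\<close> and \<open>sign\<close>
  applicable.\<close>

definition pair_map :: "(nat \<times> 'n::finite \<Rightarrow> nat) \<Rightarrow> (nat \<times> 'n \<Rightarrow> 'n) \<Rightarrow> nat \<times> 'n \<Rightarrow> nat \<times> 'n" where
  "pair_map g s = (\<lambda>i. if i \<in> cells then (g i, s i) else i)"

text \<open>For fixed g this is, up to a sign depending on g only, a product of k Levi-Civita
  symbols: the j-th one is evaluated at the letters of s on the cells with \<open>g i = j\<close>.
  It vanishes if one of these fibers does not have CARD('n) cells.\<close>

definition eps :: "(nat \<times> 'n::finite \<Rightarrow> nat) \<Rightarrow> (nat \<times> 'n \<Rightarrow> 'n) \<Rightarrow> int" where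
  "eps g s = (if pair_map g s permutes cells then sign (pair_map g s) else 0)"

lemma finite_cells [simp, intro]: "finite (cells :: (nat \<times> 'n::finite) set)"
  by (simp add: cells_def)

lemma card_cells: "card (cells :: (nat \<times> 'n::finite) set) = k * CARD('n)"
  by (simp add: cells_def card_cartesian_product)

lemma finite_row_words [simp, intro]: "finite (row_words :: (nat \<times> 'n::finite \<Rightarrow> nat) set)"
  by (simp add: row_words_def finite_PiE)

lemma finite_col_words [simp, intro]: "finite (col_words :: (nat \<times> 'n::finite \<Rightarrow> 'n) set)"
  by (simp add: col_words_def finite_PiE)

lemma pair_map_permutes_iff:
  fixes g :: "nat \<times> 'n::finite \<Rightarrow> nat"
  assumes "g \<in> row_words"
  shows "pair_map g s permutes cells \<longleftrightarrow> inj_on (\<lambda>i. (g i, s i)) cells"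
proof
  assume "pair_map g s permutes cells"
  then have "inj_on (pair_map g s) cells"
    by (rule permutes_inj_on)
  then show "inj_on (\<lambda>i. (g i, s i)) cells"
    by (auto simp: inj_on_def pair_map_def)
next
  assume inj: "inj_on (\<lambda>i. (g i, s i)) cells"
  then have inj': "inj_on (pair_map g s) cells"
    by (auto simp: inj_on_def pair_map_def)
  have into: "pair_map g s i \<in> cells" if "i \<in> cells" for i
    using assms that by (auto simp: pair_map_def row_words_def cells_def)
  have fixed: "pair_map g s i = i" if "i \<notin> cells" for i
    using that by (simp add: pair_map_def)
  show "pair_map g s permutes cells"
    by (rule inj_imp_permutes[OF inj' finite_cells into fixed])
qed

lemma eps_nonzero_iff:
  fixes g :: "nat \<times> 'n::finite \<Rightarrow> nat"
  assumes "g \<in> row_words"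
  shows "eps g s \<noteq> 0 \<longleftrightarrow> inj_on (\<lambda>i. (g i, s i)) cells"
  using pair_map_permutes_iff[OF assms, of s] by (simp add: eps_def)

lemma eps_eq_0_iff:
  fixes g :: "nat \<times> 'n::finite \<Rightarrow> nat"
  assumes "g \<in> row_words"
  shows "eps g s = 0 \<longleftrightarrow> \<not> inj_on (\<lambda>i. (g i, s i)) cells"
  using eps_nonzero_iff[OF assms, of s] by blast

lemma eps_cong:
  fixes g g' :: "nat \<times> 'n::finite \<Rightarrow> nat"
  assumes "\<And>i. i \<in> cells \<Longrightarrow> g i = g' i" "\<And>i. i \<in> cells \<Longrightarrow> s i = s' i"
  shows "eps g s = eps g' s'"
proof -
  have "pair_map g s = pair_map g' s'"
    using assms by (auto simp: pair_map_def)
  then show ?thesis by (simp add: eps_def)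
qed

lemma pair_map_comp:
  assumes "p permutes cells"
  shows "pair_map (g \<circ> p) (s \<circ> p) = pair_map g s \<circ> p"
  using permutes_in_image[OF assms] permutes_not_in[OF assms]
  by (auto simp: pair_map_def fun_eq_iff)

lemma permutes_comp_iff:
  assumes "p permutes S"
  shows "q \<circ> p permutes S \<longleftrightarrow> q permutes S"
proof
  assume "q \<circ> p permutes S"
  then have "(q \<circ> p) \<circ> inv p permutes S"
    using permutes_inv[OF assms] by (rule permutes_compose[rotated])
  then show "q permutes S"
    by (simp add: comp_assoc permutes_inv_o[OF assms])
qed (rule permutes_compose[OF assms])

lemma eps_comp:
  fixes g :: "nat \<times> 'n::finite \<Rightarrow> nat"
  assumes p: "p permutes cells"
  shows "eps (g \<circ> p) (s \<circ> p) = sign p * eps g s"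
proof (cases "pair_map g s permutes cells")
  case True
  then have "sign (pair_map g s \<circ> p) = sign (pair_map g s) * sign p"
    using p by (intro sign_compose permutes_imp_permutation[OF finite_cells])
  then show ?thesis
    using True p by (simp add: eps_def pair_map_comp permutes_comp_iff)
next
  case False
  then show ?thesis
    using p by (simp add: eps_def pair_map_comp permutes_comp_iff)
qed

text \<open>Lets a symmetrisation over the positions of g be moved onto s, and back.\<close>

lemma eps_comp_row:
  fixes g :: "nat \<times> 'n::finite \<Rightarrow> nat"
  assumes p: "p permutes cells"
  shows "eps (g \<circ> p) s = sign p * eps g (s \<circ> inv p)"
proof -
  have "s = (s \<circ> inv p) \<circ> p"
    using permutes_inv_o[OF p] by (simp add: comp_assoc)
  then show ?thesis
    using eps_comp[OF p, of g "s \<circ> inv p"] by simp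
qed

lemma eps_comp_col:
  fixes g :: "nat \<times> 'n::finite \<Rightarrow> nat"
  assumes p: "p permutes cells"
  shows "eps g (s \<circ> p) = sign p * eps (g \<circ> inv p) s"
proof -
  have "g = (g \<circ> inv p) \<circ> p"
    using permutes_inv_o[OF p] by (simp add: comp_assoc)
  then show ?thesis
    using eps_comp[OF p, of "g \<circ> inv p" s] by simp
qed

lemma eps_fst_snd: "eps fst (snd :: nat \<times> 'n::finite \<Rightarrow> 'n) = 1"
proof -
  have "pair_map fst (snd :: nat \<times> 'n \<Rightarrow> 'n) = id"
    by (auto simp: pair_map_def)
  then show ?thesis by (simp add: eps_def permutes_id)
qed

lemma comp_permutes_PiE:
  assumes "p permutes A" "g \<in> A \<rightarrow>\<^sub>E B"
  shows "g \<circ> p \<in> A \<rightarrow>\<^sub>E B"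
  using assms permutes_in_image[OF assms(1)] permutes_not_in[OF assms(1)]
  by (auto simp: PiE_iff extensional_def)

lemma bij_betw_comp_permutes_PiE:
  assumes "p permutes A"
  shows "bij_betw (\<lambda>g. g \<circ> p) (A \<rightarrow>\<^sub>E B) (A \<rightarrow>\<^sub>E B)"
proof (rule bij_betwI[where g = "\<lambda>g. g \<circ> inv p"])
  show "(\<lambda>g. g \<circ> p) \<in> (A \<rightarrow>\<^sub>E B) \<rightarrow> A \<rightarrow>\<^sub>E B"
    using comp_permutes_PiE[OF assms] by blast
  show "(\<lambda>g. g \<circ> inv p) \<in> (A \<rightarrow>\<^sub>E B) \<rightarrow> A \<rightarrow>\<^sub>E B"
    using comp_permutes_PiE[OF permutes_inv[OF assms]] by blast
qed (simp_all add: comp_assoc permutes_inv_o[OF assms])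

lemma bij_row_words:
  assumes "p permutes cells"
  shows "bij_betw (\<lambda>g. g \<circ> p) row_words (row_words :: (nat \<times> 'n::finite \<Rightarrow> nat) set)"
  unfolding row_words_def by (rule bij_betw_comp_permutes_PiE[OF assms])

lemma bij_col_words:
  assumes "p permutes cells"
  shows "bij_betw (\<lambda>g. g \<circ> p) col_words (col_words :: (nat \<times> 'n::finite \<Rightarrow> 'n) set)"
  unfolding col_words_def by (rule bij_betw_comp_permutes_PiE[OF assms])

lemma comp_row_words: "p permutes cells \<Longrightarrow> g \<in> row_words \<Longrightarrow> g \<circ> p \<in> row_words"
  for g :: "nat \<times> 'n::finite \<Rightarrow> nat"
  unfolding row_words_def by (rule comp_permutes_PiE)

lemma comp_col_words: "p permutes cells \<Longrightarrow> s \<circ> p \<in> col_words" if "s \<in> col_words"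
  for s :: "nat \<times> 'n::finite \<Rightarrow> 'n"
  using that unfolding col_words_def by (rule comp_permutes_PiE[rotated])

subsection \<open>Tensor powers act on sign vectors by the determinant\<close>

text \<open>Two cells agree under both g and s. Swapping them in t preserves the product and
  reverses the sign of \<open>eps\<close>, so the sum is its own negative.\<close>

lemma sum_words_not_inj:
  fixes g :: "nat \<times> 'n::finite \<Rightarrow> nat" and U :: "'a::{idom,ring_char_0}^'n^'n"
  assumes "\<not> inj_on (\<lambda>i. (g i, s i)) cells"
  shows "(\<Sum>t\<in>col_words. (\<Prod>i\<in>cells. U $ s i $ t i) * of_int (eps g t)) = 0"
proof -
  obtain i j where ij: "i \<in> cells" "j \<in> cells" "i \<noteq> j" "g i = g j" "s i = s j"
    using assms by (auto simp: inj_on_def)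
  let ?p = "Transposition.transpose i j"
  have p: "?p permutes cells"
    using ij by (intro permutes_swap_id)
  have gp: "g \<circ> ?p = g" and sp: "s \<circ> ?p = s"
    using ij by (auto simp: fun_eq_iff Transposition.transpose_def)
  let ?f = "\<lambda>t. (\<Prod>i\<in>cells. U $ s i $ t i) * of_int (eps g t)"
  have "sum ?f col_words = (\<Sum>t\<in>col_words. ?f (t \<circ> ?p))"
    using sum.reindex_bij_betw[OF bij_col_words[OF p], of ?f] by simp
  also have "\<dots> = (\<Sum>t\<in>col_words. - ?f t)"
  proof (rule sum.cong[OF refl])
    fix t :: "nat \<times> 'n \<Rightarrow> 'n"
    have "(\<Prod>i\<in>cells. U $ s i $ (t \<circ> ?p) i) = (\<Prod>i\<in>cells. U $ (s \<circ> ?p) i $ (t \<circ> ?p) i)"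
      by (simp add: sp)
    also have "\<dots> = (\<Prod>i\<in>cells. U $ s i $ t i)"
      using prod.permute[OF p, of "\<lambda>i. U $ s i $ t i"] by (simp add: o_def)
    finally have *: "(\<Prod>i\<in>cells. U $ s i $ (t \<circ> ?p) i) = (\<Prod>i\<in>cells. U $ s i $ t i)" .
    have "eps g (t \<circ> ?p) = - eps g t"
      using eps_comp[OF p, of g t] ij by (simp add: gp sign_swap_id)
    with * show "?f (t \<circ> ?p) = - ?f t" by simp
  qed
  finally have "sum ?f col_words = - sum ?f col_words"
    by (simp add: sum_negf)
  then show ?thesis by simp
qed


text \<open>For \<open>g = fst\<close> the cells fall into k rows. The sign factors into one sign
  per row, and the sum into k Leibniz expansions of \<open>det U\<close>.\<close>

lemma sum_words_fst:
  fixes U :: "complex^'n^'n"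
  shows "(\<Sum>t\<in>col_words. (\<Prod>i\<in>cells. U $ snd i $ t i) * of_int (eps fst t)) = det U ^ k"
proof -
  \<comment> \<open>\<open>blk K \<sigma>\<close> applies \<open>\<sigma> j\<close> within row j for
    the rows j in K. Adding one row at a time to K yields the sign as a product.\<close>
  define blk :: "nat set \<Rightarrow> (nat \<Rightarrow> 'n \<Rightarrow> 'n) \<Rightarrow> nat \<times> 'n \<Rightarrow> nat \<times> 'n"
    where "blk K \<sigma> = (\<lambda>(j, p). if j \<in> K then (j, \<sigma> j p) else (j, p))" for K \<sigma>
  have blk1: "blk {j} \<sigma> permutes Pair j ` UNIV \<and> sign (blk {j} \<sigma>) = sign (\<sigma> j)"
    if "\<sigma> j permutes UNIV" for j and \<sigma> :: "nat \<Rightarrow> 'n \<Rightarrow> 'n"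
  proof -
    have inj: "inj_on (Pair j :: 'n \<Rightarrow> _) UNIV"
      by (simp add: inj_on_def)
    have inv: "inv_into UNIV (Pair j) (j, p) = p" for p :: 'n
      by (rule inv_into_f_f[OF inj]) simp
    have eq: "blk {j} \<sigma> = map_permutation UNIV (Pair j) (\<sigma> j)"
      by (auto simp: blk_def map_permutation_def restrict_id_def fun_eq_iff inv)
    show ?thesis
      unfolding eq
      using map_permutation_permutes[OF _ that, of "Pair j" "Pair j ` UNIV"] sign_map_permutation[OF inj that finite]
        that inj by (simp add: inj_on_imp_bij_betw)
  qed
  have sgn: "permutation (blk K \<sigma>) \<and> sign (blk K \<sigma>) = (\<Prod>j\<in>K. sign (\<sigma> j))"
    if "finite K" "\<And>j. j \<in> K \<Longrightarrow> \<sigma> j permutes UNIV" for K and \<sigma> :: "nat \<Rightarrow> 'n \<Rightarrow> 'n"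
    using that
  proof (induction K)
    case empty
    have "blk {} \<sigma> = id"
      by (auto simp: blk_def)
    then show ?case by simp
  next
    case (insert j K)
    have eq: "blk (insert j K) \<sigma> = blk {j} \<sigma> \<circ> blk K \<sigma>"
      using insert.hyps by (auto simp: blk_def fun_eq_iff)
    have p1: "permutation (blk {j} \<sigma>)"
      using blk1[of \<sigma> j] insert.prems by (intro permutes_imp_permutation[of "Pair j ` UNIV"]) auto
    have p2: "permutation (blk K \<sigma>)" "sign (blk K \<sigma>) = (\<Prod>j\<in>K. sign (\<sigma> j))"
      using insert by auto
    have "sign (blk {j} \<sigma> \<circ> blk K \<sigma>) = (\<Prod>j\<in>insert j K. sign (\<sigma> j))"
      using sign_compose[OF p1 p2(1)] blk1[of \<sigma> j] insert.prems insert.hyps p2(2) by simp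
    with permutation_compose[OF p1 p2(1)] show ?case
      unfolding eq by blast
  qed
  define sg :: "('n \<Rightarrow> 'n) \<Rightarrow> int" where "sg p = (if p permutes UNIV then sign p else 0)" for p
  have eps_blk: "eps fst (\<lambda>i\<in>cells. \<sigma> (fst i) (snd i)) = (\<Prod>j<k. sg (\<sigma> j))" for \<sigma>
  proof -
    let ?t = "\<lambda>i\<in>cells. \<sigma> (fst i) (snd i)"
    have pm: "pair_map fst ?t = blk {..<k} \<sigma>"
      by (auto simp: pair_map_def blk_def cells_def fun_eq_iff)
    show ?thesis
    proof (cases "\<forall>j<k. \<sigma> j permutes UNIV")
      case True
      then have s: "permutation (blk {..<k} \<sigma>) \<and> sign (blk {..<k} \<sigma>) = (\<Prod>j<k. sign (\<sigma> j))"
        by (intro sgn) auto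
      then have "bij (blk {..<k} \<sigma>)"
        by (simp add: permutation_bijective)
      then have "blk {..<k} \<sigma> permutes cells"
        by (simp add: permutes_def bij_iff) (auto simp: blk_def cells_def)
      then show ?thesis
        using s True by (simp add: eps_def pm sg_def)
    next
      case False
      then obtain j where j: "j < k" "\<not> \<sigma> j permutes UNIV" by auto
      have "\<not> inj (\<sigma> j)"
      proof
        assume "inj (\<sigma> j)"
        then have "\<sigma> j permutes UNIV"
          by (intro inj_imp_permutes) auto
        with j show False by simp
      qed
      then obtain p q where pq: "p \<noteq> q" "\<sigma> j p = \<sigma> j q"
        by (auto simp: inj_on_def)
      have "\<not> blk {..<k} \<sigma> permutes cells"
      proof
        assume "blk {..<k} \<sigma> permutes cells"
        then have "inj (blk {..<k} \<sigma>)" by (rule permutes_inj)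
        from injD[OF this, of "(j, p)" "(j, q)"] pq j show False
          by (simp add: blk_def)
      qed
      moreover have "(\<Prod>j<k. sg (\<sigma> j)) = 0"
        using j by (auto simp: sg_def intro!: prod_zero)
      ultimately show ?thesis
        by (simp add: eps_def pm)
    qed
  qed
  have bij: "bij_betw (\<lambda>\<sigma>. \<lambda>i\<in>cells. \<sigma> (fst i) (snd i)) ({..<k} \<rightarrow>\<^sub>E UNIV)
      (col_words :: (nat \<times> 'n \<Rightarrow> 'n) set)"
    by (rule bij_betwI[where g = "\<lambda>t. \<lambda>j\<in>{..<k}. \<lambda>p. t (j, p)"])
      (auto simp: col_words_def cells_def fun_eq_iff PiE_iff extensional_def restrict_def)
  have "(\<Sum>t\<in>col_words. (\<Prod>i\<in>cells. U $ snd i $ t i) * of_int (eps fst t)) =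
    (\<Sum>\<sigma>\<in>{..<k} \<rightarrow>\<^sub>E UNIV. \<Prod>j<k. (\<Prod>p\<in>UNIV. U $ p $ \<sigma> j p) * of_int (sg (\<sigma> j)))"
    (is "?lhs = _")
  proof -
    have "?lhs = (\<Sum>\<sigma>\<in>{..<k} \<rightarrow>\<^sub>E UNIV. (\<Prod>i\<in>cells. U $ snd i $ (\<lambda>i\<in>cells. \<sigma> (fst i) (snd i)) i) *
        of_int (eps fst (\<lambda>i\<in>cells. \<sigma> (fst i) (snd i))))"
      by (subst sum.reindex_bij_betw[OF bij, symmetric]) simp
    also have "\<dots> = (\<Sum>\<sigma>\<in>{..<k} \<rightarrow>\<^sub>E UNIV. \<Prod>j<k. (\<Prod>p\<in>UNIV. U $ p $ \<sigma> j p) * of_int (sg (\<sigma> j)))"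
    proof (rule sum.cong[OF refl])
      fix \<sigma> :: "nat \<Rightarrow> 'n \<Rightarrow> 'n"
      have "(\<Prod>i\<in>cells. U $ snd i $ (\<lambda>i\<in>cells. \<sigma> (fst i) (snd i)) i) =
          (\<Prod>i\<in>cells. U $ snd i $ \<sigma> (fst i) (snd i))"
        by (rule prod.cong) auto
      also have "\<dots> = (\<Prod>j<k. \<Prod>p\<in>UNIV. U $ p $ \<sigma> j p)"
        by (simp add: cells_def prod.cartesian_product case_prod_unfold)
      finally show "(\<Prod>i\<in>cells. U $ snd i $ (\<lambda>i\<in>cells. \<sigma> (fst i) (snd i)) i) *
          of_int (eps fst (\<lambda>i\<in>cells. \<sigma> (fst i) (snd i))) =
          (\<Prod>j<k. (\<Prod>p\<in>UNIV. U $ p $ \<sigma> j p) * of_int (sg (\<sigma> j)))"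
        by (simp add: eps_blk prod.distrib)
    qed
    finally show ?thesis .
  qed
  also have "\<dots> = (\<Prod>j<k. \<Sum>\<sigma>\<in>UNIV. (\<Prod>p\<in>UNIV. U $ p $ \<sigma> p) * of_int (sg \<sigma>))"
    by (subst prod_sum_PiE) auto
  also have "(\<Sum>\<sigma>\<in>UNIV. (\<Prod>p\<in>UNIV. U $ p $ \<sigma> p) * of_int (sg \<sigma>)) = det U"
    unfolding det_def by (rule sum.mono_neutral_cong_right) (auto simp: sg_def)
  finally show ?thesis by simp
qed

text \<open>If g and s form a permutation p of the cells, the substitution of
  \<open>t \<circ> p\<close> for t reduces to \<open>fst\<close> and \<open>snd\<close> at the price
  of \<open>sign p\<close>, which is \<open>eps k g s\<close>. Otherwise both sides vanish.\<close>

lemma sum_words_eps: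
  fixes U :: "complex^'n^'n"
  assumes g: "g \<in> row_words"
  shows "(\<Sum>t\<in>col_words. (\<Prod>i\<in>cells. U $ s i $ t i) * of_int (eps g t)) = det U ^ k * of_int (eps g s)"
proof (cases "inj_on (\<lambda>i. (g i, s i)) cells")
  case False
  then show ?thesis
    using sum_words_not_inj[OF False, of U] eps_eq_0_iff[OF g, of s] by simp
next
  case True
  define p where "p = pair_map g s"
  have p: "p permutes cells"
    using True pair_map_permutes_iff[OF g] by (simp add: p_def)
  have gs: "g i = (fst \<circ> p) i" "s i = (snd \<circ> p) i" if "i \<in> cells" for i
    using that by (simp_all add: p_def pair_map_def)
  let ?f = "\<lambda>t. (\<Prod>i\<in>cells. U $ s i $ t i) * of_int (eps g t)"
  have "sum ?f col_words = (\<Sum>t\<in>col_words. ?f (t \<circ> p))"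
    using sum.reindex_bij_betw[OF bij_col_words[OF p], of ?f] by simp
  also have "\<dots> = (\<Sum>t\<in>col_words. of_int (sign p) * ((\<Prod>i\<in>cells. U $ snd i $ t i) * of_int (eps fst t)))"
  proof (rule sum.cong[OF refl])
    fix t :: "nat \<times> 'n \<Rightarrow> 'n"
    have "(\<Prod>i\<in>cells. U $ s i $ (t \<circ> p) i) = (\<Prod>i\<in>cells. U $ snd (p i) $ t (p i))"
      by (rule prod.cong) (simp_all add: gs(2))
    also have "\<dots> = (\<Prod>i\<in>cells. U $ snd i $ t i)"
      using prod.permute[OF p, of "\<lambda>i. U $ snd i $ t i"] by (simp add: o_def)
    finally have *: "(\<Prod>i\<in>cells. U $ s i $ (t \<circ> p) i) = (\<Prod>i\<in>cells. U $ snd i $ t i)" .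
    have "eps g (t \<circ> p) = eps (fst \<circ> p) (t \<circ> p)"
      by (rule eps_cong) (simp_all add: gs(1))
    with * show "?f (t \<circ> p) = of_int (sign p) * ((\<Prod>i\<in>cells. U $ snd i $ t i) * of_int (eps fst t))"
      by (simp add: eps_comp[OF p])
  qed
  also have "\<dots> = of_int (sign p) * det U ^ k"
    by (simp only: sum_distrib_left[symmetric] sum_words_fst)
  also have "sign p = eps g s"
    using p by (simp add: eps_def p_def)
  finally show ?thesis by simp
qed

lemma sum_words_eps_transpose:
  fixes U :: "complex^'n^'n"
  assumes g: "g \<in> row_words"
  shows "(\<Sum>s\<in>col_words. of_int (eps g s) * (\<Prod>i\<in>cells. U $ s i $ t i)) = det U ^ k * of_int (eps g t)"
proof -
  have "transpose U $ i $ j = U $ j $ i" for i j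
    by (simp add: transpose_def)
  then show ?thesis
    using sum_words_eps[OF g, of "transpose U" t] by (simp add: det_transpose mult.commute)
qed

end

section \<open>The kernel\<close>

text \<open>u lists the coefficients of the Lagrange basis polynomials at the nodes 0, ..., M - 1.
  Interpolating a power below M reproduces it, and comparing coefficients inverts the Vandermonde
  matrix.\<close>

lemma vandermonde_dual:
  "\<exists>u :: nat \<Rightarrow> nat \<Rightarrow> real. \<forall>m<M. \<forall>m'<M. (\<Sum>x<M. u m x * real x ^ m') = (if m = m' then 1 else 0)"
proof -
  define lag :: "nat \<Rightarrow> real poly"
    where "lag x = (\<Prod>y\<in>{..<M} - {x}. smult (1 / (real x - real y)) [:- real y, 1:])" for x
  have poly_lag: "poly (lag x) (real z) = (if x = z then 1 else 0)" if "z < M" "x < M" for x z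
  proof (cases "x = z")
    case True
    then show ?thesis by (auto simp: lag_def poly_prod diff_divide_distrib[symmetric] intro!: prod.neutral)
  next
    case False
    then show ?thesis using that by (auto simp: lag_def poly_prod intro!: prod_zero)
  qed
  have degree_lag: "degree (lag x) < M" if "x < M" for x
  proof -
    have "degree (lag x) \<le> (\<Sum>y\<in>{..<M} - {x}. degree (smult (1 / (real x - real y)) [:- real y, 1:]))"
      unfolding lag_def by (rule degree_prod_sum_le[unfolded o_def]) simp
    also have "\<dots> \<le> (\<Sum>y\<in>{..<M} - {x}. 1)"
      by (rule sum_mono) simp
    also have "\<dots> < M" using that by (simp add: card_Diff_subset)
    finally show ?thesis .
  qed
  have interp: "(\<Sum>x<M. smult (real x ^ m') (lag x)) = monom 1 m'" if "m' < M" for m'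
  proof (rule poly_eqI_degree[where A = "real ` {..<M}"])
    fix z assume "z \<in> real ` {..<M}"
    then obtain z' where z: "z = real z'" "z' < M" by auto
    have "(\<Sum>x<M. real x ^ m' * poly (lag x) z) = (\<Sum>x<M. if x = z' then real x ^ m' else 0)"
      by (rule sum.cong) (auto simp: z poly_lag)
    then show "poly (\<Sum>x<M. smult (real x ^ m') (lag x)) z = poly (monom 1 m') z"
      using z by (simp add: poly_sum poly_monom)
  next
    have "card (real ` {..<M}) = M" by (simp add: card_image inj_on_def)
    moreover have "degree (\<Sum>x<M. smult (real x ^ m') (lag x)) < M"
      using that degree_lag by (intro degree_sum_less) (auto intro: le_less_trans[OF degree_smult_le])
    ultimately show "degree (\<Sum>x<M. smult (real x ^ m') (lag x)) < card (real ` {..<M})"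
      "degree (monom (1::real) m') < card (real ` {..<M})"
      using that by (auto simp: degree_monom_eq)
  qed
  have "(\<Sum>x<M. coeff (lag x) m * real x ^ m') = (if m = m' then 1 else 0)" if "m < M" "m' < M" for m m'
  proof -
    have "(\<Sum>x<M. coeff (lag x) m * real x ^ m') = coeff (\<Sum>x<M. smult (real x ^ m') (lag x)) m"
      by (simp add: coeff_sum mult.commute)
    also have "\<dots> = (if m = m' then 1 else 0)"
      using that by (simp add: interp)
    finally show ?thesis .
  qed
  then show ?thesis by (intro exI[of _ "\<lambda>m x. coeff (lag x) m"]) auto
qed

text \<open>A product of one-variable duals, one for each index c, inverts evaluation of monomials
  on the grid. So any function \<kappa> of a bounded exponent vector is a combination of monomials
  with exactly these exponents.\<close>

lemma monomial_interpolation: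
  fixes \<kappa> :: "('c::finite \<Rightarrow> nat) \<Rightarrow> real" and M :: nat
  defines "E \<equiv> {f :: 'c \<Rightarrow> nat. \<forall>c. f c < M}"
  shows "\<exists>w. \<forall>e\<in>E. (\<Sum>x\<in>E. w x * (\<Prod>c\<in>UNIV. real (x c) ^ e c)) = \<kappa> e"
proof -
  obtain u :: "nat \<Rightarrow> nat \<Rightarrow> real" where
    u: "\<And>m m'. m < M \<Longrightarrow> m' < M \<Longrightarrow> (\<Sum>x<M. u m x * real x ^ m') = (if m = m' then 1 else 0)"
    using vandermonde_dual[of M] by auto
  have E: "E = PiE UNIV (\<lambda>_. {..<M})"
    by (auto simp: E_def PiE_iff)
  then have fin: "finite E" by (simp add: finite_PiE)
  define w where "w x = (\<Sum>e\<in>E. \<kappa> e * (\<Prod>c\<in>UNIV. u (e c) (x c)))" for x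
  have "(\<Sum>x\<in>E. w x * (\<Prod>c\<in>UNIV. real (x c) ^ e' c)) = \<kappa> e'" if e': "e' \<in> E" for e'
  proof -
    have "(\<Sum>x\<in>E. w x * (\<Prod>c\<in>UNIV. real (x c) ^ e' c)) =
        (\<Sum>x\<in>E. \<Sum>e\<in>E. \<kappa> e * (\<Prod>c\<in>UNIV. u (e c) (x c) * real (x c) ^ e' c))"
      by (simp add: w_def sum_distrib_right prod.distrib mult.assoc)
    also have "\<dots> = (\<Sum>e\<in>E. \<kappa> e * (\<Sum>x\<in>E. \<Prod>c\<in>UNIV. u (e c) (x c) * real (x c) ^ e' c))"
      by (subst sum.swap) (simp add: sum_distrib_left)
    also have "\<dots> = (\<Sum>e\<in>E. \<kappa> e * (\<Prod>c\<in>UNIV. \<Sum>x<M. u (e c) x * real x ^ e' c))"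
      unfolding E by (subst prod_sum_PiE) auto
    also have "\<dots> = (\<Sum>e\<in>E. if e = e' then \<kappa> e else 0)"
    proof (rule sum.cong[OF refl])
      fix e assume e: "e \<in> E"
      have "(\<Prod>c\<in>UNIV. \<Sum>x<M. u (e c) x * real x ^ e' c) = (\<Prod>c\<in>UNIV. if e c = e' c then 1 else 0)"
        using e e' by (intro prod.cong refl u) (auto simp: E_def)
      also have "\<dots> = (if e = e' then 1 else 0)"
      proof (cases "e = e'")
        case False
        then obtain c where "e c \<noteq> e' c" by auto
        then have "(\<Prod>c\<in>UNIV. if e c = e' c then 1 else 0 :: real) = 0"
          by (intro prod_zero) auto
        with False show ?thesis by simp
      qed simp
      finally show "\<kappa> e * (\<Prod>c\<in>UNIV. \<Sum>x<M. u (e c) x * real x ^ e' c) = (if e = e' then \<kappa> e else 0)"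
        by simp
    qed
    also have "\<dots> = \<kappa> e'" using e' fin by simp
    finally show ?thesis .
  qed
  then show ?thesis by blast
qed

context
  fixes k :: nat
begin

definition kern :: "(nat \<times> 'n::finite \<Rightarrow> 'n) \<Rightarrow> (nat \<times> 'n \<Rightarrow> 'n) \<Rightarrow> int" where
  "kern s r = (\<Sum>g\<in>row_words k. eps k g s * eps k g r)"

definition pair_count :: "(nat \<times> 'n::finite \<Rightarrow> 'n) \<Rightarrow> (nat \<times> 'n \<Rightarrow> 'n) \<Rightarrow> 'n \<times> 'n \<Rightarrow> nat" where
  "pair_count s r c = card {i \<in> cells k. (s i, r i) = c}"

lemma kern_comp:
  assumes p: "p permutes cells k"
  shows "kern (s \<circ> p) (r \<circ> p) = kern s r"
proof -
  have "kern (s \<circ> p) (r \<circ> p) = (\<Sum>g\<in>row_words k. eps k (g \<circ> p) (s \<circ> p) * eps k (g \<circ> p) (r \<circ> p))"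
    using sum.reindex_bij_betw[OF bij_row_words[OF p], of "\<lambda>g. eps k g (s \<circ> p) * eps k g (r \<circ> p)"]
    by (simp only: kern_def)
  also have "\<dots> = (\<Sum>g\<in>row_words k. (sign p * sign p) * (eps k g s * eps k g r))"
    by (simp only: eps_comp[OF p] mult_ac)
  also have "\<dots> = kern s r"
    by (simp add: kern_def)
  finally show ?thesis .
qed

text \<open>Equal multiplicities mean that one pair of words arises from the other by a permutation
  of the cells. Its sign enters each summand twice.\<close>

lemma kern_eq_if_pair_count_eq:
  assumes "pair_count s r = pair_count s' r'"
  shows "kern s r = kern s' r'"
proof -
  have "image_mset (\<lambda>i. (s i, r i)) (mset_set (cells k)) = image_mset (\<lambda>i. (s' i, r' i)) (mset_set (cells k))"
  proof (rule multiset_eqI)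
    fix c
    show "count (image_mset (\<lambda>i. (s i, r i)) (mset_set (cells k))) c =
      count (image_mset (\<lambda>i. (s' i, r' i)) (mset_set (cells k))) c"
      using fun_cong[OF assms, of c] by (simp add: count_image_mset_eq_card_vimage pair_count_def)
  qed
  then obtain p where p: "p permutes cells k" "\<forall>i\<in>cells k. (s i, r i) = (s' (p i), r' (p i))"
    by (rule image_mset_eq_implies_permutes[OF finite_cells]) (rule that, assumption, assumption)
  have "kern s r = kern (s' \<circ> p) (r' \<circ> p)"
    unfolding kern_def using p(2) by (intro sum.cong arg_cong2[where f = "(*)"] eps_cong) auto
  then show ?thesis by (simp add: kern_comp[OF p(1)])
qed

lemma prod_cells_eq_pair_count:
  fixes f :: "'n::finite \<times> 'n \<Rightarrow> 'a::comm_monoid_mult"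
  shows "(\<Prod>i\<in>cells k. f (s i, r i)) = (\<Prod>c\<in>UNIV. f c ^ pair_count s r c)"
proof -
  have "(\<Prod>i\<in>cells k. f (s i, r i)) = (\<Prod>c\<in>UNIV. \<Prod>i\<in>{i \<in> cells k. (s i, r i) = c}. f (s i, r i))"
    by (rule prod.group[symmetric]) auto
  also have "\<dots> = (\<Prod>c\<in>UNIV. f c ^ pair_count s r c)"
    by (intro prod.cong refl) (simp add: pair_count_def)
  finally show ?thesis .
qed

text \<open>As a function of multiplicities the kernel can be interpolated by monomials, and a
  monomial in the entries of x with exponents \<open>pair_count s r\<close> is the entry (s, r) of
  the tensor power of x.\<close>

lemma kern_combination_tensor_powers:
  obtains A :: "('n::finite \<times> 'n \<Rightarrow> nat) set" and w :: "('n \<times> 'n \<Rightarrow> nat) \<Rightarrow> real" where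
    "\<And>s r. real_of_int (kern s r) = (\<Sum>x\<in>A. w x * (\<Prod>i\<in>cells k. real (x (s i, r i))))"
proof -
  \<comment> \<open>No multiplicity exceeds the number of cells, so all exponents lie strictly below
    \<open>M\<close>.\<close>
  define M where "M = Suc (card (cells k :: (nat \<times> 'n) set))"
  \<comment> \<open>The kernel as a function of multiplicities. Any pair of words realising e gives
    the same value, so the choice is harmless.\<close>
  define \<kappa> where "\<kappa> e = real_of_int (let z = (SOME z. pair_count (fst z) (snd z) = e) in kern (fst z) (snd z))"
    for e :: "'n \<times> 'n \<Rightarrow> nat"
  obtain w :: "('n \<times> 'n \<Rightarrow> nat) \<Rightarrow> real" where
    w: "\<And>e. (\<forall>c. e c < M) \<Longrightarrow> (\<Sum>x\<in>{f. \<forall>c. f c < M}. w x * (\<Prod>c\<in>UNIV. real (x c) ^ e c)) = \<kappa> e"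
    using monomial_interpolation[of M \<kappa>] by auto
  have "real_of_int (kern s r) = (\<Sum>x\<in>{f. \<forall>c. f c < M}. w x * (\<Prod>i\<in>cells k. real (x (s i, r i))))"
    for s r :: "nat \<times> 'n \<Rightarrow> 'n"
  proof -
    define z where "z = (SOME z. pair_count (fst z) (snd z) = pair_count s r)"
    have "pair_count (fst z) (snd z) = pair_count s r"
      unfolding z_def by (rule someI[of _ "(s, r)"]) simp
    then have "kern (fst z) (snd z) = kern s r"
      by (rule kern_eq_if_pair_count_eq)
    then have "\<kappa> (pair_count s r) = kern s r"
      by (simp only: \<kappa>_def Let_def z_def[symmetric])
    moreover have "pair_count s r c < M" for c
      unfolding M_def pair_count_def less_Suc_eq_le by (rule card_mono) auto
    ultimately show ?thesis
      using w[of "pair_count s r"] by (simp only: prod_cells_eq_pair_count[of "\<lambda>c. real (_ c)"] simp_thms)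
  qed
  then show ?thesis by (rule that)
qed

text \<open>\<tau> is a vector of a tensor power of the standard representation, with words as
  coordinates. The set of matrices is a parameter, so that it can be enlarged from the unitary group
  to all real matrices.\<close>

definition det_covariant :: "(complex^'n^'n) set \<Rightarrow> ((nat \<times> 'n::finite \<Rightarrow> 'n) \<Rightarrow> complex) \<Rightarrow> bool" where
  "det_covariant \<X> \<tau> \<longleftrightarrow> (\<forall>X\<in>\<X>. \<forall>s\<in>col_words k.
     (\<Sum>r\<in>col_words k. (\<Prod>i\<in>cells k. X $ s i $ r i) * \<tau> r) = det X ^ k * \<tau> s)"

text \<open>Writing the kernel as a combination of tensor powers exhibits c as the same combination
  of values \<open>det X ^ k\<close>. To see c \<noteq> 0, the quadratic form of the kernel is
  evaluated at one covariant vector: it is a sum of squares, one of them positive.\<close>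

lemma kern_eigenvalue:
  obtains c :: complex where "c \<noteq> 0"
    "\<And>\<tau> s. det_covariant (range (map_matrix complex_of_real)) \<tau> \<Longrightarrow> s \<in> col_words k \<Longrightarrow>
       (\<Sum>r\<in>col_words k. of_int (kern s r) * \<tau> r) = c * \<tau> (s :: nat \<times> 'n::finite \<Rightarrow> 'n)"
proof -
  obtain A :: "('n \<times> 'n \<Rightarrow> nat) set" and w :: "('n \<times> 'n \<Rightarrow> nat) \<Rightarrow> real" where
    w: "\<And>s r. real_of_int (kern s r) = (\<Sum>x\<in>A. w x * (\<Prod>i\<in>cells k. real (x (s i, r i))))"
    by (rule kern_combination_tensor_powers) (rule that, assumption)
  define X where "X x = (\<chi> a b. complex_of_nat (x (a, b)))" for x :: "'n \<times> 'n \<Rightarrow> nat"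
  have X: "X x \<in> range (map_matrix complex_of_real)" for x
    by (rule image_eqI[of _ _ "\<chi> a b. real (x (a, b))"]) (simp_all add: X_def map_matrix_def vec_eq_iff)
  have kern: "of_int (kern s r) = (\<Sum>x\<in>A. of_real (w x) * (\<Prod>i\<in>cells k. X x $ s i $ r i))" for s r
  proof -
    have "of_int (kern s r) = complex_of_real (real_of_int (kern s r))" by simp
    also have "\<dots> = (\<Sum>x\<in>A. of_real (w x) * (\<Prod>i\<in>cells k. X x $ s i $ r i))"
      by (simp add: w X_def)
    finally show ?thesis .
  qed
  define c where "c = (\<Sum>x\<in>A. of_real (w x) * det (X x) ^ k)"
  have c: "(\<Sum>r\<in>col_words k. of_int (kern s r) * \<tau> r) = c * \<tau> s"
    if \<tau>: "det_covariant (range (map_matrix complex_of_real)) \<tau>" and s: "s \<in> col_words k"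
    for \<tau> and s :: "nat \<times> 'n \<Rightarrow> 'n"
  proof -
    have "(\<Sum>r\<in>col_words k. of_int (kern s r) * \<tau> r) =
       (\<Sum>r\<in>col_words k. \<Sum>x\<in>A. of_real (w x) * ((\<Prod>i\<in>cells k. X x $ s i $ r i) * \<tau> r))"
      by (simp only: kern sum_distrib_right mult.assoc)
    also have "\<dots> = (\<Sum>x\<in>A. of_real (w x) * (\<Sum>r\<in>col_words k. (\<Prod>i\<in>cells k. X x $ s i $ r i) * \<tau> r))"
      by (subst sum.swap) (simp only: sum_distrib_left)
    also have "\<dots> = (\<Sum>x\<in>A. of_real (w x) * (det (X x) ^ k * \<tau> s))"
      using \<tau>[unfolded det_covariant_def, rule_format, OF X s] by simp
    finally show ?thesis
      by (simp add: c_def sum_distrib_right mult.assoc)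
  qed
  \<comment> \<open>The test vector is nonzero because it has value 1 at the word
    \<open>snd\<close>, restricted to the cells.\<close>
  define g0 where "g0 = restrict fst (cells k :: (nat \<times> 'n) set)"
  have g0: "g0 \<in> row_words k"
    by (auto simp: g0_def row_words_def cells_def)
  define e where "e s = eps k g0 s" for s
  have "det_covariant UNIV (\<lambda>s. of_int (e s))"
    unfolding det_covariant_def e_def using sum_words_eps[OF g0] by blast
  then have cov: "det_covariant (range (map_matrix complex_of_real)) (\<lambda>s. of_int (e s))"
    by (auto simp: det_covariant_def)
  \<comment> \<open>The right-hand side is the quadratic form of the kernel at \<open>e\<close>; the
    eigenvalue gives one evaluation, the definition of \<open>kern\<close> as a sum over g the
    other.\<close>
  have "c * of_int (\<Sum>s\<in>col_words k. e s * e s) =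
      (\<Sum>s\<in>col_words k. of_int (e s) * (\<Sum>r\<in>col_words k. of_int (kern s r) * of_int (e r)))"
  proof -
    have "(\<Sum>s\<in>col_words k. of_int (e s) * (\<Sum>r\<in>col_words k. of_int (kern s r) * of_int (e r))) =
        (\<Sum>s\<in>col_words k. of_int (e s) * (c * of_int (e s)))"
      by (intro sum.cong refl) (simp only: c[OF cov])
    also have "\<dots> = (\<Sum>s\<in>col_words k. c * of_int (e s * e s))"
      by (intro sum.cong refl) simp
    also have "\<dots> = c * of_int (\<Sum>s\<in>col_words k. e s * e s)"
      by (simp only: sum_distrib_left of_int_sum)
    finally show ?thesis by (rule sym)
  qed
  also have "\<dots> = of_int (\<Sum>s\<in>col_words k. e s * (\<Sum>r\<in>col_words k. kern s r * e r))"
    by simp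
  also have "(\<Sum>s\<in>col_words k. e s * (\<Sum>r\<in>col_words k. kern s r * e r)) =
      (\<Sum>g\<in>row_words k. (\<Sum>s\<in>col_words k. eps k g s * e s)^2)"
  proof -
    have "(\<Sum>s\<in>col_words k. e s * (\<Sum>r\<in>col_words k. kern s r * e r)) =
      (\<Sum>s\<in>col_words k. \<Sum>r\<in>col_words k. \<Sum>g\<in>row_words k. (eps k g s * e s) * (eps k g r * e r))"
      by (simp only: kern_def sum_distrib_left sum_distrib_right mult_ac)
    also have "\<dots> = (\<Sum>g\<in>row_words k. \<Sum>s\<in>col_words k. \<Sum>r\<in>col_words k. (eps k g s * e s) * (eps k g r * e r))"
      by (rule trans[OF sum.cong[OF refl sum.swap] sum.swap])
    finally show ?thesis
      by (simp add: power2_eq_square sum_product)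
  qed
  finally have eq: "c * of_int (\<Sum>s\<in>col_words k. e s * e s) =
    of_int (\<Sum>g\<in>row_words k. (\<Sum>s\<in>col_words k. eps k g s * e s)^2)" .
  define s0 where "s0 = restrict snd (cells k :: (nat \<times> 'n) set)"
  have s0: "s0 \<in> col_words k"
    by (auto simp: s0_def col_words_def)
  have "e s0 = eps k fst (snd :: nat \<times> 'n \<Rightarrow> 'n)"
    unfolding e_def by (rule eps_cong) (simp_all add: g0_def s0_def)
  then have e0: "e s0 = 1" by (simp add: eps_fst_snd)
  have pos: "(\<Sum>s\<in>col_words k. e s * e s) > 0"
    using s0 e0 by (intro sum_pos2[of _ s0]) auto
  have "(\<Sum>g\<in>row_words k. (\<Sum>s\<in>col_words k. eps k g s * e s)^2) > 0"
    using g0 pos by (intro sum_pos2[of _ g0]) (auto simp: e_def)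
  then have "complex_of_int (\<Sum>g\<in>row_words k. (\<Sum>s\<in>col_words k. eps k g s * e s)^2) \<noteq> 0"
    by (simp only: of_int_eq_0_iff)
  with eq have "c \<noteq> 0" by (metis mult_zero_left)
  with c show ?thesis using that by blast
qed

end

section \<open>From unitary to arbitrary matrices\<close>

lemma poly_det_poly:
  fixes U :: "complex^'n^'n"
  shows "poly (det_poly U) x = det (mat 1 + map_matrix (\<lambda>z. x * z) U)"
  unfolding det_poly_def det_def poly_sum
  by (intro sum.cong refl)
    (auto simp: poly_prod map_matrix_def mat_def poly_monom mult.commute intro!: arg_cong2[where f = "(*)"] prod.cong)

lemma poly_det_poly_0: "poly (det_poly U) 0 = 1"
proof -
  have "map_matrix (\<lambda>z. 0 * z) U = 0"
    by (simp add: vec_eq_iff map_matrix_def)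
  then show ?thesis by (simp add: poly_det_poly)
qed

section \<open>Diagonal matrices and matrices acting in a coordinate plane\<close>

definition diag_matrix :: "('n \<Rightarrow> complex) \<Rightarrow> complex^'n^'n" where
  "diag_matrix z = (\<chi> i j. if i = j then z i else 0)"

lemma det_diag_matrix: "det (diag_matrix z) = (\<Prod>i\<in>UNIV. z i)"
  by (subst det_diagonal) (auto simp: diag_matrix_def)

lemma diag_matrix_mult: "diag_matrix y ** diag_matrix z = diag_matrix (\<lambda>i. y i * z i)"
proof -
  have "(\<Sum>l\<in>UNIV. (if i = l then y i else 0) * (if l = j then z l else 0)) =
      (\<Sum>l\<in>UNIV. if l = i then (if i = j then y i * z i else 0) else 0)" for i j
    by (rule sum.cong) auto
  then show ?thesis
    by (simp add: diag_matrix_def matrix_matrix_mult_def vec_eq_iff)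
qed

lemma diag_matrix_unitary:
  assumes "\<And>i. cmod (z i) = 1"
  shows "diag_matrix z \<in> unitary_group"
proof -
  have "conj_transpose (diag_matrix z) = diag_matrix (\<lambda>i. cnj (z i))"
    by (auto simp: conj_transpose_def diag_matrix_def map_matrix_def transpose_def vec_eq_iff)
  moreover have "cnj (z i) * z i = 1" "z i * cnj (z i) = 1" for i
    using assms[of i] complex_norm_square[of "z i"] by (simp_all add: mult.commute)
  moreover have "diag_matrix (\<lambda>_. 1) = mat 1"
    by (auto simp: diag_matrix_def mat_def vec_eq_iff)
  ultimately show ?thesis
    by (simp add: unitary_group_def diag_matrix_mult)
qed

text \<open>One family for rotations, transpositions, shears and scalings of one coordinate;
  products follow the rule for 2 by 2 matrices.\<close>

definition plane_matrix :: "'n \<Rightarrow> 'n \<Rightarrow> complex \<Rightarrow> complex \<Rightarrow> complex \<Rightarrow> complex \<Rightarrow> complex^'n^'n" where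
  "plane_matrix p q a b c d = (\<chi> i j.
     if i = p then (if j = p then a else if j = q then b else 0)
     else if i = q then (if j = p then c else if j = q then d else 0)
     else of_bool (i = j))"

lemma plane_matrix_mult:
  assumes "p \<noteq> q"
  shows "plane_matrix p q a b c d ** plane_matrix p q a' b' c' d' =
    plane_matrix p q (a * a' + b * c') (a * b' + b * d') (c * a' + d * c') (c * b' + d * d')"
proof -
  let ?A = "plane_matrix p q a b c d" and ?B = "plane_matrix p q a' b' c' d'"
  have two: "(\<Sum>l\<in>UNIV. ?A $ i $ l * ?B $ l $ j) = ?A $ i $ p * ?B $ p $ j + ?A $ i $ q * ?B $ q $ j"
    if "i = p \<or> i = q" for i j
  proof -
    have "(\<Sum>l\<in>UNIV. ?A $ i $ l * ?B $ l $ j) = (\<Sum>l\<in>{p, q}. ?A $ i $ l * ?B $ l $ j)"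
      using that by (intro sum.mono_neutral_right) (auto simp: plane_matrix_def)
    then show ?thesis using assms by simp
  qed
  have one: "(\<Sum>l\<in>UNIV. ?A $ i $ l * ?B $ l $ j) = ?B $ i $ j" if "i \<noteq> p" "i \<noteq> q" for i j
  proof -
    have "(\<Sum>l\<in>UNIV. ?A $ i $ l * ?B $ l $ j) = (\<Sum>l\<in>{i}. ?A $ i $ l * ?B $ l $ j)"
      using that by (intro sum.mono_neutral_right) (auto simp: plane_matrix_def)
    then show ?thesis using that by (simp add: plane_matrix_def)
  qed
  have "(\<Sum>l\<in>UNIV. ?A $ i $ l * ?B $ l $ j) = plane_matrix p q (a * a' + b * c') (a * b' + b * d')
      (c * a' + d * c') (c * b' + d * d') $ i $ j" for i j
  proof (cases "i = p \<or> i = q")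
    case True
    show ?thesis unfolding two[OF True] using True assms by (auto simp: plane_matrix_def)
  next
    case False
    then have i: "i \<noteq> p" "i \<noteq> q" by auto
    show ?thesis unfolding one[OF i] using i by (simp add: plane_matrix_def)
  qed
  then show ?thesis
    by (simp add: matrix_matrix_mult_def vec_eq_iff)
qed

lemma plane_matrix_id: "p \<noteq> q \<Longrightarrow> plane_matrix p q 1 0 0 1 = mat 1"
  by (auto simp: plane_matrix_def mat_def vec_eq_iff)

lemma plane_matrix_unitary:
  assumes "p \<noteq> q" "a * cnj a + b * cnj b = 1" "c * cnj c + d * cnj d = 1" "a * cnj c + b * cnj d = 0"
    "cnj a * a + cnj c * c = 1" "cnj b * b + cnj d * d = 1" "cnj a * b + cnj c * d = 0"
  shows "plane_matrix p q a b c d \<in> unitary_group"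
proof -
  have ct: "conj_transpose (plane_matrix p q a b c d) = plane_matrix p q (cnj a) (cnj c) (cnj b) (cnj d)"
    using assms(1) by (auto simp: conj_transpose_def plane_matrix_def map_matrix_def transpose_def vec_eq_iff)
  have "c * cnj a + d * cnj b = 0" "cnj b * a + cnj d * c = 0"
    using arg_cong[OF assms(4), of cnj] arg_cong[OF assms(7), of cnj] by (simp_all add: mult.commute)
  with assms show ?thesis
    by (simp add: unitary_group_def ct plane_matrix_mult plane_matrix_id)
qed

lemma map_matrix_of_real_mult:
  "map_matrix complex_of_real (A ** B) = map_matrix complex_of_real A ** map_matrix complex_of_real B"
  by (simp add: matrix_matrix_mult_def map_matrix_def vec_eq_iff)

section \<open>Closure properties of covariance\<close>

lemma det_covariant_singleton: "det_covariant k {X} \<tau> \<longleftrightarrow> (\<forall>s\<in>col_words k.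
     (\<Sum>r\<in>col_words k. (\<Prod>i\<in>cells k. X $ s i $ r i) * \<tau> r) = det X ^ k * \<tau> s)"
  by (simp add: det_covariant_def)

lemma prod_matrix_mult_words:
  fixes X Y :: "complex^'n^'n"
  shows "(\<Prod>i\<in>cells k. (X ** Y) $ s i $ r i) =
    (\<Sum>q\<in>col_words k. (\<Prod>i\<in>cells k. X $ s i $ q i) * (\<Prod>i\<in>cells k. Y $ q i $ r i))"
proof -
  have "(\<Prod>i\<in>cells k. (X ** Y) $ s i $ r i) = (\<Prod>i\<in>cells k. \<Sum>l\<in>UNIV. X $ s i $ l * Y $ l $ r i)"
    by (simp add: matrix_matrix_mult_def)
  also have "\<dots> = (\<Sum>q\<in>col_words k. \<Prod>i\<in>cells k. X $ s i $ q i * Y $ q i $ r i)"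
    unfolding col_words_def by (rule prod_sum_PiE) auto
  finally show ?thesis
    by (simp add: prod.distrib)
qed

lemma det_covariant_mult:
  fixes X Y :: "complex^'n^'n"
  assumes "det_covariant k {X} \<tau>" "det_covariant k {Y} \<tau>"
  shows "det_covariant k {X ** Y} \<tau>"
  unfolding det_covariant_singleton
proof
  fix s :: "nat \<times> 'n \<Rightarrow> 'n" assume s: "s \<in> col_words k"
  have "(\<Sum>r\<in>col_words k. (\<Prod>i\<in>cells k. (X ** Y) $ s i $ r i) * \<tau> r) =
      (\<Sum>r\<in>col_words k. (\<Sum>q\<in>col_words k. (\<Prod>i\<in>cells k. X $ s i $ q i) * (\<Prod>i\<in>cells k. Y $ q i $ r i)) * \<tau> r)"
    by (simp only: prod_matrix_mult_words)
  also have "\<dots> = (\<Sum>r\<in>col_words k. \<Sum>q\<in>col_words k.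
      (\<Prod>i\<in>cells k. X $ s i $ q i) * ((\<Prod>i\<in>cells k. Y $ q i $ r i) * \<tau> r))"
    by (simp only: sum_distrib_right mult.assoc)
  also have "\<dots> = (\<Sum>q\<in>col_words k. (\<Prod>i\<in>cells k. X $ s i $ q i) *
      (\<Sum>r\<in>col_words k. (\<Prod>i\<in>cells k. Y $ q i $ r i) * \<tau> r))"
    by (subst sum.swap) (simp only: sum_distrib_left)
  also have "\<dots> = (\<Sum>q\<in>col_words k. (\<Prod>i\<in>cells k. X $ s i $ q i) * (det Y ^ k * \<tau> q))"
    by (intro sum.cong refl arg_cong2[where f = "(*)"] assms(2)[unfolded det_covariant_singleton, rule_format])
  also have "\<dots> = det Y ^ k * (\<Sum>q\<in>col_words k. (\<Prod>i\<in>cells k. X $ s i $ q i) * \<tau> q)"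
    by (simp only: sum_distrib_left mult_ac)
  also have "\<dots> = det Y ^ k * (det X ^ k * \<tau> s)"
    by (simp only: assms(1)[unfolded det_covariant_singleton, rule_format, OF s])
  finally show "(\<Sum>r\<in>col_words k. (\<Prod>i\<in>cells k. (X ** Y) $ s i $ r i) * \<tau> r) = det (X ** Y) ^ k * \<tau> s"
    by (simp add: det_mul power_mult_distrib)
qed

text \<open>Covariance is a set of polynomial identities in the entries, hence a closed condition.
  Shears and singular matrices are reached in this way.\<close>

lemma det_covariant_limit:
  fixes X :: "'b \<Rightarrow> complex^'n^'n"
  assumes lim: "\<And>i j. ((\<lambda>n. X n $ i $ j) \<longlongrightarrow> Y $ i $ j) F" and "F \<noteq> bot"
    and ev: "eventually (\<lambda>n. det_covariant k {X n} \<tau>) F"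
  shows "det_covariant k {Y} \<tau>"
  unfolding det_covariant_singleton
proof
  fix s :: "nat \<times> 'n \<Rightarrow> 'n" assume s: "s \<in> col_words k"
  have l: "((\<lambda>n. \<Sum>r\<in>col_words k. (\<Prod>i\<in>cells k. X n $ s i $ r i) * \<tau> r) \<longlongrightarrow>
      (\<Sum>r\<in>col_words k. (\<Prod>i\<in>cells k. Y $ s i $ r i) * \<tau> r)) F"
    by (intro tendsto_intros lim)
  have r: "((\<lambda>n. det (X n) ^ k * \<tau> s) \<longlongrightarrow> det Y ^ k * \<tau> s) F"
    unfolding det_def by (intro tendsto_intros lim)
  have "eventually (\<lambda>n. (\<Sum>r\<in>col_words k. (\<Prod>i\<in>cells k. X n $ s i $ r i) * \<tau> r) = det (X n) ^ k * \<tau> s) F"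
    using ev by eventually_elim (use s in \<open>auto simp: det_covariant_singleton\<close>)
  from tendsto_cong[OF this] l have "((\<lambda>n. det (X n) ^ k * \<tau> s) \<longlongrightarrow>
      (\<Sum>r\<in>col_words k. (\<Prod>i\<in>cells k. Y $ s i $ r i) * \<tau> r)) F"
    by simp
  from tendsto_unique[OF \<open>F \<noteq> bot\<close> this r]
  show "(\<Sum>r\<in>col_words k. (\<Prod>i\<in>cells k. Y $ s i $ r i) * \<tau> r) = det Y ^ k * \<tau> s" .
qed

lemma prod_diag_words:
  assumes "s \<in> col_words k" "r \<in> col_words k"
  shows "(\<Prod>i\<in>cells k. diag_matrix z $ s i $ r i) = (if r = s then \<Prod>i\<in>cells k. z (s i) else 0)"
proof (cases "r = s")
  case False
  then obtain i where "i \<in> cells k" "s i \<noteq> r i"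
    using assms unfolding col_words_def by (metis PiE_ext)
  then have "(\<Prod>i\<in>cells k. diag_matrix z $ s i $ r i) = 0"
    by (intro prod_zero) (auto simp: diag_matrix_def)
  with False show ?thesis by simp
qed (simp add: diag_matrix_def)

text \<open>A diagonal matrix multiplies the coordinate \<open>\<tau> s\<close> by a monomial in its
  entries, so covariance splits into one condition per word.\<close>

lemma det_covariant_diag_iff:
  "det_covariant k {diag_matrix z} \<tau> \<longleftrightarrow>
     (\<forall>s\<in>col_words k. (\<Prod>p\<in>UNIV. z p ^ card {i \<in> cells k. s i = p}) * \<tau> s = (\<Prod>p\<in>UNIV. z p ^ k) * \<tau> s)"
proof -
  have "(\<Sum>r\<in>col_words k. (\<Prod>i\<in>cells k. diag_matrix z $ s i $ r i) * \<tau> r) =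
      (\<Prod>p\<in>UNIV. z p ^ card {i \<in> cells k. s i = p}) * \<tau> s" if s: "s \<in> col_words k" for s
  proof -
    have "(\<Sum>r\<in>col_words k. (\<Prod>i\<in>cells k. diag_matrix z $ s i $ r i) * \<tau> r) =
        (\<Sum>r\<in>col_words k. if r = s then (\<Prod>i\<in>cells k. z (s i)) * \<tau> s else 0)"
      by (rule sum.cong) (auto simp: prod_diag_words[OF s])
    also have "\<dots> = (\<Prod>i\<in>cells k. z (s i)) * \<tau> s"
      using s by simp
    also have "(\<Prod>i\<in>cells k. z (s i)) = (\<Prod>p\<in>UNIV. \<Prod>i\<in>{i \<in> cells k. s i = p}. z (s i))"
      by (rule prod.group[symmetric]) auto
    finally show ?thesis by simp
  qed
  then show ?thesis
    by (simp add: det_covariant_singleton det_diag_matrix prod_power_distrib)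
qed

text \<open>A primitive root of unity of order m + k + 1 separates the two exponents.\<close>

lemma unit_power_eq_imp_eq:
  assumes "\<And>w :: complex. cmod w = 1 \<Longrightarrow> w ^ m = w ^ k"
  shows "m = (k::nat)"
proof -
  define M where "M = Suc (m + k)"
  have "0 < M" by (simp add: M_def)
  note bij = Complex.bij_betw_roots_unity[OF this]
  have "cis (2 * pi / real M) ^ m = cis (2 * pi / real M) ^ k"
    by (rule assms) simp
  then have "cis (2 * pi * real m / real M) = cis (2 * pi * real k / real M)"
    by (simp add: Complex.DeMoivre mult_ac)
  then show ?thesis
    using bij_betw_imp_inj_on[OF bij] by (auto simp: inj_on_def M_def)
qed

text \<open>Unitary diagonal matrices already force each letter to occur exactly k times in every
  word where \<tau> is nonzero. After that the modulus of the entries is irrelevant.\<close>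

lemma det_covariant_unitary_imp_diag:
  fixes \<tau> :: "(nat \<times> 'n::finite \<Rightarrow> 'n) \<Rightarrow> complex"
  assumes cov: "\<And>V. V \<in> unitary_group \<Longrightarrow> det_covariant k {V} \<tau>"
  shows "det_covariant k {diag_matrix z} \<tau>"
  unfolding det_covariant_diag_iff
proof
  fix s :: "nat \<times> 'n \<Rightarrow> 'n" assume s: "s \<in> col_words k"
  show "(\<Prod>p\<in>UNIV. z p ^ card {i \<in> cells k. s i = p}) * \<tau> s = (\<Prod>p\<in>UNIV. z p ^ k) * \<tau> s"
  proof (cases "\<tau> s = 0")
    case False
    have "card {i \<in> cells k. s i = p} = k" for p
    proof (rule unit_power_eq_imp_eq)
      fix w :: complex assume w: "cmod w = 1"
      define y where "y q = (if q = p then w else 1)" for q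
      have "det_covariant k {diag_matrix y} \<tau>"
        using w by (intro cov diag_matrix_unitary) (simp add: y_def)
      then have "(\<Prod>q\<in>UNIV. y q ^ card {i \<in> cells k. s i = q}) = (\<Prod>q\<in>UNIV. y q ^ k)"
        using s False by (auto simp: det_covariant_diag_iff)
      moreover have "(\<Prod>q\<in>UNIV. y q ^ f q) = w ^ f p" for f
      proof -
        have "(\<Prod>q\<in>UNIV. y q ^ f q) = (\<Prod>q\<in>UNIV. if q = p then w ^ f p else 1)"
          by (rule prod.cong) (auto simp: y_def)
        then show ?thesis by simp
      qed
      ultimately show "w ^ card {i \<in> cells k. s i = p} = w ^ k" by simp
    qed
    then show ?thesis by simp
  qed simp
qed

text \<open>Conjugating the rotation by \<theta> with the diagonal matrix (1, sin \<theta> / b)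
  keeps the upper right entry equal to b, while the other entries tend to those of the shear as
  \<theta> tends to 0.\<close>

lemma det_covariant_shear:
  fixes \<tau> :: "(nat \<times> 'n::finite \<Rightarrow> 'n) \<Rightarrow> complex"
  assumes cov: "\<And>V. V \<in> unitary_group \<Longrightarrow> det_covariant k {V} \<tau>" and pq: "p \<noteq> q" and b: "b \<noteq> 0"
  shows "det_covariant k {plane_matrix p q 1 b 0 1} \<tau>"
proof (rule det_covariant_limit[where F = "at_right (0::real)"])
  let ?X = "\<lambda>\<theta>. plane_matrix p q (of_real (cos \<theta>)) b (- (of_real (sin \<theta>))\<^sup>2 / b) (of_real (cos \<theta>))"
  show "((\<lambda>\<theta>. ?X \<theta> $ i $ j) \<longlongrightarrow> plane_matrix p q 1 b 0 1 $ i $ j) (at_right 0)" for i j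
  proof -
    have 1: "((\<lambda>\<theta>. complex_of_real (cos \<theta>)) \<longlongrightarrow> 1) (at_right 0)"
      by (rule tendsto_eq_intros refl)+ simp
    have 2: "((\<lambda>\<theta>. - (complex_of_real (sin \<theta>))\<^sup>2 / b) \<longlongrightarrow> 0) (at_right 0)"
      by (rule tendsto_eq_intros refl b)+ simp
    show ?thesis
      using 1 2 by (auto simp: plane_matrix_def)
  qed
  show "eventually (\<lambda>\<theta>. det_covariant k {?X \<theta>} \<tau>) (at_right 0)"
    using eventually_at_right_real[OF pi_gt_zero]
  proof eventually_elim
    case (elim \<theta>)
    then have sin0: "sin \<theta> \<noteq> 0"
      using sin_gt_zero[of \<theta>] by auto
    define d where "d = complex_of_real (sin \<theta>) / b"
    have d: "d \<noteq> 0" using b sin0 by (simp add: d_def)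
    let ?D = "\<lambda>d. plane_matrix p q 1 0 0 d"
    let ?R = "plane_matrix p q (of_real (cos \<theta>)) (of_real (sin \<theta>)) (- of_real (sin \<theta>)) (of_real (cos \<theta>))"
    \<comment> \<open>\<open>?D d\<close> need not be unitary, but covariance under unitary matrices
      covers all diagonal ones.\<close>
    have D: "det_covariant k {?D d} \<tau>" for d
    proof -
      have "?D d = diag_matrix (\<lambda>i. if i = q then d else 1)"
        using pq by (auto simp: plane_matrix_def diag_matrix_def vec_eq_iff)
      then show ?thesis
        using det_covariant_unitary_imp_diag[OF cov] by simp
    qed
    have cs: "complex_of_real (cos \<theta>) * of_real (cos \<theta>) + of_real (sin \<theta>) * of_real (sin \<theta>) = 1"
      by (metis of_real_add of_real_mult of_real_1 sin_cos_squared_add3)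
    have "det_covariant k {?R} \<tau>"
      by (intro cov plane_matrix_unitary pq) (simp_all add: cs add.commute[of "of_real (sin \<theta>) * _"] mult.commute)
    then have "det_covariant k {?D d ** ?R ** ?D (1 / d)} \<tau>"
      by (intro det_covariant_mult D)
    also have "?D d ** ?R ** ?D (1 / d) = ?X \<theta>"
      using d b sin0 by (simp add: plane_matrix_mult[OF pq] d_def power2_eq_square)
    finally show ?case .
  qed
qed simp

text \<open>Elementary matrices generate the invertible real ones, and singular ones are limits of
  invertible ones. Real matrices suffice because the tensor powers that make up the kernel have
  natural entries.\<close>

lemma det_covariant_unitary_imp_real:
  fixes \<tau> :: "(nat \<times> 'n::finite \<Rightarrow> 'n) \<Rightarrow> complex"
  assumes "det_covariant k unitary_group \<tau>"
  shows "det_covariant k (range (map_matrix complex_of_real)) \<tau>"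
proof -
  let ?c = "map_matrix complex_of_real"
  have cov: "det_covariant k {V} \<tau>" if "V \<in> unitary_group" for V
    using assms that by (simp add: det_covariant_def)
  have one: "det_covariant k {mat 1} \<tau>"
  proof -
    have "mat 1 = diag_matrix (\<lambda>_ :: 'n. 1)"
      by (auto simp: diag_matrix_def mat_def vec_eq_iff)
    then show ?thesis using cov[OF diag_matrix_unitary[of "\<lambda>_. 1"]] by simp
  qed
  \<comment> \<open>The premise makes the case of a zero row vacuous, and both factors of an
    invertible product inherit it.\<close>
  have inv: "det (?c A) \<noteq> 0 \<longrightarrow> det_covariant k {?c A} \<tau>" for A :: "real^'n^'n"
  proof (induction A rule: induct_matrix_elementary)
    case (1 A B)
    then show ?case by (auto simp: map_matrix_of_real_mult det_mul intro: det_covariant_mult)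
  next
    case (2 A i)
    have "row i (?c A) = 0"
      using 2 by (simp add: row_def map_matrix_def vec_eq_iff)
    then show ?case by (simp add: det_zero_row)
  next
    case (3 A)
    have "?c A = diag_matrix (\<lambda>i. of_real (A $ i $ i))"
      using 3 by (auto simp: map_matrix_def diag_matrix_def vec_eq_iff)
    then show ?case using det_covariant_unitary_imp_diag[OF cov] by simp
  next
    case (4 m n)
    have "?c (\<chi> i j. mat 1 $ i $ Transposition.transpose m n j) = plane_matrix m n 0 1 1 0"
      using 4 by (auto simp: map_matrix_def plane_matrix_def vec_eq_iff mat_def Transposition.transpose_def)
    moreover have "plane_matrix m n 0 1 1 0 \<in> unitary_group"
      by (intro plane_matrix_unitary 4) simp_all
    ultimately show ?case using cov by simp
  next
    case (5 m n c)
    have eq: "?c (\<chi> i j. if i = m \<and> j = n then c else of_bool (i = j)) = plane_matrix m n 1 (of_real c) 0 1"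
      using 5 by (auto simp: map_matrix_def plane_matrix_def vec_eq_iff)
    show ?case
    proof (cases "c = 0")
      case True
      then show ?thesis using eq one 5 by (simp add: plane_matrix_id)
    next
      case False
      then show ?thesis unfolding eq using det_covariant_shear[OF cov 5, of "of_real c"] by simp
    qed
  qed
  have "det_covariant k {?c A} \<tau>" for A :: "real^'n^'n"
  proof (rule det_covariant_limit[where F = sequentially])
    let ?X = "\<lambda>m. A + (1 / real m) *\<^sub>R mat 1"
    show "(\<lambda>m. ?c (?X m) $ i $ j) \<longlonglongrightarrow> ?c A $ i $ j" for i j
    proof -
      have "(\<lambda>m. complex_of_real (A $ i $ j + (1 / real m) * (mat 1 :: real^'n^'n) $ i $ j)) \<longlonglongrightarrow>
          complex_of_real (A $ i $ j + 0 * (mat 1 :: real^'n^'n) $ i $ j)"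
        by (intro tendsto_intros lim_1_over_n)
      then show ?thesis by (simp add: map_matrix_def)
    qed
    \<comment> \<open>A + I / m is 1 / m times I + m A, and det (I + x A) is a polynomial in x with
      value 1 at 0. So it is invertible for all large m.\<close>
    have "det_poly (?c A) \<noteq> 0"
      using poly_det_poly_0[of "?c A"] by auto
    then have fin: "finite {x. poly (det_poly (?c A)) x = 0}"
      by (rule poly_roots_finite)
    have "inj complex_of_nat" by (simp add: inj_on_def)
    then have "finite {m. poly (det_poly (?c A)) (of_nat m) = 0}"
      using finite_vimageI[OF fin, of complex_of_nat] by (simp add: vimage_def)
    then have "eventually (\<lambda>m. poly (det_poly (?c A)) (of_nat m) \<noteq> 0) sequentially"
      by (simp add: cofinite_eq_sequentially[symmetric] eventually_cofinite)
    then show "eventually (\<lambda>m. det_covariant k {?c (?X m)} \<tau>) sequentially"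
      using eventually_gt_at_top[of 0]
    proof eventually_elim
      case (elim m)
      have "?c (?X m) = diag_matrix (\<lambda>_. 1 / of_nat m) ** (mat 1 + map_matrix (\<lambda>z. of_nat m * z) (?c A))"
      proof -
        have "(\<Sum>l\<in>UNIV. (if i = l then 1 / of_nat m else 0) * ((mat 1 :: complex^'n^'n) $ l $ j + of_nat m * of_real (A $ l $ j))) =
          (\<Sum>l\<in>UNIV. if l = i then 1 / of_nat m * ((mat 1 :: complex^'n^'n) $ l $ j + of_nat m * of_real (A $ l $ j)) else 0)" for i j
          by (rule sum.cong) auto
        then show ?thesis
          using elim by (simp add: vec_eq_iff map_matrix_def matrix_matrix_mult_def diag_matrix_def field_simps)
            (simp add: mat_def)
      qed
      then have "det (?c (?X m)) \<noteq> 0"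
        using elim by (simp add: det_mul det_diag_matrix poly_det_poly)
      with inv show ?case by blast
    qed
  qed simp
  then show ?thesis
    by (auto simp: det_covariant_def)
qed

section \<open>Moments of the Haar measure\<close>

lemma conj_transpose_mult: "conj_transpose (A ** B) = conj_transpose B ** conj_transpose A"
  by (simp add: conj_transpose_def map_matrix_def transpose_def matrix_matrix_mult_def vec_eq_iff mult.commute)

lemma unitary_group_mult:
  fixes U V :: "complex^'n^'n"
  assumes "U \<in> unitary_group" "V \<in> unitary_group"
  shows "U ** V \<in> unitary_group"
proof -
  have "conj_transpose V ** conj_transpose U ** (U ** V) = conj_transpose V ** (conj_transpose U ** U) ** V"
    "U ** V ** (conj_transpose V ** conj_transpose U) = U ** (V ** conj_transpose V) ** conj_transpose U"
    by (simp_all only: matrix_mul_assoc)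
  then show ?thesis
    using assms by (simp add: unitary_group_def conj_transpose_mult)
qed

lemma det_conj_transpose:
  fixes A :: "complex^'n^'n"
  shows "det (conj_transpose A) = cnj (det A)"
proof -
  have "det (map_matrix cnj A) = cnj (det A)" for A :: "complex^'n^'n"
    by (simp add: det_def map_matrix_def)
  then show ?thesis
    by (simp add: conj_transpose_def det_transpose)
qed

lemma det_unitary:
  assumes "U \<in> unitary_group"
  shows "cnj (det U) * det U = 1"
proof -
  have "det (conj_transpose U ** U) = 1"
    using assms by (simp add: unitary_group_def)
  then show ?thesis by (simp add: det_mul det_conj_transpose)
qed

lemma norm_det_unitary:
  assumes "U \<in> unitary_group"
  shows "cmod (det U) = 1"
proof -
  have "cmod (cnj (det U) * det U) = 1"
    using det_unitary[OF assms] by simp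
  then have "(cmod (det U))\<^sup>2 = 1"
    by (simp add: norm_mult power2_eq_square)
  then show ?thesis by (simp add: power2_eq_1_iff) (use norm_ge_zero[of "det U"] in linarith)
qed

lemma norm_entry_unitary:
  fixes U :: "complex^'n^'n"
  assumes "U \<in> unitary_group"
  shows "cmod (U $ i $ j) \<le> 1"
proof -
  have "(\<Sum>l\<in>UNIV. complex_of_real ((cmod (U $ i $ l))\<^sup>2)) = (U ** conj_transpose U) $ i $ i"
    by (simp add: matrix_matrix_mult_def conj_transpose_def map_matrix_def transpose_def complex_norm_square
        del: of_real_power)
  also have "\<dots> = 1"
    using assms by (simp add: unitary_group_def mat_def)
  finally have "complex_of_real (\<Sum>l\<in>UNIV. (cmod (U $ i $ l))\<^sup>2) = complex_of_real 1" by simp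
  then have "(\<Sum>l\<in>UNIV. (cmod (U $ i $ l))\<^sup>2) = 1"
    by (simp only: of_real_eq_iff)
  moreover have "(cmod (U $ i $ j))\<^sup>2 \<le> (\<Sum>l\<in>UNIV. (cmod (U $ i $ l))\<^sup>2)"
    by (rule member_le_sum) auto
  ultimately show ?thesis
    using power2_le_imp_le[of "cmod (U $ i $ j)" 1] by simp
qed

lemma continuous_on_det: "continuous_on A (\<lambda>U :: complex^'n^'n. det U)"
  unfolding det_def by (intro continuous_intros)

lemma haar_measurable:
  fixes f :: "complex^'n^'n \<Rightarrow> complex"
  assumes "haar_prob_measure M" "continuous_on UNIV f"
  shows "f \<in> borel_measurable M"
proof -
  have "f \<in> borel_measurable (restrict_space borel unitary_group)"
    using borel_measurable_continuous_onI[OF assms(2)] by (rule measurable_restrict_space1)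
  moreover have "sets M = sets (restrict_space borel unitary_group)"
    using assms(1) by (simp add: haar_prob_measure_def)
  ultimately show ?thesis
    using measurable_cong_sets[of M "restrict_space borel unitary_group" borel borel] by simp
qed

lemma haar_integrable:
  fixes f :: "complex^'n^'n \<Rightarrow> complex"
  assumes M: "haar_prob_measure M" and "continuous_on UNIV f"
    and bound: "\<And>U. U \<in> unitary_group \<Longrightarrow> cmod (f U) \<le> B"
  shows "integrable M f"
proof -
  interpret prob_space M using M by (simp add: haar_prob_measure_def)
  show ?thesis
  proof (rule integrable_const_bound[where B = B])
    show "AE x in M. cmod (f x) \<le> B"
      using M bound by (intro AE_I2) (simp add: haar_prob_measure_def)
  qed (rule haar_measurable[OF assms(1,2)])
qed

lemma haar_left_invariant:
  fixes f :: "complex^'n^'n \<Rightarrow> complex"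
  assumes M: "haar_prob_measure M" and cont: "continuous_on UNIV f" and V: "V \<in> unitary_group"
  shows "(LINT U|M. f (V ** U)) = (LINT U|M. f U)"
proof -
  let ?R = "restrict_space borel (unitary_group :: (complex^'n^'n) set)"
  have sets: "sets M = sets ?R"
    using M by (simp add: haar_prob_measure_def)
  have "continuous_on UNIV (\<lambda>U :: complex^'n^'n. V ** U)"
    unfolding matrix_matrix_mult_def by (intro continuous_intros)
  then have "(\<lambda>U. V ** U) \<in> measurable ?R borel"
    by (intro measurable_restrict_space1 borel_measurable_continuous_onI)
  then have "(\<lambda>U. V ** U) \<in> measurable ?R ?R"
    using unitary_group_mult[OF V] by (intro measurable_restrict_space2) (auto simp: space_restrict_space)
  then have meas: "(\<lambda>U. V ** U) \<in> measurable M M"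
    using measurable_cong_sets[OF sets sets] by simp
  have "(LINT U|M. f U) = (LINT U|distr M M (\<lambda>U. V ** U). f U)"
    using M V by (simp add: haar_prob_measure_def)
  also have "\<dots> = (LINT U|M. f (V ** U))"
    by (rule integral_distr[OF meas haar_measurable[OF M cont]])
  finally show ?thesis by simp
qed

definition haar_moment :: "nat \<Rightarrow> (complex^'n^'n) measure \<Rightarrow>
    (nat \<times> 'n::finite \<Rightarrow> 'n) \<Rightarrow> (nat \<times> 'n \<Rightarrow> 'n) \<Rightarrow> complex" where
  "haar_moment k M s t = (LINT U|M. cnj (det U) ^ k * (\<Prod>i\<in>cells k. U $ s i $ t i))"

lemma continuous_on_moment:
  "continuous_on UNIV (\<lambda>U :: complex^'n^'n. cnj (det U) ^ k * (\<Prod>i\<in>cells k. U $ s i $ t i))"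
  by (intro continuous_intros continuous_on_det)

lemma integrable_moment:
  fixes M :: "(complex^'n^'n) measure"
  assumes "haar_prob_measure M"
  shows "integrable M (\<lambda>U. cnj (det U) ^ k * (\<Prod>i\<in>cells k. U $ s i $ t i))"
proof (rule haar_integrable[OF assms continuous_on_moment, where B = 1])
  fix U :: "complex^'n^'n" assume U: "U \<in> unitary_group"
  have "cmod (\<Prod>i\<in>cells k. U $ s i $ t i) \<le> 1"
    unfolding prod_norm[symmetric] by (rule prod_le_1) (simp add: norm_entry_unitary[OF U])
  then show "cmod (cnj (det U) ^ k * (\<Prod>i\<in>cells k. U $ s i $ t i)) \<le> 1"
    by (simp add: norm_mult norm_power norm_det_unitary[OF U])
qed

text \<open>Replacing U by V U applies the tensor power of V to the left word and multiplies the
  conjugate determinant power by that of V, whose inverse is \<open>det V ^ k\<close>.\<close>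

lemma haar_moment_covariant:
  fixes M :: "(complex^'n^'n) measure"
  assumes M: "haar_prob_measure M"
  shows "det_covariant k unitary_group (\<lambda>s. haar_moment k M s t)"
  unfolding det_covariant_def
proof (intro ballI)
  fix V :: "complex^'n^'n" and s :: "nat \<times> 'n \<Rightarrow> 'n"
  assume V: "V \<in> unitary_group"
  let ?f = "\<lambda>s U :: complex^'n^'n. cnj (det U) ^ k * (\<Prod>i\<in>cells k. U $ s i $ t i)"
  have "(\<Sum>r\<in>col_words k. (\<Prod>i\<in>cells k. V $ s i $ r i) * haar_moment k M r t) =
      (LINT U|M. (\<Sum>r\<in>col_words k. (\<Prod>i\<in>cells k. V $ s i $ r i) * ?f r U))"
    unfolding haar_moment_def
    by (subst Bochner_Integration.integral_sum) (auto intro!: integrable_moment[OF M])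
  also have "\<dots> = (LINT U|M. det V ^ k * ?f s (V ** U))"
  proof (rule Bochner_Integration.integral_cong[OF refl])
    fix U :: "complex^'n^'n"
    have "det V ^ k * ?f s (V ** U) = (cnj (det V) * det V) ^ k * cnj (det U) ^ k * (\<Prod>i\<in>cells k. (V ** U) $ s i $ t i)"
      by (simp add: det_mul power_mult_distrib)
    also have "\<dots> = cnj (det U) ^ k * (\<Sum>r\<in>col_words k. (\<Prod>i\<in>cells k. V $ s i $ r i) * (\<Prod>i\<in>cells k. U $ r i $ t i))"
      by (simp add: det_unitary[OF V] prod_matrix_mult_words)
    also have "\<dots> = (\<Sum>r\<in>col_words k. (\<Prod>i\<in>cells k. V $ s i $ r i) * ?f r U)"
      by (simp only: sum_distrib_left mult_ac)
    finally show "(\<Sum>r\<in>col_words k. (\<Prod>i\<in>cells k. V $ s i $ r i) * ?f r U) = det V ^ k * ?f s (V ** U)"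
      by simp
  qed
  also have "\<dots> = det V ^ k * haar_moment k M s t"
    using haar_left_invariant[OF M continuous_on_moment V, of k s t] by (simp add: haar_moment_def)
  finally show "(\<Sum>r\<in>col_words k. (\<Prod>i\<in>cells k. V $ s i $ r i) * haar_moment k M r t) =
      det V ^ k * haar_moment k M s t" .
qed

text \<open>The identity holds before integration: the tensor power of U acts on
  \<open>eps g\<close> by \<open>det U ^ k\<close>, which the conjugate power cancels. Total mass 1
  then fixes the normalisation.\<close>

lemma sum_eps_haar_moment:
  fixes M :: "(complex^'n^'n) measure"
  assumes M: "haar_prob_measure M" and g: "g \<in> row_words k"
  shows "(\<Sum>s\<in>col_words k. of_int (eps k g s) * haar_moment k M s t) = of_int (eps k g t)"
proof -
  interpret prob_space M using M by (simp add: haar_prob_measure_def)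
  let ?f = "\<lambda>s U :: complex^'n^'n. cnj (det U) ^ k * (\<Prod>i\<in>cells k. U $ s i $ t i)"
  have "(\<Sum>s\<in>col_words k. of_int (eps k g s) * haar_moment k M s t) =
      (LINT U|M. (\<Sum>s\<in>col_words k. of_int (eps k g s) * ?f s U))"
    unfolding haar_moment_def
    by (subst Bochner_Integration.integral_sum) (auto intro!: integrable_moment[OF M])
  also have "\<dots> = (LINT U|M. of_int (eps k g t))"
  proof (rule Bochner_Integration.integral_cong[OF refl])
    fix U :: "complex^'n^'n" assume "U \<in> space M"
    then have U: "U \<in> unitary_group" using M by (simp add: haar_prob_measure_def)
    have "(\<Sum>s\<in>col_words k. of_int (eps k g s) * ?f s U) =
        cnj (det U) ^ k * (\<Sum>s\<in>col_words k. of_int (eps k g s) * (\<Prod>i\<in>cells k. U $ s i $ t i))"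
      by (simp only: sum_distrib_left mult_ac)
    also have "\<dots> = (cnj (det U) * det U) ^ k * of_int (eps k g t)"
      by (simp add: sum_words_eps_transpose[OF g] power_mult_distrib)
    finally show "(\<Sum>s\<in>col_words k. of_int (eps k g s) * ?f s U) = of_int (eps k g t)"
      by (simp add: det_unitary[OF U])
  qed
  also have "\<dots> = of_int (eps k g t)"
    by (simp add: prob_space)
  finally show ?thesis .
qed

text \<open>The kernel is applied to a column of moments and evaluated twice: as the scalar c by
  covariance, and as the kernel itself by pairing each \<open>eps g\<close> with the column. The
  last clause exports the same c, which must later cancel against the trace.\<close>

lemma haar_moment_eq_kern:
  obtains c :: complex where "c \<noteq> 0"
    "\<And>(M :: (complex^'n^'n) measure) s t. haar_prob_measure M \<Longrightarrow> s \<in> col_words k \<Longrightarrow>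
        haar_moment k M s t = of_int (kern k s t) / c"
    "\<And>\<tau> s. det_covariant k UNIV \<tau> \<Longrightarrow> s \<in> col_words k \<Longrightarrow>
        (\<Sum>r\<in>col_words k. of_int (kern k s r) * \<tau> r) = c * \<tau> (s :: nat \<times> 'n::finite \<Rightarrow> 'n)"
proof -
  obtain c :: complex where c: "c \<noteq> 0"
    "\<And>\<tau> s. det_covariant k (range (map_matrix complex_of_real)) \<tau> \<Longrightarrow> s \<in> col_words k \<Longrightarrow>
       (\<Sum>r\<in>col_words k. of_int (kern k s r) * \<tau> r) = c * \<tau> (s :: nat \<times> 'n \<Rightarrow> 'n)"
    by (rule kern_eigenvalue[of k]) (rule that, assumption, assumption)
  have "haar_moment k M s t = of_int (kern k s t) / c"
    if M: "haar_prob_measure M" and s: "s \<in> col_words k" for M :: "(complex^'n^'n) measure" and s t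
  proof -
    have "c * haar_moment k M s t = (\<Sum>r\<in>col_words k. of_int (kern k s r) * haar_moment k M r t)"
      by (rule c(2)[OF det_covariant_unitary_imp_real[OF haar_moment_covariant[OF M]] s, symmetric])
    also have "\<dots> = (\<Sum>r\<in>col_words k. \<Sum>g\<in>row_words k.
        of_int (eps k g s) * (of_int (eps k g r) * haar_moment k M r t))"
      by (simp add: kern_def sum_distrib_right mult.assoc)
    also have "\<dots> = (\<Sum>g\<in>row_words k. of_int (eps k g s) *
        (\<Sum>r\<in>col_words k. of_int (eps k g r) * haar_moment k M r t))"
      by (subst sum.swap) (simp only: sum_distrib_left)
    also have "\<dots> = of_int (kern k s t)"
      by (simp add: sum_eps_haar_moment[OF M] kern_def)
    finally show ?thesis using c(1) by (simp add: field_simps)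
  qed
  moreover have "(\<Sum>r\<in>col_words k. of_int (kern k s r) * \<tau> r) = c * \<tau> s"
    if "det_covariant k UNIV \<tau>" "s \<in> col_words k" for \<tau> and s :: "nat \<times> 'n \<Rightarrow> 'n"
    using that by (intro c(2)) (auto simp: det_covariant_def)
  ultimately show ?thesis using that[OF c(1)] by blast
qed

section \<open>Coefficients of the determinant\<close>

text \<open>The principal minor of U with index set S.\<close>

definition minor_sum :: "complex^'n^'n \<Rightarrow> 'n set \<Rightarrow> complex" where
  "minor_sum U S = (\<Sum>\<sigma> | \<sigma> permutes S. of_int (sign \<sigma>) * (\<Prod>i\<in>S. U $ i $ \<sigma> i))"

text \<open>In the Leibniz expansion of det (I + u U) let X be the set of indices that take their
  factor from u U. The factors of I at the other indices require \<sigma> to fix them, so \<sigma>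
  permutes X.\<close>

lemma coeff_det_poly:
  fixes U :: "complex^'n^'n"
  shows "coeff (det_poly U) m = (\<Sum>S | card S = m. minor_sum U S)"
proof -
  have entry: "(mat 1 + map_matrix (\<lambda>z. monom z 1) U) $ i $ j = monom (U $ i $ j) 1 + (if i = j then 1 else 0)" for i j
    by (simp add: mat_def map_matrix_def)
  have prod_monom: "(\<Prod>i\<in>X. monom (U $ i $ \<sigma> i) 1) = monom (\<Prod>i\<in>X. U $ i $ \<sigma> i) (card X)" for X \<sigma>
  proof -
    have "finite X" by simp
    then show ?thesis
      by (induction X) (simp_all add: mult_monom)
  qed
  have prod_delta: "(\<Prod>i\<in>UNIV - X. if i = \<sigma> i then 1 else 0 :: complex poly) = (if \<sigma> permutes X then 1 else 0)"
    if "\<sigma> permutes UNIV" for X and \<sigma> :: "'n \<Rightarrow> 'n"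
  proof (cases "\<forall>i\<in>UNIV - X. \<sigma> i = i")
    case True
    then have "\<sigma> permutes X"
      using that by (auto simp: permutes_def)
    moreover have "(\<Prod>i\<in>UNIV - X. if i = \<sigma> i then 1 else 0 :: complex poly) = 1"
      using True by (intro prod.neutral) auto
    ultimately show ?thesis by simp
  next
    case False
    then obtain i where i: "i \<in> UNIV - X" "\<sigma> i \<noteq> i" by blast
    then have "\<not> \<sigma> permutes X" by (auto simp: permutes_def)
    moreover have "(\<Prod>i\<in>UNIV - X. if i = \<sigma> i then 1 else 0 :: complex poly) = 0"
      using i by (intro prod_zero bexI[of _ i]) auto
    ultimately show ?thesis by simp
  qed
  have "coeff (det_poly U) m = (\<Sum>\<sigma> | \<sigma> permutes UNIV. of_int (sign \<sigma>) *
      coeff (\<Prod>i\<in>UNIV. monom (U $ i $ \<sigma> i) 1 + (if i = \<sigma> i then 1 else 0)) m)"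
  proof -
    have "coeff (of_int z * p) m = of_int z * coeff p m" for z :: int and p :: "complex poly"
      by (simp add: of_int_poly)
    then show ?thesis
      unfolding det_poly_def det_def entry coeff_sum by simp
  qed
  also have "\<dots> = (\<Sum>\<sigma> | \<sigma> permutes UNIV. \<Sum>X\<in>UNIV. if \<sigma> permutes X then
      (if card X = m then of_int (sign \<sigma>) * (\<Prod>i\<in>X. U $ i $ \<sigma> i) else 0) else 0)"
  proof (rule sum.cong[OF refl])
    fix \<sigma> :: "'n \<Rightarrow> 'n" assume "\<sigma> \<in> {\<sigma>. \<sigma> permutes UNIV}"
    then have \<sigma>: "\<sigma> permutes UNIV" by simp
    have expand: "(\<Prod>i\<in>UNIV. monom (U $ i $ \<sigma> i) 1 + (if i = \<sigma> i then 1 else 0)) =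
        (\<Sum>X\<in>UNIV. monom (\<Prod>i\<in>X. U $ i $ \<sigma> i) (card X) * (if \<sigma> permutes X then 1 else 0))"
      by (simp only: prod_add[OF finite] Pow_UNIV prod_monom prod_delta[OF \<sigma>])
    show "of_int (sign \<sigma>) * coeff (\<Prod>i\<in>UNIV. monom (U $ i $ \<sigma> i) 1 + (if i = \<sigma> i then 1 else 0)) m =
        (\<Sum>X\<in>UNIV. if \<sigma> permutes X then (if card X = m then of_int (sign \<sigma>) * (\<Prod>i\<in>X. U $ i $ \<sigma> i) else 0) else 0)"
      unfolding expand coeff_sum sum_distrib_left by (intro sum.cong refl) simp
  qed
  also have "\<dots> = (\<Sum>X\<in>UNIV. \<Sum>\<sigma> | \<sigma> permutes UNIV. if \<sigma> permutes X then
      (if card X = m then of_int (sign \<sigma>) * (\<Prod>i\<in>X. U $ i $ \<sigma> i) else 0) else 0)"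
    by (rule sum.swap)
  also have "\<dots> = (\<Sum>X\<in>UNIV. if card X = m then minor_sum U X else 0)"
  proof (rule sum.cong[OF refl])
    fix X :: "'n set"
    have "(\<Sum>\<sigma> | \<sigma> permutes UNIV. if \<sigma> permutes X then
        (if card X = m then of_int (sign \<sigma>) * (\<Prod>i\<in>X. U $ i $ \<sigma> i) else 0) else 0) =
        (\<Sum>\<sigma> | \<sigma> permutes X. if card X = m then of_int (sign \<sigma>) * (\<Prod>i\<in>X. U $ i $ \<sigma> i) else 0)"
      by (rule sum.mono_neutral_cong_right) (auto intro: permutes_subset)
    then show "(\<Sum>\<sigma> | \<sigma> permutes UNIV. if \<sigma> permutes X then
        (if card X = m then of_int (sign \<sigma>) * (\<Prod>i\<in>X. U $ i $ \<sigma> i) else 0) else 0) =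
        (if card X = m then minor_sum U X else 0)"
      by (simp add: minor_sum_def)
  qed
  also have "\<dots> = (\<Sum>S | card S = m. minor_sum U S)"
    using sum.inter_filter[of UNIV "minor_sum U" "\<lambda>X. card X = m"] by simp
  finally show ?thesis .
qed

text \<open>The trace, on the tensor power indexed by F, of the tensor power of U combined with the
  signed sum of the permutations in P.\<close>

definition word_trace :: "complex^'n^'n \<Rightarrow> 'a set \<Rightarrow> ('a \<Rightarrow> 'a) set \<Rightarrow> complex" where
  "word_trace U F P = (\<Sum>s\<in>F \<rightarrow>\<^sub>E UNIV. \<Sum>p\<in>P. of_int (sign p) * (\<Prod>i\<in>F. U $ s i $ s (p i)))"

text \<open>An injective word transports permutations of F to permutations of its image. If the word
  repeats a letter, composing with the swap of the two positions reverses all signs.\<close>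

lemma sum_permutes_word:
  fixes U :: "complex^'n^'n"
  assumes fin: "finite F"
  shows "(\<Sum>p | p permutes F. of_int (sign p) * (\<Prod>i\<in>F. U $ s i $ s (p i))) =
    (if inj_on s F then minor_sum U (s ` F) else 0)"
proof (cases "inj_on s F")
  case True
  define f where "f = (\<lambda>\<pi> x. if x \<in> s ` F then s (\<pi> (inv_into F s x)) else x)"
  have bij: "bij_betw f {\<pi>. \<pi> permutes F} {\<pi>. \<pi> permutes s ` F}"
    unfolding f_def by (rule bij_betw_permutations) (use True in \<open>simp add: inj_on_imp_bij_betw\<close>)
  have "minor_sum U (s ` F) = (\<Sum>p | p permutes F. of_int (sign (f p)) * (\<Prod>i\<in>s ` F. U $ i $ f p i))"
    unfolding minor_sum_def by (rule sum.reindex_bij_betw[OF bij, symmetric])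
  also have "\<dots> = (\<Sum>p | p permutes F. of_int (sign p) * (\<Prod>i\<in>F. U $ s i $ s (p i)))"
  proof (rule sum.cong[OF refl])
    fix p assume "p \<in> {p. p permutes F}"
    then have p: "p permutes F" by simp
    have "f p = map_permutation F s p"
      by (auto simp: f_def map_permutation_def restrict_id_def fun_eq_iff)
    then have "sign (f p) = sign p"
      using sign_map_permutation[OF True p fin] by simp
    moreover have "(\<Prod>i\<in>s ` F. U $ i $ f p i) = (\<Prod>i\<in>F. U $ s i $ s (p i))"
      by (subst prod.reindex[OF True]) (auto simp: f_def True intro!: prod.cong)
    ultimately show "of_int (sign (f p)) * (\<Prod>i\<in>s ` F. U $ i $ f p i) =
        of_int (sign p) * (\<Prod>i\<in>F. U $ s i $ s (p i))" by simp
  qed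
  finally show ?thesis using True by simp
next
  case False
  then obtain i j where ij: "i \<in> F" "j \<in> F" "i \<noteq> j" "s i = s j" by (auto simp: inj_on_def)
  let ?t = "Transposition.transpose i j"
  have t: "?t permutes F" using ij by (intro permutes_swap_id)
  have st: "s (?t x) = s x" for x using ij by (auto simp: Transposition.transpose_def)
  let ?S = "\<Sum>p | p permutes F. of_int (sign p) * (\<Prod>i\<in>F. U $ s i $ s (p i))"
  have "?S = (\<Sum>p | p permutes F. of_int (sign (?t \<circ> p)) * (\<Prod>i\<in>F. U $ s i $ s ((?t \<circ> p) i)))"
    by (rule setum_permutations_compose_left[OF t])
  also have "\<dots> = (\<Sum>p | p permutes F. - (of_int (sign p) * (\<Prod>i\<in>F. U $ s i $ s (p i))))"
  proof (rule sum.cong[OF refl])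
    fix p assume "p \<in> {p. p permutes F}"
    then have "sign (?t \<circ> p) = - sign p"
      using sign_compose[OF permutation_swap_id permutes_imp_permutation[OF fin], of p i j] ij
      by (simp add: sign_swap_id)
    then show "of_int (sign (?t \<circ> p)) * (\<Prod>i\<in>F. U $ s i $ s ((?t \<circ> p) i)) =
        - (of_int (sign p) * (\<Prod>i\<in>F. U $ s i $ s (p i)))"
      by (simp add: st)
  qed
  finally have "?S = - ?S" by (simp only: sum_negf)
  then have "?S = 0" by simp
  with False show ?thesis by simp
qed

lemma card_bijective_words:
  assumes "finite F" "card F = card S" "finite S"
  shows "card {s \<in> F \<rightarrow>\<^sub>E UNIV. inj_on s F \<and> s ` F = S} = fact (card F)"
proof -
  obtain b where b: "bij_betw b F S"
    using finite_same_card_bij[OF assms(1,3,2)] by blast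
  have "bij_betw (\<lambda>p. restrict (b \<circ> p) F) {p. p permutes F} {s \<in> F \<rightarrow>\<^sub>E UNIV. inj_on s F \<and> s ` F = S}"
  proof (rule bij_betw_imageI)
    show "inj_on (\<lambda>p. restrict (b \<circ> p) F) {p. p permutes F}"
    proof (rule inj_onI, rule ext)
      fix p q x assume pq: "p \<in> {p. p permutes F}" "q \<in> {p. p permutes F}"
        and eq: "restrict (b \<circ> p) F = restrict (b \<circ> q) F"
      show "p x = q x"
      proof (cases "x \<in> F")
        case True
        then have "b (p x) = b (q x)" using fun_cong[OF eq, of x] by simp
        moreover have "p x \<in> F" "q x \<in> F" using pq True permutes_in_image by fastforce+
        ultimately show ?thesis using bij_betw_imp_inj_on[OF b] by (auto simp: inj_on_def)
      next
        case False
        have "p permutes F" "q permutes F" using pq by simp_all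
        then show ?thesis using permutes_not_in[OF _ False] by metis
      qed
    qed
    show "(\<lambda>p. restrict (b \<circ> p) F) ` {p. p permutes F} = {s \<in> F \<rightarrow>\<^sub>E UNIV. inj_on s F \<and> s ` F = S}"
    proof (intro equalityI subsetI)
      fix s assume "s \<in> (\<lambda>p. restrict (b \<circ> p) F) ` {p. p permutes F}"
      then obtain p where p: "p permutes F" "s = restrict (b \<circ> p) F" by auto
      have "bij_betw (b \<circ> p) F S" by (rule bij_betw_trans[OF permutes_imp_bij[OF p(1)] b])
      then show "s \<in> {s \<in> F \<rightarrow>\<^sub>E UNIV. inj_on s F \<and> s ` F = S}"
        by (auto simp: p(2) bij_betw_def inj_on_def)
    next
      fix s assume "s \<in> {s \<in> F \<rightarrow>\<^sub>E UNIV. inj_on s F \<and> s ` F = S}"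
      then have s: "s \<in> extensional F" "bij_betw s F S" by (auto simp: bij_betw_def PiE_iff)
      define p where "p x = (if x \<in> F then inv_into F b (s x) else x)" for x
      have "bij_betw (inv_into F b \<circ> s) F F"
        by (rule bij_betw_trans[OF s(2) bij_betw_inv_into[OF b]])
      then have "bij_betw p F F"
        by (rule bij_betw_cong[THEN iffD1, rotated]) (simp add: p_def)
      then have p: "p permutes F" by (rule bij_imp_permutes) (simp add: p_def)
      have "b (p x) = s x" if "x \<in> F" for x
        using that bij_betw_inv_into_right[OF b] bij_betwE[OF s(2)] by (simp add: p_def)
      then have "s = restrict (b \<circ> p) F" using s(1) by (auto simp: extensional_def fun_eq_iff)
      with p show "s \<in> (\<lambda>p. restrict (b \<circ> p) F) ` {p. p permutes F}" by blast
    qed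
  qed
  from bij_betw_same_card[OF this] show ?thesis
    using card_permutations[OF refl assms(1)] by simp
qed

text \<open>Full antisymmetrisation gives the trace on an exterior power: every principal minor of
  size \<open>card F\<close> comes from \<open>fact (card F)\<close> injective words.\<close>

lemma word_trace_permutes:
  fixes U :: "complex^'n^'n"
  assumes fin: "finite F"
  shows "word_trace U F {p. p permutes F} = fact (card F) * coeff (det_poly U) (card F)"
proof -
  have finW: "finite (F \<rightarrow>\<^sub>E (UNIV :: 'n set))" using fin by (simp add: finite_PiE)
  have "word_trace U F {p. p permutes F} = (\<Sum>s\<in>F \<rightarrow>\<^sub>E UNIV. if inj_on s F then minor_sum U (s ` F) else 0)"
    unfolding word_trace_def by (simp only: sum_permutes_word[OF fin])
  also have "\<dots> = (\<Sum>s\<in>{s \<in> F \<rightarrow>\<^sub>E UNIV. inj_on s F}. minor_sum U (s ` F))"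
    by (rule sum.inter_filter[OF finW, symmetric])
  also have "\<dots> = (\<Sum>S | card S = card F. \<Sum>s\<in>{s \<in> {s \<in> F \<rightarrow>\<^sub>E UNIV. inj_on s F}. s ` F = S}. minor_sum U (s ` F))"
    by (rule sum.group[symmetric]) (use finW in \<open>auto simp: card_image\<close>)
  also have "\<dots> = (\<Sum>S | card S = card F. fact (card F) * minor_sum U S)"
  proof (rule sum.cong[OF refl])
    fix S :: "'n set" assume "S \<in> {S. card S = card F}"
    then have S: "card F = card S" by simp
    have "(\<Sum>s\<in>{s \<in> {s \<in> F \<rightarrow>\<^sub>E UNIV. inj_on s F}. s ` F = S}. minor_sum U (s ` F)) =
        (\<Sum>s\<in>{s \<in> F \<rightarrow>\<^sub>E UNIV. inj_on s F \<and> s ` F = S}. minor_sum U S)"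
      by (rule sum.cong) auto
    then show "(\<Sum>s\<in>{s \<in> {s \<in> F \<rightarrow>\<^sub>E UNIV. inj_on s F}. s ` F = S}. minor_sum U (s ` F)) =
        fact (card F) * minor_sum U S"
      by (simp add: card_bijective_words[OF fin S])
  qed
  also have "\<dots> = fact (card F) * coeff (det_poly U) (card F)"
    by (simp only: coeff_det_poly sum_distrib_left)
  finally show ?thesis .
qed

section \<open>Factorisation of traces over the colors\<close>

definition color_perms :: "('a \<Rightarrow> 'c) \<Rightarrow> 'a set \<Rightarrow> ('a \<Rightarrow> 'a) set" where
  "color_perms c F = {p. p permutes F \<and> (\<forall>i\<in>F. c (p i) = c i)}"

text \<open>Since the two sets share no color, a color-preserving permutation of the union cannot
  move an element from one to the other.\<close>

lemma bij_color_perms_Un: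
  assumes disj: "c ` F \<inter> c ` F' = {}"
  shows "bij_betw (\<lambda>(p, q). p \<circ> q) (color_perms c F \<times> color_perms c F') (color_perms c (F \<union> F'))"
proof -
  have FF: "F \<inter> F' = {}" using disj by auto
  have comp: "(p \<circ> q) i = (if i \<in> F then p i else q i)"
    if "p permutes F" "q permutes F'" for p q i
  proof (cases "i \<in> F'")
    case True
    then have "i \<notin> F" "q i \<notin> F" using FF permutes_in_image[OF that(2), of i] by auto
    then show ?thesis using permutes_not_in[OF that(1)] by simp
  next
    case False
    then show ?thesis using permutes_not_in[OF that(2), of i] permutes_not_in[OF that(1), of i] by simp
  qed
  show ?thesis
  proof (rule bij_betwI[where g = "\<lambda>r. (\<lambda>i. if i \<in> F then r i else i, \<lambda>i. if i \<in> F' then r i else i)"])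
    show "(\<lambda>(p, q). p \<circ> q) \<in> color_perms c F \<times> color_perms c F' \<rightarrow> color_perms c (F \<union> F')"
    proof (clarsimp simp: color_perms_def)
      fix p q assume p: "p permutes F" "\<forall>i\<in>F. c (p i) = c i" and q: "q permutes F'" "\<forall>i\<in>F'. c (q i) = c i"
      have "p permutes F \<union> F'" "q permutes F \<union> F'"
        using permutes_subset[OF p(1)] permutes_subset[OF q(1)] by auto
      then have "p \<circ> q permutes F \<union> F'" by (intro permutes_compose)
      moreover have "c (p (q i)) = c i" if "i \<in> F \<union> F'" for i
        using comp[OF p(1) q(1), of i] that p(2) q(2) by auto
      ultimately show "p \<circ> q permutes F \<union> F' \<and> (\<forall>i\<in>F \<union> F'. c (p (q i)) = c i)" by blast
    qed
    have res: "(\<lambda>i. if i \<in> A then r i else i) \<in> color_perms c A"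
      if r: "r \<in> color_perms c (A \<union> B)" and AB: "c ` A \<inter> c ` B = {}" for r A B
    proof -
      have rp: "r permutes A \<union> B" and rc: "\<And>i. i \<in> A \<union> B \<Longrightarrow> c (r i) = c i"
        using r by (auto simp: color_perms_def)
      have rA: "r i \<in> A \<longleftrightarrow> i \<in> A" if "i \<in> A \<union> B" for i
        using rc[OF that] permutes_in_image[OF rp, of i] AB that by (auto simp: image_iff disjoint_iff)
      have "bij_betw r A A"
      proof (rule bij_betw_imageI)
        show "inj_on r A" using permutes_inj_on[OF rp] .
        show "r ` A = A"
        proof (intro equalityI subsetI)
          fix x assume "x \<in> A"
          then obtain y where "y \<in> A \<union> B" "x = r y" using permutes_image[OF rp] by blast
          then show "x \<in> r ` A" using rA \<open>x \<in> A\<close> by blast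
        qed (use rA in auto)
      qed
      then have "bij_betw (\<lambda>i. if i \<in> A then r i else i) A A"
        by (rule bij_betw_cong[THEN iffD1, rotated]) simp
      then have "(\<lambda>i. if i \<in> A then r i else i) permutes A"
        by (rule bij_imp_permutes) simp
      then show ?thesis using rc by (simp add: color_perms_def)
    qed
    show "(\<lambda>r. (\<lambda>i. if i \<in> F then r i else i, \<lambda>i. if i \<in> F' then r i else i)) \<in>
        color_perms c (F \<union> F') \<rightarrow> color_perms c F \<times> color_perms c F'"
      using res[of _ F F'] res[of _ F' F] disj by (auto simp: Un_commute Int_commute)
  next
    fix pq assume pq: "pq \<in> color_perms c F \<times> color_perms c F'"
    obtain p q where pq_def: "pq = (p, q)" by (cases pq)
    then have p: "p permutes F" and q: "q permutes F'" using pq by (auto simp: color_perms_def)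
    have 1: "(\<lambda>i. if i \<in> F then (p \<circ> q) i else i) = p"
      by (rule ext) (use comp[OF p q] permutes_not_in[OF p] in simp)
    have 2: "(\<lambda>i. if i \<in> F' then (p \<circ> q) i else i) = q"
    proof
      fix i
      show "(if i \<in> F' then (p \<circ> q) i else i) = q i"
        using comp[OF p q, of i] permutes_not_in[OF q, of i] FF by auto
    qed
    show "(\<lambda>r. (\<lambda>i. if i \<in> F then r i else i, \<lambda>i. if i \<in> F' then r i else i)) ((\<lambda>(p, q). p \<circ> q) pq) = pq"
      unfolding pq_def by (simp only: prod.case 1 2)
  next
    fix r assume r: "r \<in> color_perms c (F \<union> F')"
    then have rp: "r permutes F \<union> F'" and rc: "\<And>i. i \<in> F \<union> F' \<Longrightarrow> c (r i) = c i"
      by (auto simp: color_perms_def)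
    have "(if r i \<in> F then r (r i) else r i) = r i" if "i \<in> F'" for i
    proof -
      have "r i \<notin> F" using rc[of i] that disj by (auto simp: image_iff disjoint_iff)
      then show ?thesis by simp
    qed
    then show "(\<lambda>(p, q). p \<circ> q) ((\<lambda>r. (\<lambda>i. if i \<in> F then r i else i, \<lambda>i. if i \<in> F' then r i else i)) r) = r"
      using permutes_not_in[OF rp] by (fastforce simp: fun_eq_iff)
  qed
qed

lemma card_color_perms_Un:
  assumes "c ` F \<inter> c ` F' = {}"
  shows "card (color_perms c (F \<union> F')) = card (color_perms c F) * card (color_perms c F')"
  using bij_betw_same_card[OF bij_color_perms_Un[OF assms]] by (simp add: card_cartesian_product)

lemma bij_words_Un:
  assumes "F \<inter> F' = {}"
  shows "bij_betw (\<lambda>(s, s'). \<lambda>i\<in>F \<union> F'. if i \<in> F then s i else s' i)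
    ((F \<rightarrow>\<^sub>E UNIV) \<times> (F' \<rightarrow>\<^sub>E UNIV)) (F \<union> F' \<rightarrow>\<^sub>E UNIV)"
  by (rule bij_betwI[where g = "\<lambda>s. (restrict s F, restrict s F')"])
    (use assms in \<open>auto simp: fun_eq_iff restrict_def PiE_iff extensional_def\<close>)

lemma word_trace_Un:
  fixes U :: "complex^'n^'n" and c :: "'a \<Rightarrow> 'c"
  assumes disj: "c ` F \<inter> c ` F' = {}" and fin: "finite F" "finite F'"
  shows "word_trace U (F \<union> F') (color_perms c (F \<union> F')) =
    word_trace U F (color_perms c F) * word_trace U F' (color_perms c F')"
proof -
  have FF: "F \<inter> F' = {}" using disj by auto
  let ?t = "\<lambda>F s p. of_int (sign p) * (\<Prod>i\<in>F. U $ s i $ s (p i))"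
  let ?m = "\<lambda>s s'. \<lambda>i\<in>F \<union> F'. if i \<in> F then s i else s' i"
  have summand: "?t (F \<union> F') (?m s s') (p \<circ> q) = ?t F s p * ?t F' s' q"
    if p: "p \<in> color_perms c F" and q: "q \<in> color_perms c F'" for s s' p q
  proof -
    have pp: "p permutes F" and qp: "q permutes F'" using p q by (auto simp: color_perms_def)
    have "(\<Prod>i\<in>F. U $ ?m s s' i $ ?m s s' ((p \<circ> q) i)) = (\<Prod>i\<in>F. U $ s i $ s (p i))"
    proof (rule prod.cong[OF refl])
      fix i assume i: "i \<in> F"
      then have "q i = i" "p i \<in> F" using FF permutes_not_in[OF qp, of i] permutes_in_image[OF pp] by auto
      then show "U $ ?m s s' i $ ?m s s' ((p \<circ> q) i) = U $ s i $ s (p i)" using i by simp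
    qed
    moreover have "(\<Prod>i\<in>F'. U $ ?m s s' i $ ?m s s' ((p \<circ> q) i)) = (\<Prod>i\<in>F'. U $ s' i $ s' (q i))"
    proof (rule prod.cong[OF refl])
      fix i assume i: "i \<in> F'"
      then have "q i \<in> F'" using permutes_in_image[OF qp] by simp
      then have "q i \<notin> F" "i \<notin> F" using FF i by auto
      then show "U $ ?m s s' i $ ?m s s' ((p \<circ> q) i) = U $ s' i $ s' (q i)"
        using i \<open>q i \<in> F'\<close> permutes_not_in[OF pp, of "q i"] by simp
    qed
    moreover have "sign (p \<circ> q) = sign p * sign q"
      by (rule sign_compose[OF permutes_imp_permutation[OF fin(1) pp] permutes_imp_permutation[OF fin(2) qp]])
    ultimately show ?thesis
      using prod.union_disjoint[OF fin FF, of "\<lambda>i. U $ ?m s s' i $ ?m s s' ((p \<circ> q) i)"] by simp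
  qed
  have "word_trace U (F \<union> F') (color_perms c (F \<union> F')) =
      (\<Sum>z\<in>(F \<rightarrow>\<^sub>E UNIV) \<times> (F' \<rightarrow>\<^sub>E UNIV). \<Sum>p\<in>color_perms c (F \<union> F'). ?t (F \<union> F') (?m (fst z) (snd z)) p)"
    unfolding word_trace_def
    using sum.reindex_bij_betw[OF bij_words_Un[OF FF], of "\<lambda>s. \<Sum>p\<in>color_perms c (F \<union> F'). ?t (F \<union> F') s p"]
    by (simp only: case_prod_unfold)
  also have "\<dots> = (\<Sum>z\<in>(F \<rightarrow>\<^sub>E UNIV) \<times> (F' \<rightarrow>\<^sub>E UNIV). \<Sum>w\<in>color_perms c F \<times> color_perms c F'.
      ?t F (fst z) (fst w) * ?t F' (snd z) (snd w))"
  proof (rule sum.cong[OF refl])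
    fix z :: "('a \<Rightarrow> 'n) \<times> ('a \<Rightarrow> 'n)"
    have "(\<Sum>p\<in>color_perms c (F \<union> F'). ?t (F \<union> F') (?m (fst z) (snd z)) p) =
        (\<Sum>w\<in>color_perms c F \<times> color_perms c F'. ?t (F \<union> F') (?m (fst z) (snd z)) (fst w \<circ> snd w))"
      using sum.reindex_bij_betw[OF bij_color_perms_Un[OF disj], of "?t (F \<union> F') (?m (fst z) (snd z))"]
      by (simp only: case_prod_unfold)
    also have "\<dots> = (\<Sum>w\<in>color_perms c F \<times> color_perms c F'. ?t F (fst z) (fst w) * ?t F' (snd z) (snd w))"
      by (rule sum.cong[OF refl], rule summand) auto
    finally show "(\<Sum>p\<in>color_perms c (F \<union> F'). ?t (F \<union> F') (?m (fst z) (snd z)) p) =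
        (\<Sum>w\<in>color_perms c F \<times> color_perms c F'. ?t F (fst z) (fst w) * ?t F' (snd z) (snd w))" .
  qed
  also have "\<dots> = word_trace U F (color_perms c F) * word_trace U F' (color_perms c F')"
  proof -
    have inner: "(\<Sum>w\<in>color_perms c F \<times> color_perms c F'. a (fst w) * b (snd w)) =
        (\<Sum>p\<in>color_perms c F. a p) * (\<Sum>q\<in>color_perms c F'. b q)" for a b :: "('a \<Rightarrow> 'a) \<Rightarrow> complex"
      by (simp only: sum_product sum.cartesian_product case_prod_unfold)
    have outer: "(\<Sum>z\<in>(F \<rightarrow>\<^sub>E UNIV) \<times> (F' \<rightarrow>\<^sub>E UNIV). a (fst z) * b (snd z)) =
        (\<Sum>s\<in>F \<rightarrow>\<^sub>E UNIV. a s) * (\<Sum>s\<in>F' \<rightarrow>\<^sub>E UNIV. b s)" for a b :: "('a \<Rightarrow> 'n) \<Rightarrow> complex"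
      by (simp only: sum_product sum.cartesian_product case_prod_unfold)
    have "(\<Sum>z\<in>(F \<rightarrow>\<^sub>E UNIV) \<times> (F' \<rightarrow>\<^sub>E UNIV). \<Sum>w\<in>color_perms c F \<times> color_perms c F'.
        ?t F (fst z) (fst w) * ?t F' (snd z) (snd w)) =
        (\<Sum>z\<in>(F \<rightarrow>\<^sub>E UNIV) \<times> (F' \<rightarrow>\<^sub>E UNIV). (\<Sum>p\<in>color_perms c F. ?t F (fst z) p) *
          (\<Sum>q\<in>color_perms c F'. ?t F' (snd z) q))"
    proof (rule sum.cong[OF refl])
      fix z :: "('a \<Rightarrow> 'n) \<times> ('a \<Rightarrow> 'n)"
      show "(\<Sum>w\<in>color_perms c F \<times> color_perms c F'. ?t F (fst z) (fst w) * ?t F' (snd z) (snd w)) =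
          (\<Sum>p\<in>color_perms c F. ?t F (fst z) p) * (\<Sum>q\<in>color_perms c F'. ?t F' (snd z) q)"
        by (rule inner[of "?t F (fst z)" "?t F' (snd z)"])
    qed
    also have "\<dots> = word_trace U F (color_perms c F) * word_trace U F' (color_perms c F')"
      unfolding word_trace_def
      by (rule outer[of "\<lambda>s. \<Sum>p\<in>color_perms c F. ?t F s p" "\<lambda>s. \<Sum>q\<in>color_perms c F'. ?t F' s q"])
    finally show ?thesis .
  qed
  finally show ?thesis .
qed

text \<open>Colors are added one at a time. On a single color every permutation is allowed, which
  gives a factorial times a coefficient; the factorials multiply up to the order of the
  color-preserving group.\<close>

lemma word_trace_color_perms:
  fixes U :: "complex^'n^'n" and c :: "'a \<Rightarrow> 'c"
  assumes fin: "finite F" and "finite C"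
  shows "word_trace U {i \<in> F. c i \<in> C} (color_perms c {i \<in> F. c i \<in> C}) =
      of_nat (card (color_perms c {i \<in> F. c i \<in> C})) * (\<Prod>x\<in>C. coeff (det_poly U) (card {i \<in> F. c i = x}))
    \<and> card (color_perms c {i \<in> F. c i \<in> C}) > 0"
  using \<open>finite C\<close>
proof (induction C)
  case empty
  have "color_perms c {} = {id}" by (auto simp: color_perms_def)
  then show ?case by (simp add: word_trace_def)
next
  case (insert x C)
  let ?G = "\<lambda>C. {i \<in> F. c i \<in> C}"
  let ?X = "{i \<in> F. c i = x}"
  have split: "?G (insert x C) = ?X \<union> ?G C" by auto
  have disj: "c ` ?X \<inter> c ` ?G C = {}" using insert.hyps by auto
  have one: "color_perms c (?X) = {p. p permutes ?X}"
    by (auto simp: color_perms_def dest: permutes_in_image)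
  have "card (color_perms c (?X)) = fact (card (?X))"
    unfolding one using fin by (intro card_permutations) auto
  moreover have "word_trace U (?X) (color_perms c (?X)) =
      fact (card (?X)) * coeff (det_poly U) (card (?X))"
    unfolding one using fin by (intro word_trace_permutes) auto
  ultimately show ?case
    unfolding split using insert fin
    by (simp add: card_color_perms_Un[OF disj] word_trace_Un[OF disj])
qed

section \<open>Rearrangement, levels and traces\<close>

text \<open>The product c g counts the lattice points of a c by g rectangle; the two summations are
  then exchanged.\<close>

lemma sum_mult_eq_sum_layers:
  fixes c g :: "'a \<Rightarrow> nat"
  assumes "finite I" "\<And>i. i \<in> I \<Longrightarrow> c i \<le> B" "\<And>i. i \<in> I \<Longrightarrow> g i \<le> B"
  shows "(\<Sum>i\<in>I. c i * g i) = (\<Sum>z\<in>{1..B} \<times> {1..B}. card {i \<in> I. fst z \<le> c i \<and> snd z \<le> g i})"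
proof -
  have "(\<Sum>i\<in>I. c i * g i) = (\<Sum>i\<in>I. card {z \<in> {1..B} \<times> {1..B}. fst z \<le> c i \<and> snd z \<le> g i})"
  proof (rule sum.cong[OF refl])
    fix i assume "i \<in> I"
    then have "{z \<in> {1..B} \<times> {1..B}. fst z \<le> c i \<and> snd z \<le> g i} = {1..c i} \<times> {1..g i}"
      using assms(2,3)[of i] by auto
    then show "c i * g i = card {z \<in> {1..B} \<times> {1..B}. fst z \<le> c i \<and> snd z \<le> g i}"
      by (simp add: card_cartesian_product)
  qed
  also have "\<dots> = (\<Sum>i\<in>I. \<Sum>z\<in>{1..B} \<times> {1..B}. if fst z \<le> c i \<and> snd z \<le> g i then 1 else 0)"
    by (intro sum.cong refl) (simp add: sum.If_cases Int_def)
  also have "\<dots> = (\<Sum>z\<in>{1..B} \<times> {1..B}. \<Sum>i\<in>I. if fst z \<le> c i \<and> snd z \<le> g i then 1 else 0)"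
    by (rule sum.swap)
  also have "\<dots> = (\<Sum>z\<in>{1..B} \<times> {1..B}. card {i \<in> I. fst z \<le> c i \<and> snd z \<le> g i})"
    using assms(1) by (intro sum.cong refl) (simp add: sum.If_cases Int_def)
  finally show ?thesis .
qed

text \<open>Counting layers turns the sum of products into a sum of terms each of which is maximised by
  the similar ordering.\<close>

lemma rearrangement:
  fixes c g :: "'a \<Rightarrow> nat"
  assumes fin: "finite I" and \<rho>: "\<rho> permutes I"
    and sim: "\<And>i j. i \<in> I \<Longrightarrow> j \<in> I \<Longrightarrow> (c i \<le> c j \<and> g i \<le> g j) \<or> (c j \<le> c i \<and> g j \<le> g i)"
  shows "(\<Sum>i\<in>I. c i * g (\<rho> i)) \<le> (\<Sum>i\<in>I. c i * g i)"
    and "(\<Sum>i\<in>I. c i * g (\<rho> i)) = (\<Sum>i\<in>I. c i * g i) \<Longrightarrow>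
      card {i \<in> I. c i = x \<and> g (\<rho> i) = y} = card {i \<in> I. c i = x \<and> g i = y}"
proof -
  define n where "n h x y = card {i \<in> I. x \<le> c i \<and> y \<le> h i}" for h :: "'a \<Rightarrow> nat" and x y
  define B where "B = (\<Sum>i\<in>I. c i) + (\<Sum>i\<in>I. g i)"
  have B: "c i \<le> B" "g i \<le> B" "g (\<rho> i) \<le> B" if "i \<in> I" for i
    using member_le_sum[of i I c] member_le_sum[of i I g] member_le_sum[of "\<rho> i" I g] fin that
      permutes_in_image[OF \<rho>, of i] by (auto simp: B_def)
  have card_rho: "card {i \<in> I. y \<le> g (\<rho> i)} = card {i \<in> I. y \<le> g i}" for y
  proof (rule bij_betw_same_card[of \<rho>])
    show "bij_betw \<rho> {i \<in> I. y \<le> g (\<rho> i)} {i \<in> I. y \<le> g i}"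
      using permutes_in_image[OF \<rho>] permutes_inj_on[OF \<rho>] permutes_image[OF \<rho>]
      by (auto simp: bij_betw_def image_iff)
  qed
  \<comment> \<open>By similarity one of the upper level sets of c and g contains the other, so
    their intersection is as large as their sizes permit.\<close>
  have n_le: "n (\<lambda>i. g (\<rho> i)) x y \<le> n g x y" for x y
  proof (cases "{i \<in> I. x \<le> c i} \<subseteq> {i \<in> I. y \<le> g i}")
    case True
    then have "{i \<in> I. x \<le> c i \<and> y \<le> g i} = {i \<in> I. x \<le> c i}" by auto
    then show ?thesis
      unfolding n_def using fin by (auto intro!: card_mono)
  next
    case False
    then obtain i where "i \<in> I" "x \<le> c i" "\<not> y \<le> g i" by auto
    then have i: "i \<in> I" "x \<le> c i" "g i < y" by simp_all
    have "{i \<in> I. y \<le> g i} \<subseteq> {i \<in> I. x \<le> c i}"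
    proof
      fix j assume "j \<in> {i \<in> I. y \<le> g i}"
      then have j: "j \<in> I" "y \<le> g j" by auto
      show "j \<in> {i \<in> I. x \<le> c i}"
        using sim[OF i(1) j(1)] i j by auto
    qed
    then have "{i \<in> I. x \<le> c i \<and> y \<le> g i} = {i \<in> I. y \<le> g i}" by auto
    then have "n g x y = card {i \<in> I. y \<le> g (\<rho> i)}"
      by (simp add: n_def card_rho)
    then show ?thesis
      unfolding n_def using fin by (auto intro!: card_mono)
  qed
  have s1: "(\<Sum>i\<in>I. c i * g i) = (\<Sum>z\<in>{1..B} \<times> {1..B}. n g (fst z) (snd z))"
    and s2: "(\<Sum>i\<in>I. c i * g (\<rho> i)) = (\<Sum>z\<in>{1..B} \<times> {1..B}. n (\<lambda>i. g (\<rho> i)) (fst z) (snd z))"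
    unfolding n_def by (rule sum_mult_eq_sum_layers[OF fin]; simp add: B)+
  show "(\<Sum>i\<in>I. c i * g (\<rho> i)) \<le> (\<Sum>i\<in>I. c i * g i)"
    unfolding s1 s2 by (rule sum_mono) (rule n_le)
  assume eq: "(\<Sum>i\<in>I. c i * g (\<rho> i)) = (\<Sum>i\<in>I. c i * g i)"
  \<comment> \<open>Equal sums of termwise ordered terms have equal terms. Differences of layer
    counts, in x and then in y, recover the joint distribution of colors and values.\<close>
  have n_eq: "n (\<lambda>i. g (\<rho> i)) x y = n g x y" for x y
  proof -
    consider "x = 0" | "y = 0" | "x > B" | "y > B" | "(x, y) \<in> {1..B} \<times> {1..B}"
      by (cases "x = 0"; cases "y = 0"; cases "B < x"; cases "B < y") (auto simp: not_less)
    then show ?thesis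
    proof cases
      case 3
      then have e: "{i \<in> I. x \<le> c i \<and> y \<le> g i} = {}" "{i \<in> I. x \<le> c i \<and> y \<le> g (\<rho> i)} = {}" using B by fastforce+
      show ?thesis unfolding n_def by (simp only: e)
    next
      case 4
      then have e: "{i \<in> I. x \<le> c i \<and> y \<le> g i} = {}" "{i \<in> I. x \<le> c i \<and> y \<le> g (\<rho> i)} = {}" using B by fastforce+
      show ?thesis unfolding n_def by (simp only: e)
    next
      case 5
      have "n (\<lambda>i. g (\<rho> i)) (fst (x, y)) (snd (x, y)) = n g (fst (x, y)) (snd (x, y))"
        by (rule sum_mono_inv[of "\<lambda>z. n (\<lambda>i. g (\<rho> i)) (fst z) (snd z)" "{1..B} \<times> {1..B}" "\<lambda>z. n g (fst z) (snd z)"])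
          (use eq 5 n_le in \<open>auto simp: s1 s2\<close>)
      then show ?thesis by simp
    qed (simp_all add: n_def card_rho)
  qed
  define m where "m h x y = card {i \<in> I. c i = x \<and> y \<le> h i}" for h :: "'a \<Rightarrow> nat" and x y
  have m_eq: "m (\<lambda>i. g (\<rho> i)) x y = m g x y" for x y
  proof -
    have "n h x y = m h x y + n h (Suc x) y" for h
    proof -
      have "{i \<in> I. x \<le> c i \<and> y \<le> h i} = {i \<in> I. c i = x \<and> y \<le> h i} \<union> {i \<in> I. Suc x \<le> c i \<and> y \<le> h i}"
        by auto
      then show ?thesis
        unfolding n_def m_def using fin by (simp add: card_Un_disjoint disjoint_iff)
    qed
    from this[of g] this[of "\<lambda>i. g (\<rho> i)"] show ?thesis using n_eq by simp
  qed
  have m_split: "m h x y = card {i \<in> I. c i = x \<and> h i = y} + m h x (Suc y)" for h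
  proof -
    have "{i \<in> I. c i = x \<and> y \<le> h i} = {i \<in> I. c i = x \<and> h i = y} \<union> {i \<in> I. c i = x \<and> Suc y \<le> h i}"
      by auto
    then show ?thesis
      unfolding m_def using fin by (simp add: card_Un_disjoint disjoint_iff)
  qed
  show "card {i \<in> I. c i = x \<and> g (\<rho> i) = y} = card {i \<in> I. c i = x \<and> g i = y}"
    using m_split[of g] m_split[of "\<lambda>i. g (\<rho> i)"] m_eq[of x y] m_eq[of x "Suc y"] by simp
qed

text \<open>Reflecting c to B - c turns the opposite ordering into the similar one. In the equality
  case injectivity of c makes each level of c a single element, so equal distributions mean equal
  values.\<close>

lemma rearrangement_anti:
  fixes c g :: "'a \<Rightarrow> nat"
  assumes fin: "finite I" and \<rho>: "\<rho> permutes I"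
    and anti: "\<And>i j. i \<in> I \<Longrightarrow> j \<in> I \<Longrightarrow> (c i \<le> c j \<and> g j \<le> g i) \<or> (c j \<le> c i \<and> g i \<le> g j)"
  shows "(\<Sum>i\<in>I. c i * g i) \<le> (\<Sum>i\<in>I. c i * g (\<rho> i))"
    and "inj_on c I \<Longrightarrow> (\<Sum>i\<in>I. c i * g i) = (\<Sum>i\<in>I. c i * g (\<rho> i)) \<Longrightarrow> i \<in> I \<Longrightarrow> g (\<rho> i) = g i"
proof -
  define B where "B = (\<Sum>i\<in>I. c i)"
  have B: "c i \<le> B" if "i \<in> I" for i
    unfolding B_def using that fin by (intro member_le_sum) auto
  have sim: "(B - c i \<le> B - c j \<and> g i \<le> g j) \<or> (B - c j \<le> B - c i \<and> g j \<le> g i)" if "i \<in> I" "j \<in> I" for i j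
    using anti[OF that] by auto
  have comp: "(\<Sum>i\<in>I. (B - c i) * h i) + (\<Sum>i\<in>I. c i * h i) = B * (\<Sum>i\<in>I. h i)" for h
  proof -
    have "(B - c i) * h i + c i * h i = B * h i" if "i \<in> I" for i
      using B[OF that] by (simp add: distrib_right[symmetric])
    then have "(\<Sum>i\<in>I. (B - c i) * h i + c i * h i) = (\<Sum>i\<in>I. B * h i)"
      by (intro sum.cong) auto
    then show ?thesis by (simp add: sum.distrib sum_distrib_left)
  qed
  have perm: "(\<Sum>i\<in>I. g (\<rho> i)) = (\<Sum>i\<in>I. g i)"
    using sum.permute[OF \<rho>, of g] by (simp add: o_def)
  have r1: "(\<Sum>i\<in>I. (B - c i) * g (\<rho> i)) \<le> (\<Sum>i\<in>I. (B - c i) * g i)"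
    using sim by (rule rearrangement(1)[OF fin \<rho>])
  have r2: "card {i \<in> I. B - c i = x \<and> g (\<rho> i) = y} = card {i \<in> I. B - c i = x \<and> g i = y}"
    if "(\<Sum>i\<in>I. (B - c i) * g (\<rho> i)) = (\<Sum>i\<in>I. (B - c i) * g i)" for x y
    using sim that by (rule rearrangement(2)[OF fin \<rho>])
  show "(\<Sum>i\<in>I. c i * g i) \<le> (\<Sum>i\<in>I. c i * g (\<rho> i))"
    using r1 comp[of g] comp[of "\<lambda>i. g (\<rho> i)", unfolded perm] by linarith
  assume inj: "inj_on c I" and eq: "(\<Sum>i\<in>I. c i * g i) = (\<Sum>i\<in>I. c i * g (\<rho> i))" and i: "i \<in> I"
  have "(\<Sum>i\<in>I. (B - c i) * g (\<rho> i)) = (\<Sum>i\<in>I. (B - c i) * g i)"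
    using comp[of g] comp[of "\<lambda>i. g (\<rho> i)", unfolded perm] eq by linarith
  from r2[OF this, of "B - c i" "g i"]
  have card: "card {j \<in> I. B - c j = B - c i \<and> g (\<rho> j) = g i} = card {j \<in> I. B - c j = B - c i \<and> g j = g i}" .
  have "j = i" if "j \<in> I" "B - c j = B - c i" for j
  proof -
    have "c j = c i" using that(2) B[OF that(1)] B[OF i] by linarith
    then show ?thesis using inj i that(1) by (simp add: inj_on_def)
  qed
  then have sub: "{j \<in> I. B - c j = B - c i \<and> g (\<rho> j) = g i} \<subseteq> {j. j = i \<and> g (\<rho> i) = g i}"
    by auto
  have "i \<in> {j \<in> I. B - c j = B - c i \<and> g j = g i}" using i by simp
  then have "card {j \<in> I. B - c j = B - c i \<and> g j = g i} > 0"
    using fin by (auto simp: card_gt_0_iff)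
  then have "{j \<in> I. B - c j = B - c i \<and> g (\<rho> j) = g i} \<noteq> {}"
    using card by (metis card.empty less_numeral_extra(3))
  then show "g (\<rho> i) = g i" using sub by auto
qed

text \<open>The level of an element is the size of the longest chain strictly below it.\<close>

lemma chain_levels:
  fixes R :: "'a \<Rightarrow> 'a \<Rightarrow> bool"
  assumes fin: "finite X"
    and irrefl: "\<And>x. x \<in> X \<Longrightarrow> \<not> R x x"
    and trans: "\<And>x y z. x \<in> X \<Longrightarrow> y \<in> X \<Longrightarrow> z \<in> X \<Longrightarrow> R x y \<Longrightarrow> R y z \<Longrightarrow> R x z"
    and chains: "\<And>C. C \<subseteq> X \<Longrightarrow> (\<And>x y. x \<in> C \<Longrightarrow> y \<in> C \<Longrightarrow> x \<noteq> y \<Longrightarrow> R x y \<or> R y x) \<Longrightarrow> card C \<le> N"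
  obtains lev :: "'a \<Rightarrow> nat" where "\<And>x. x \<in> X \<Longrightarrow> lev x < N"
    "\<And>x y. x \<in> X \<Longrightarrow> y \<in> X \<Longrightarrow> R x y \<Longrightarrow> lev x < lev y"
proof -
  define chain where "chain C \<longleftrightarrow> C \<subseteq> X \<and> (\<forall>x\<in>C. \<forall>y\<in>C. x \<noteq> y \<longrightarrow> R x y \<or> R y x)" for C
  define below where "below x = {C. chain C \<and> (\<forall>y\<in>C. R y x)}" for x
  define lev where "lev x = Max (card ` below x)" for x
  have finite_below: "finite (below x)" for x
    by (rule finite_subset[of _ "Pow X"]) (use fin in \<open>auto simp: below_def chain_def\<close>)
  have empty_below: "{} \<in> below x" for x
    by (simp add: below_def chain_def)
  have ext: "chain (insert x C) \<and> card (insert x C) = Suc (card C)" if "x \<in> X" "C \<in> below x" for x C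
  proof -
    have "C \<subseteq> X" using that by (simp add: below_def chain_def)
    moreover have "x \<notin> C" using that irrefl by (auto simp: below_def)
    ultimately show ?thesis
      using that finite_subset[OF \<open>C \<subseteq> X\<close> fin] by (auto simp: below_def chain_def)
  qed
  have attained: "\<exists>C\<in>below x. card C = lev x" for x
  proof -
    have "lev x \<in> card ` below x"
      unfolding lev_def using finite_below empty_below by (intro Max_in) auto
    then show ?thesis by auto
  qed
  show ?thesis
  proof (rule that[of lev])
    fix x assume x: "x \<in> X"
    obtain C where C: "C \<in> below x" "card C = lev x" using attained by blast
    have "card (insert x C) \<le> N"
      using ext[OF x C(1)] by (intro chains) (auto simp: chain_def)
    then show "lev x < N" using ext[OF x C(1)] C by simp
  next
    fix x y assume xy: "x \<in> X" "y \<in> X" "R x y"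
    obtain C where C: "C \<in> below x" "card C = lev x" using attained by blast
    have "R z y" if "z \<in> insert x C" for z
    proof (cases "z = x")
      case False
      then have "z \<in> X" "R z x" using that C(1) by (auto simp: below_def chain_def)
      then show ?thesis using trans xy by blast
    qed (use xy in simp)
    then have "insert x C \<in> below y"
      using ext[OF xy(1) C(1)] by (simp add: below_def)
    then have "card (insert x C) \<le> lev y"
      unfolding lev_def using finite_below by (intro Max_ge) auto
    then show "lev x < lev y" using ext[OF xy(1) C(1)] C by simp
  qed
qed

text \<open>The operator \<Sum>h a h \<otimes> v h has its image in the span of the v h and acts
  there as the scalar C, so its trace is C times the dimension. By \<open>span\<close> and
  \<open>tri\<close> the vectors v g with g in G form a basis of that span.\<close>

lemma trace_eq_card:
  fixes a v :: "'g \<Rightarrow> 's \<Rightarrow> complex" and \<mu> :: "'g \<Rightarrow> nat"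
  assumes fin: "finite S" "finite \<Gamma>" "finite G"
    and repr: "\<And>g s. g \<in> G \<Longrightarrow> s \<in> S \<Longrightarrow> (\<Sum>h\<in>\<Gamma>. (\<Sum>r\<in>S. v g r * a h r) * v h s) = C * v g s"
    and span: "\<And>h. h \<in> \<Gamma> \<Longrightarrow> \<exists>L. \<forall>s\<in>S. v h s = (\<Sum>g\<in>G. L g * v g s)"
    and tri: "\<And>g. g \<in> G \<Longrightarrow> \<exists>s\<in>S. v g s \<noteq> 0 \<and> (\<forall>g'\<in>G. v g' s \<noteq> 0 \<longrightarrow> g' = g \<or> \<mu> g < \<mu> g')"
  shows "(\<Sum>h\<in>\<Gamma>. \<Sum>s\<in>S. a h s * v h s) = C * of_nat (card G)"
proof -
  obtain L where L: "\<And>h s. h \<in> \<Gamma> \<Longrightarrow> s \<in> S \<Longrightarrow> v h s = (\<Sum>g\<in>G. L h g * v g s)"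
    using span by metis
  have indep: "x g = 0" if x: "\<And>s. s \<in> S \<Longrightarrow> (\<Sum>g\<in>G. x g * v g s) = 0" and g: "g \<in> G" for x g
  proof (rule ccontr)
    assume "x g \<noteq> 0"
    \<comment> \<open>The support of a linear relation. At the witness s of an element of largest
      \<mu> in it, all other terms vanish.\<close>
    define T where "T = {g \<in> G. x g \<noteq> 0}"
    have "finite T" "T \<noteq> {}" using fin g \<open>x g \<noteq> 0\<close> by (auto simp: T_def)
    then obtain g0 where g0: "g0 \<in> T" "\<And>g'. g' \<in> T \<Longrightarrow> \<mu> g' \<le> \<mu> g0"
      using Max_in[of "\<mu> ` T"] Max_ge[of "\<mu> ` T"] by (auto simp: image_iff) (metis Max_ge finite_imageI imageI)
    obtain s where s: "s \<in> S" "v g0 s \<noteq> 0" "\<And>g'. g' \<in> G \<Longrightarrow> v g' s \<noteq> 0 \<Longrightarrow> g' = g0 \<or> \<mu> g0 < \<mu> g'"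
      using tri[of g0] g0(1) by (auto simp: T_def)
    have "x g' * v g' s = (if g' = g0 then x g0 * v g0 s else 0)" if "g' \<in> G" for g'
      using s(3)[OF that] g0(2)[of g'] that by (cases "x g' = 0") (auto simp: T_def)
    then have "(\<Sum>g\<in>G. x g * v g s) = (\<Sum>g\<in>G. if g = g0 then x g0 * v g0 s else 0)"
      by (intro sum.cong) auto
    also have "\<dots> = x g0 * v g0 s" using g0(1) fin by (simp add: T_def)
    finally show False using x[OF s(1)] s(2) g0(1) by (simp add: T_def)
  qed
  \<comment> \<open>Expanding each \<open>v h\<close> in the basis rewrites the operator as \<Sum>g
    w g \<otimes> v g. By independence, acting as C means that w is C times a dual family.\<close>
  define w where "w g s = (\<Sum>h\<in>\<Gamma>. L h g * a h s)" for g s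
  have dual: "(\<Sum>s\<in>S. v g s * w g' s) = (if g' = g then C else 0)" if g: "g \<in> G" and g': "g' \<in> G" for g g'
  proof -
    define x where "x g' = (\<Sum>s\<in>S. v g s * w g' s) - (if g' = g then C else 0)" for g'
    have "(\<Sum>g'\<in>G. x g' * v g' s) = 0" if s: "s \<in> S" for s
    proof -
      have "(\<Sum>g'\<in>G. (\<Sum>r\<in>S. v g r * w g' r) * v g' s) =
          (\<Sum>g'\<in>G. \<Sum>r\<in>S. \<Sum>h\<in>\<Gamma>. v g r * a h r * (L h g' * v g' s))"
        by (simp only: w_def sum_distrib_left sum_distrib_right mult_ac)
      also have "\<dots> = (\<Sum>g'\<in>G. \<Sum>h\<in>\<Gamma>. \<Sum>r\<in>S. v g r * a h r * (L h g' * v g' s))"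
        by (rule sum.cong[OF refl sum.swap])
      also have "\<dots> = (\<Sum>h\<in>\<Gamma>. \<Sum>g'\<in>G. \<Sum>r\<in>S. v g r * a h r * (L h g' * v g' s))"
        by (rule sum.swap)
      also have "\<dots> = (\<Sum>h\<in>\<Gamma>. (\<Sum>r\<in>S. v g r * a h r) * (\<Sum>g'\<in>G. L h g' * v g' s))"
        by (intro sum.cong refl) (simp only: sum_product, rule sum.swap)
      also have "\<dots> = (\<Sum>h\<in>\<Gamma>. (\<Sum>r\<in>S. v g r * a h r) * v h s)"
        by (intro sum.cong refl) (simp only: L[OF _ s])
      also have "\<dots> = C * v g s" by (rule repr[OF g s])
      finally have 1: "(\<Sum>g'\<in>G. (\<Sum>r\<in>S. v g r * w g' r) * v g' s) = C * v g s" .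
      have "(\<Sum>g'\<in>G. (if g' = g then C else 0) * v g' s) = (\<Sum>g'\<in>G. if g' = g then C * v g s else 0)"
        by (rule sum.cong) auto
      also have "\<dots> = C * v g s" using g fin by simp
      finally show ?thesis using 1 by (simp add: x_def left_diff_distrib sum_subtractf)
    qed
    then have "x g' = 0" using indep g' by blast
    then show ?thesis by (simp add: x_def)
  qed
  have "(\<Sum>h\<in>\<Gamma>. \<Sum>s\<in>S. a h s * v h s) = (\<Sum>h\<in>\<Gamma>. \<Sum>s\<in>S. \<Sum>g\<in>G. v g s * (L h g * a h s))"
    by (intro sum.cong refl) (simp add: L sum_distrib_left mult_ac)
  also have "\<dots> = (\<Sum>h\<in>\<Gamma>. \<Sum>g\<in>G. \<Sum>s\<in>S. v g s * (L h g * a h s))"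
    by (rule sum.cong[OF refl sum.swap])
  also have "\<dots> = (\<Sum>g\<in>G. \<Sum>h\<in>\<Gamma>. \<Sum>s\<in>S. v g s * (L h g * a h s))"
    by (rule sum.swap)
  also have "\<dots> = (\<Sum>g\<in>G. \<Sum>s\<in>S. \<Sum>h\<in>\<Gamma>. v g s * (L h g * a h s))"
    by (rule sum.cong[OF refl sum.swap])
  also have "\<dots> = (\<Sum>g\<in>G. \<Sum>s\<in>S. v g s * w g s)"
    by (simp only: w_def sum_distrib_left)
  also have "\<dots> = (\<Sum>g\<in>G. C)"
    by (intro sum.cong refl) (simp add: dual)
  finally show ?thesis by (simp add: mult.commute)
qed

section \<open>Straightening\<close>

text \<open>Each color stands for one coefficient factor of det (I + u U): the colors below k for
  the complementary power, the colors k + r for the power whose degree is n.\<close>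

locale coloring =
  fixes k :: nat and col :: "nat \<times> 'n::finite \<Rightarrow> nat"
  assumes col_less: "i \<in> cells k \<Longrightarrow> col i < 2 * k"
begin

abbreviation J :: "(nat \<times> 'n) set" where "J \<equiv> cells k"

definition young :: "(nat \<times> 'n \<Rightarrow> nat \<times> 'n) set" where
  "young = {p. p permutes J \<and> col \<circ> p = col}"

text \<open>Symmetrising in g equals antisymmetrising in s (\<open>sum_sign_eps_young\<close>),
  which is the form in which the trace over color-preserving permutations produces it.\<close>

definition sym_eps :: "(nat \<times> 'n \<Rightarrow> nat) \<Rightarrow> (nat \<times> 'n \<Rightarrow> 'n) \<Rightarrow> int" where
  "sym_eps g s = (\<Sum>p\<in>young. eps k (g \<circ> p) s)"

lemma finite_young [simp, intro]: "finite young"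
  by (rule finite_subset[OF _ finite_permutations[OF finite_cells[of k]]]) (auto simp: young_def)

lemma young_permutes: "p \<in> young \<Longrightarrow> p permutes J"
  by (simp add: young_def)

lemma id_young [simp]: "id \<in> young"
  by (simp add: young_def permutes_id)

lemma card_young_pos: "card young > 0"
  using id_young by (auto simp: card_gt_0_iff simp del: id_young)

lemma young_comp: "p \<in> young \<Longrightarrow> q \<in> young \<Longrightarrow> p \<circ> q \<in> young"
  by (auto simp: young_def comp_assoc[symmetric] intro: permutes_compose)

lemma young_inv:
  assumes "p \<in> young"
  shows "inv p \<in> young"
proof -
  have "col \<circ> inv p = col \<circ> p \<circ> inv p"
    using assms by (simp add: young_def)
  then have "col \<circ> inv p = col"
    by (simp add: comp_assoc permutes_inv_o[OF young_permutes[OF assms]])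
  then show ?thesis
    using permutes_inv[OF young_permutes[OF assms]] by (simp add: young_def)
qed

lemma bij_young_left:
  assumes q: "q \<in> young"
  shows "bij_betw (\<lambda>p. q \<circ> p) young young"
  by (rule bij_betwI[where g = "\<lambda>p. inv q \<circ> p"])
    (use q young_comp young_inv in \<open>auto simp: comp_assoc[symmetric] permutes_inv_o[OF young_permutes]\<close>)

lemma bij_young_right:
  assumes q: "q \<in> young"
  shows "bij_betw (\<lambda>p. p \<circ> q) young young"
  by (rule bij_betwI[where g = "\<lambda>p. p \<circ> inv q"])
    (use q young_comp young_inv in \<open>auto simp: comp_assoc permutes_inv_o[OF young_permutes]\<close>)

lemma bij_young_inv: "bij_betw inv young young"
  by (rule bij_betwI[where g = inv])
    (use young_inv in \<open>auto simp: inv_inv_eq permutes_bij[OF young_permutes]\<close>)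

lemma sym_eps_comp_row:
  assumes q: "q \<in> young"
  shows "sym_eps (g \<circ> q) s = sym_eps g s"
  using sum.reindex_bij_betw[OF bij_young_left[OF q], of "\<lambda>p. eps k (g \<circ> p) s"]
  by (simp add: sym_eps_def comp_assoc)

lemma sum_sign_eps_young: "(\<Sum>p\<in>young. sign p * eps k g (s \<circ> p)) = sym_eps g s"
proof -
  have "(\<Sum>p\<in>young. sign p * eps k g (s \<circ> p)) = (\<Sum>p\<in>young. eps k (g \<circ> inv p) s)"
    by (intro sum.cong refl) (simp add: eps_comp_col[OF young_permutes])
  also have "\<dots> = sym_eps g s"
    using sum.reindex_bij_betw[OF bij_young_inv, of "\<lambda>p. eps k (g \<circ> p) s"] by (simp add: sym_eps_def)
  finally show ?thesis .
qed

lemma sym_eps_comp_col: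
  assumes q: "q \<in> young"
  shows "sym_eps g (s \<circ> q) = sign q * sym_eps g s"
proof -
  have "sym_eps g (s \<circ> q) = (\<Sum>p\<in>young. sign q * eps k (g \<circ> (p \<circ> inv q)) s)"
    unfolding sym_eps_def by (intro sum.cong refl) (simp add: eps_comp_col[OF young_permutes[OF q]] comp_assoc)
  also have "\<dots> = (\<Sum>p\<in>young. sign q * eps k (g \<circ> p) s)"
    by (rule sum.reindex_bij_betw[OF bij_young_right[OF young_inv[OF q]]])
  finally show ?thesis by (simp add: sym_eps_def sum_distrib_left)
qed

text \<open>Words with equal joint counts of color and letter differ by a permutation of the cells
  that preserves colors.\<close>

lemma sym_eps_eq_if_card_eq:
  assumes eq: "\<And>x y. card {i \<in> J. col i = x \<and> g i = y} = card {i \<in> J. col i = x \<and> g' i = y}"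
  shows "sym_eps g = sym_eps g'"
proof
  fix s
  have "image_mset (\<lambda>i. (col i, g i)) (mset_set (J)) = image_mset (\<lambda>i. (col i, g' i)) (mset_set (J))"
  proof (rule multiset_eqI)
    fix z
    show "count (image_mset (\<lambda>i. (col i, g i)) (mset_set (J))) z =
      count (image_mset (\<lambda>i. (col i, g' i)) (mset_set (J))) z"
      using eq[of "fst z" "snd z"] by (cases z) (simp add: count_image_mset_eq_card_vimage)
  qed
  then obtain p where p: "p permutes J" "\<forall>i\<in>J. (col i, g i) = (col (p i), g' (p i))"
    by (rule image_mset_eq_implies_permutes[OF finite_cells]) (rule that, assumption, assumption)
  have "col (p i) = col i" for i
    using p(2) permutes_not_in[OF p(1), of i] by (cases "i \<in> J") auto
  then have py: "p \<in> young" using p(1) by (auto simp: young_def)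
  have "sym_eps g s = sym_eps (g' \<circ> p) s"
    unfolding sym_eps_def
  proof (intro sum.cong refl eps_cong)
    fix q i assume "q \<in> young" "i \<in> J"
    then have "q i \<in> J" using permutes_in_image[OF young_permutes] by blast
    then show "(g \<circ> q) i = (g' \<circ> p \<circ> q) i" using p(2) by simp
  qed
  then show "sym_eps g s = sym_eps g' s" by (simp add: sym_eps_comp_row[OF py])
qed

text \<open>By the pigeonhole principle two of the permuted positions carry the same letter of \<open>s\<close>;
  swapping them reverses the sign.\<close>

lemma sum_permutes_eps_eq_0:
  fixes s :: "nat \<times> 'n \<Rightarrow> 'n"
  assumes I: "I \<subseteq> J" "card I > CARD('n)"
  shows "(\<Sum>\<rho> | \<rho> permutes I. eps k (g \<circ> \<rho>) s) = 0"
proof -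
  have "\<not> inj_on s I"
  proof
    assume "inj_on s I"
    then have "card I \<le> CARD('n)"
      by (metis card_image card_mono finite subset_UNIV)
    with I show False by simp
  qed
  then obtain i j where ij: "i \<in> I" "j \<in> I" "i \<noteq> j" "s i = s j"
    by (auto simp: inj_on_def)
  let ?t = "Transposition.transpose i j"
  have t: "?t permutes I" and t': "?t permutes J"
    using ij I(1) by (auto intro!: permutes_swap_id)
  have s: "s \<circ> ?t = s"
    using ij by (auto simp: fun_eq_iff Transposition.transpose_def)
  let ?S = "\<Sum>\<rho> | \<rho> permutes I. eps k (g \<circ> \<rho>) s"
  have "?S = (\<Sum>\<rho> | \<rho> permutes I. eps k (g \<circ> (\<rho> \<circ> ?t)) s)"
    by (rule sum_permutations_compose_right[OF t])
  also have "\<dots> = (\<Sum>\<rho> | \<rho> permutes I. - eps k (g \<circ> \<rho>) s)"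
  proof (rule sum.cong[OF refl])
    fix \<rho>
    show "eps k (g \<circ> (\<rho> \<circ> ?t)) s = - eps k (g \<circ> \<rho>) s"
      using eps_comp[OF t', of "g \<circ> \<rho>" s] ij by (simp add: comp_assoc s sign_swap_id)
  qed
  finally have "?S = - ?S" by (simp add: sum_negf)
  then show ?thesis by simp
qed

text \<open>Color-preserving permutations need not preserve I. Moving them from g to s leaves the
  sum over permutations of I intact, and that sum vanishes for every s.\<close>

lemma sum_permutes_sym_eps_eq_0:
  assumes I: "I \<subseteq> J" "card I > CARD('n)"
  shows "(\<Sum>\<rho> | \<rho> permutes I. sym_eps (g \<circ> \<rho>) s) = 0"
proof -
  have "(\<Sum>\<rho> | \<rho> permutes I. sym_eps (g \<circ> \<rho>) s) =
      (\<Sum>p\<in>young. sign p * (\<Sum>\<rho> | \<rho> permutes I. eps k (g \<circ> \<rho>) (s \<circ> inv p)))"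
    unfolding sym_eps_def
    by (subst sum.swap) (simp add: eps_comp_row[OF young_permutes] sum_distrib_left)
  then show ?thesis by (simp add: sum_permutes_eps_eq_0[OF I])
qed

text \<open>The cells of I lie along an SE-chain of the table whose rows are colors and whose
  columns are letters.\<close>

definition similar :: "(nat \<times> 'n \<Rightarrow> nat) \<Rightarrow> (nat \<times> 'n) set \<Rightarrow> bool" where
  "similar g I \<longleftrightarrow> (\<forall>i\<in>I. \<forall>j\<in>I. (col i \<le> col j \<and> g i \<le> g j) \<or> (col j \<le> col i \<and> g j \<le> g i))"

definition bottom :: "(nat \<times> 'n) set" where
  "bottom = {i \<in> J. k \<le> col i}"

definition balanced :: "(nat \<times> 'n \<Rightarrow> nat) \<Rightarrow> bool" where
  "balanced g \<longleftrightarrow> (\<forall>j<k. card {i \<in> J. g i = j} = CARD('n))"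

definition top_diag :: "(nat \<times> 'n \<Rightarrow> nat) \<Rightarrow> bool" where
  "top_diag g \<longleftrightarrow> (\<forall>i\<in>J. col i < k \<longrightarrow> g i = col i)"

text \<open>The counterpart of standard tableaux in this setting.\<close>

definition good :: "(nat \<times> 'n \<Rightarrow> nat) \<Rightarrow> bool" where
  "good g \<longleftrightarrow> g \<in> row_words k \<and> top_diag g \<and> balanced g \<and>
     (\<forall>I\<subseteq>bottom. similar g I \<longrightarrow> card I \<le> CARD('n))"

definition count_mat :: "(nat \<times> 'n \<Rightarrow> nat) \<Rightarrow> nat mat" where
  "count_mat g = Matrix.mat k k (\<lambda>(r, j). card {i \<in> J. col i = k + r \<and> g i = j})"

text \<open>Words with \<open>top_diag\<close> and equal \<open>count_mat\<close> have the same
  \<open>sym_eps\<close>, so one word per matrix is kept.\<close>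

definition rep :: "nat mat \<Rightarrow> nat \<times> 'n \<Rightarrow> nat" where
  "rep A = (SOME g. good g \<and> count_mat g = A)"

definition basis :: "(nat \<times> 'n \<Rightarrow> nat) set" where
  "basis = rep ` count_mat ` {g. good g}"

lemma rep_count_mat:
  assumes "good g"
  shows "good (rep (count_mat g))" "count_mat (rep (count_mat g)) = count_mat g"
  using someI[of "\<lambda>h. good h \<and> count_mat h = count_mat g" g] assms by (auto simp: rep_def)

lemma good_row_words: "good g \<Longrightarrow> g \<in> row_words k"
  by (simp add: good_def)

lemma basis_good: "g \<in> basis \<Longrightarrow> good g"
  by (auto simp: basis_def rep_count_mat)

lemma finite_basis: "finite basis"
  by (rule finite_subset[OF _ finite_row_words[of k]]) (auto dest: basis_good good_row_words)

lemma inj_on_count_mat_basis: "inj_on count_mat basis"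
  by (auto simp: inj_on_def basis_def rep_count_mat)

lemma card_basis: "card basis = card (count_mat ` {g. good g})"
proof -
  have "count_mat ` basis = count_mat ` {g. good g}"
    by (auto simp: basis_def image_iff rep_count_mat)
  then show ?thesis using card_image[OF inj_on_count_mat_basis] by simp
qed

lemma sym_eps_eq_if_count_mat_eq:
  assumes g: "g \<in> row_words k" "top_diag g" and g': "g' \<in> row_words k" "top_diag g'"
    and eq: "count_mat g = count_mat g'"
  shows "sym_eps g = sym_eps g'"
proof -
  have *: "card {i \<in> J. col i = x \<and> g i = y} = card {i \<in> J. col i = x \<and> g' i = y}" for x y
  proof -
    consider "x < k" | "x \<ge> 2 * k \<or> y \<ge> k" | "k \<le> x" "x - k < k" "y < k" by linarith
    then show ?thesis
    proof cases
      case 1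
      have "{i \<in> J. col i = x \<and> g i = y} = {i \<in> J. col i = x \<and> g' i = y}"
        using g(2) g'(2) 1 by (auto simp: top_diag_def)
      then show ?thesis by simp
    next
      case 2
      have empty: "{i \<in> J. col i = x \<and> h i = y} = {}" if "h \<in> row_words k" for h
      proof -
        have "h i < k" if "i \<in> J" for i
          using \<open>h \<in> row_words k\<close> that by (auto simp: row_words_def)
        then show ?thesis using 2 col_less by fastforce
      qed
      then show ?thesis by (simp only: empty[OF g(1)] empty[OF g'(1)])
    next
      case 3
      then have "count_mat h $$ (x - k, y) = card {i \<in> J. col i = x \<and> h i = y}" for h
        by (simp add: count_mat_def)
      then show ?thesis using eq by metis
    qed
  qed
  show ?thesis
    by (rule sym_eps_eq_if_card_eq) (rule *)
qed

lemma eps_nonzero_balanced: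
  assumes g: "g \<in> row_words k" and nz: "eps k g s \<noteq> 0"
  shows "balanced g"
  unfolding balanced_def
proof (intro allI impI)
  fix j assume j: "j < k"
  have p: "pair_map k g s permutes J"
    using nz by (auto simp: eps_def split: if_splits)
  have "bij_betw (pair_map k g s) {i \<in> J. g i = j} ({j} \<times> UNIV)"
  proof (rule bij_betw_imageI)
    show "inj_on (pair_map k g s) {i \<in> J. g i = j}"
      using permutes_inj_on[OF p] .
    have "x \<in> pair_map k g s ` {i \<in> J. g i = j}" if "x \<in> {j} \<times> UNIV" for x
    proof -
      have "x \<in> J" using that j by (auto simp: cells_def)
      then obtain i where i: "i \<in> J" "x = pair_map k g s i"
        using permutes_image[OF p] by blast
      then show ?thesis using that by (auto simp: pair_map_def)
    qed
    then show "pair_map k g s ` {i \<in> J. g i = j} = {j} \<times> UNIV"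
      by (auto simp: pair_map_def)
  qed
  then have "card {i \<in> J. g i = j} = card ({j} \<times> (UNIV :: 'n set))"
    by (rule bij_betw_same_card)
  then show "card {i \<in> J. g i = j} = CARD('n)"
    by (simp add: card_cartesian_product)
qed

lemma card_comp_permutes:
  assumes p: "p permutes A"
  shows "card {i \<in> A. P (p i)} = card {i \<in> A. P i}"
proof (rule bij_betw_same_card[of p])
  show "bij_betw p {i \<in> A. P (p i)} {i \<in> A. P i}"
  proof (rule bij_betw_imageI)
    show "inj_on p {i \<in> A. P (p i)}" using permutes_inj_on[OF p] .
    show "p ` {i \<in> A. P (p i)} = {i \<in> A. P i}"
      using permutes_image[OF p] by (auto simp: image_iff)
  qed
qed

lemma sym_eps_not_balanced:
  assumes g: "g \<in> row_words k" and nb: "\<not> balanced g"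
  shows "sym_eps g s = 0"
  unfolding sym_eps_def
proof (intro sum.neutral ballI)
  fix p assume p: "p \<in> young"
  have "\<not> balanced (g \<circ> p)"
    using nb card_comp_permutes[OF young_permutes[OF p], of "\<lambda>i. g i = _"] by (auto simp: balanced_def)
  then show "eps k (g \<circ> p) s = 0"
    using eps_nonzero_balanced comp_row_words[OF young_permutes[OF p] g] by blast
qed

section \<open>Reduction to the standard words\<close>

definition in_span :: "((nat \<times> 'n \<Rightarrow> 'n) \<Rightarrow> int) \<Rightarrow> bool" where
  "in_span f \<longleftrightarrow> (\<exists>L :: (nat \<times> 'n \<Rightarrow> nat) \<Rightarrow> complex. \<forall>s. of_int (f s) = (\<Sum>g\<in>basis. L g * of_int (sym_eps g s)))"

text \<open>The identity is among the permutations that give back \<open>sym_eps g\<close>. Hence in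
  the vanishing sum \<open>sym_eps g\<close> has a positive multiplicity, by which the remaining
  terms can be divided.\<close>

lemma in_span_reduce:
  assumes I: "I \<subseteq> J" "card I > CARD('n)"
    and red: "\<And>\<rho>. \<rho> permutes I \<Longrightarrow> sym_eps (g \<circ> \<rho>) = sym_eps g \<or> in_span (sym_eps (g \<circ> \<rho>))"
  shows "in_span (sym_eps g)"
proof -
  define P where "P = {\<rho>. \<rho> permutes I}"
  define A where "A = {\<rho> \<in> P. sym_eps (g \<circ> \<rho>) = sym_eps g}"
  have finI: "finite I" using I(1) finite_subset by blast
  have finP: "finite P" unfolding P_def by (rule finite_permutations[OF finI])
  have finA: "finite A" using finP by (simp add: A_def)
  have "id \<in> A" by (simp add: A_def P_def permutes_id)
  then have cA: "card A > 0" using finA by (auto simp: card_gt_0_iff)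
  have "\<forall>\<rho>\<in>P - A. \<exists>L. \<forall>s. complex_of_int (sym_eps (g \<circ> \<rho>) s) = (\<Sum>h\<in>basis. L h * of_int (sym_eps h s))"
    using red by (auto simp: A_def P_def in_span_def)
  then obtain L where L: "\<And>\<rho> s. \<rho> \<in> P - A \<Longrightarrow> complex_of_int (sym_eps (g \<circ> \<rho>) s) = (\<Sum>h\<in>basis. L \<rho> h * of_int (sym_eps h s))"
    by metis
  define L' where "L' h = - (\<Sum>\<rho>\<in>P - A. L \<rho> h) / of_nat (card A)" for h
  have "of_int (sym_eps g s) = (\<Sum>h\<in>basis. L' h * of_int (sym_eps h s))" for s
  proof -
    have "0 = complex_of_int (\<Sum>\<rho>\<in>P. sym_eps (g \<circ> \<rho>) s)"
      using sum_permutes_sym_eps_eq_0[OF I, of g s] by (simp add: P_def)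
    also have "\<dots> = (\<Sum>\<rho>\<in>P - A. of_int (sym_eps (g \<circ> \<rho>) s)) + (\<Sum>\<rho>\<in>A. of_int (sym_eps (g \<circ> \<rho>) s))"
      unfolding of_int_sum by (rule sum.subset_diff) (use finP in \<open>auto simp: A_def\<close>)
    also have "(\<Sum>\<rho>\<in>A. complex_of_int (sym_eps (g \<circ> \<rho>) s)) = of_nat (card A) * of_int (sym_eps g s)"
      by (simp add: A_def)
    also have "(\<Sum>\<rho>\<in>P - A. of_int (sym_eps (g \<circ> \<rho>) s)) = (\<Sum>\<rho>\<in>P - A. \<Sum>h\<in>basis. L \<rho> h * of_int (sym_eps h s))"
      by (rule sum.cong[OF refl L])
    also have "\<dots> = (\<Sum>h\<in>basis. (\<Sum>\<rho>\<in>P - A. L \<rho> h) * of_int (sym_eps h s))"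
      by (subst sum.swap) (simp add: sum_distrib_right)
    also have "\<dots> = (\<Sum>h\<in>basis. - of_nat (card A) * (L' h * of_int (sym_eps h s)))"
      using cA by (intro sum.cong refl) (simp add: L'_def)
    finally have "of_nat (card A) * complex_of_int (sym_eps g s) = of_nat (card A) * (\<Sum>h\<in>basis. L' h * of_int (sym_eps h s))"
      by (simp add: sum_distrib_left sum_negf algebra_simps)
    then show ?thesis using cA by simp
  qed
  then show ?thesis by (auto simp: in_span_def)
qed

definition off :: "(nat \<times> 'n \<Rightarrow> nat) \<Rightarrow> nat" where
  "off g = card {i \<in> J. col i < k \<and> g i \<noteq> col i}"

text \<open>Used twice: straightening along a chain lowers it, and it orders the triangular system
  that proves independence.\<close>

definition bot :: "(nat \<times> 'n \<Rightarrow> nat) \<Rightarrow> nat" where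
  "bot g = (\<Sum>i\<in>bottom. col i * g i)"

text \<open>Exceeds all values of \<open>bot\<close>, so that \<open>big * off g + bot g\<close>
  orders words lexicographically, by \<open>off\<close> first.\<close>

definition big :: nat where
  "big = Suc (\<Sum>i\<in>bottom. col i * k)"

lemma bottom_subset: "bottom \<subseteq> J" and finite_bottom [simp, intro]: "finite bottom"
  by (auto simp: bottom_def)

lemma bot_less_big:
  assumes "g \<in> row_words k"
  shows "bot g < big"
proof -
  have "g i \<le> k" if "i \<in> bottom" for i
    using assms that bottom_subset by (force simp: row_words_def)
  then show ?thesis
    unfolding bot_def big_def less_Suc_eq_le by (intro sum_mono mult_left_mono) auto
qed

lemma off_eq_0_iff: "off g = 0 \<longleftrightarrow> top_diag g"
  by (auto simp: off_def top_diag_def)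

lemma permutes_comp_row_words: "\<rho> permutes I \<Longrightarrow> I \<subseteq> J \<Longrightarrow> g \<in> row_words k \<Longrightarrow> g \<circ> \<rho> \<in> row_words k"
  for g :: "nat \<times> 'n \<Rightarrow> nat"
  using comp_row_words permutes_subset by blast

text \<open>I consists of i0 and the CARD('n) cells that carry the letter i0 should have. Only one
  cell of I has another letter, so a permuted word is determined by where that letter goes. A target
  of the color of i0 gives a color-preserving swap; any other target repairs i0.\<close>

lemma straighten_top:
  assumes g: "g \<in> row_words k" and bal: "balanced g"
    and i0: "i0 \<in> J" "col i0 < k" "g i0 \<noteq> col i0"
    and IH: "\<And>h. h \<in> row_words k \<Longrightarrow> off h < off g \<Longrightarrow> in_span (sym_eps h)"
  shows "in_span (sym_eps g)"
proof -
  define c0 where "c0 = col i0"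
  define I where "I = insert i0 {i \<in> J. g i = c0}"
  have I: "I \<subseteq> J" using i0 by (auto simp: I_def)
  have cardI: "card I = Suc CARD('n)"
    using bal i0 by (simp add: I_def c0_def balanced_def card_insert_if)
  show ?thesis
  proof (rule in_span_reduce[OF I])
    show "CARD('n) < card I" by (simp add: cardI)
  next
    fix \<rho> assume \<rho>: "\<rho> permutes I"
    define i1 where "i1 = inv \<rho> i0"
    have \<rho>i1: "\<rho> i1 = i0" using permutes_inverses(1)[OF \<rho>] by (simp add: i1_def)
    have i1: "i1 \<in> I" using permutes_in_image[OF permutes_inv[OF \<rho>], of i0] by (simp add: i1_def I_def)
    let ?t = "Transposition.transpose i0 i1"
    have gt: "g \<circ> \<rho> = g \<circ> ?t"
    proof
      fix i
      have g_I: "g j = c0" if "j \<in> I" "j \<noteq> i0" for j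
        using that by (auto simp: I_def)
      show "(g \<circ> \<rho>) i = (g \<circ> ?t) i"
      proof (cases "i = i1")
        case True
        then show ?thesis using \<rho>i1 by simp
      next
        case False
        then have ne: "\<rho> i \<noteq> i0"
          using \<rho>i1 permutes_inj[OF \<rho>] by (metis injD)
        show ?thesis
        proof (cases "i \<in> I")
          case True
          then have "g (\<rho> i) = c0" using ne g_I permutes_in_image[OF \<rho>] by blast
          moreover have "g (?t i) = c0"
            using True False g_I[of i] g_I[of i1] i1 by (cases "i = i0") auto
          ultimately show ?thesis by simp
        next
          case i: False
          then have "i \<noteq> i0" by (auto simp: I_def)
          then show ?thesis using permutes_not_in[OF \<rho> i] False by simp
        qed
      qed
    qed
    have t: "?t permutes J" using i1 I i0 by (intro permutes_swap_id) auto
    have rw: "g \<circ> ?t \<in> row_words k" by (rule comp_row_words[OF t g])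
    show "sym_eps (g \<circ> \<rho>) = sym_eps g \<or> in_span (sym_eps (g \<circ> \<rho>))"
    proof (cases "col i1 = c0")
      case True
      then have "col \<circ> ?t = col" by (auto simp: fun_eq_iff Transposition.transpose_def c0_def)
      then have "?t \<in> young" using t by (simp add: young_def)
      then have "sym_eps (g \<circ> \<rho>) = sym_eps g" unfolding gt by (intro ext sym_eps_comp_row)
      then show ?thesis ..
    next
      case False
      then have ne: "i1 \<noteq> i0" by (auto simp: c0_def)
      have gi1: "g i1 = c0" using i1 ne by (auto simp: I_def)
      \<comment> \<open>\<open>i1\<close> carried a letter different from its color, so if its color
        is below k it was a violation already.\<close>
      have "{i \<in> J. col i < k \<and> (g \<circ> ?t) i \<noteq> col i} \<subset> {i \<in> J. col i < k \<and> g i \<noteq> col i}"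
      proof (rule psubsetI)
        show "{i \<in> J. col i < k \<and> (g \<circ> ?t) i \<noteq> col i} \<subseteq> {i \<in> J. col i < k \<and> g i \<noteq> col i}"
          using gi1 False i0 by (auto simp: Transposition.transpose_def c0_def split: if_splits)
        have "i0 \<notin> {i \<in> J. col i < k \<and> (g \<circ> ?t) i \<noteq> col i}" using gi1 by (simp add: c0_def)
        then show "{i \<in> J. col i < k \<and> (g \<circ> ?t) i \<noteq> col i} \<noteq> {i \<in> J. col i < k \<and> g i \<noteq> col i}"
          using i0 by blast
      qed
      then have "off (g \<circ> ?t) < off g"
        unfolding off_def by (intro psubset_card_mono) auto
      then show ?thesis using IH[OF rw] gt by simp
    qed
  qed
qed

text \<open>By the rearrangement inequality, permuting the letters along a chain either lowers
  \<open>bot\<close> or keeps the joint counts of color and letter, and with them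
  \<open>sym_eps\<close>.\<close>

lemma straighten_bottom:
  assumes g: "g \<in> row_words k" and top: "top_diag g"
    and I: "I \<subseteq> bottom" "similar g I" "card I > CARD('n)"
    and IH: "\<And>h. h \<in> row_words k \<Longrightarrow> top_diag h \<Longrightarrow> bot h < bot g \<Longrightarrow> in_span (sym_eps h)"
  shows "in_span (sym_eps g)"
proof (rule in_span_reduce[OF _ I(3)])
  show Ic: "I \<subseteq> J" using I(1) bottom_subset by simp
  fix \<rho> assume \<rho>: "\<rho> permutes I"
  have finI: "finite I" using I(1) finite_subset by blast
  have rw: "g \<circ> \<rho> \<in> row_words k" by (rule permutes_comp_row_words[OF \<rho> Ic g])
  have out: "(g \<circ> \<rho>) i = g i" if "i \<notin> I" for i
    using permutes_not_in[OF \<rho> that] by simp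
  have td: "top_diag (g \<circ> \<rho>)"
    unfolding top_diag_def
  proof (intro ballI impI)
    fix i assume i: "i \<in> J" "col i < k"
    then have "i \<notin> I" using I(1) by (auto simp: bottom_def)
    with out top i show "(g \<circ> \<rho>) i = col i" by (simp add: top_diag_def)
  qed
  have sim: "(col i \<le> col j \<and> g i \<le> g j) \<or> (col j \<le> col i \<and> g j \<le> g i)" if "i \<in> I" "j \<in> I" for i j
    using I(2) that by (simp add: similar_def)
  have split: "bot h = (\<Sum>i\<in>bottom - I. col i * h i) + (\<Sum>i\<in>I. col i * h i)" for h
    unfolding bot_def by (rule sum.subset_diff[OF I(1) finite_bottom])
  have same: "(\<Sum>i\<in>bottom - I. col i * (g \<circ> \<rho>) i) = (\<Sum>i\<in>bottom - I. col i * g i)"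
    using out by (intro sum.cong) auto
  show "sym_eps (g \<circ> \<rho>) = sym_eps g \<or> in_span (sym_eps (g \<circ> \<rho>))"
  proof (cases "(\<Sum>i\<in>I. col i * g (\<rho> i)) = (\<Sum>i\<in>I. col i * g i)")
    case True
    have "sym_eps (g \<circ> \<rho>) = sym_eps g"
    proof (rule sym_eps_eq_if_card_eq)
      fix x y :: nat
      have "card {i \<in> J. col i = x \<and> h i = y} =
          card {i \<in> I. col i = x \<and> h i = y} + card {i \<in> J - I. col i = x \<and> h i = y}" for h
      proof -
        have "{i \<in> J. col i = x \<and> h i = y} =
            {i \<in> I. col i = x \<and> h i = y} \<union> {i \<in> J - I. col i = x \<and> h i = y}"
          using Ic by auto
        then show ?thesis using finI by (simp add: card_Un_disjoint disjoint_iff)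
      qed
      moreover have "{i \<in> J - I. col i = x \<and> (g \<circ> \<rho>) i = y} = {i \<in> J - I. col i = x \<and> g i = y}"
        using out by auto
      ultimately show "card {i \<in> J. col i = x \<and> (g \<circ> \<rho>) i = y} = card {i \<in> J. col i = x \<and> g i = y}"
        using rearrangement(2)[OF finI \<rho> sim True, of x y] by simp
    qed
    then show ?thesis ..
  next
    case False
    moreover have "(\<Sum>i\<in>I. col i * g (\<rho> i)) \<le> (\<Sum>i\<in>I. col i * g i)"
      using sim by (rule rearrangement(1)[OF finI \<rho>])
    ultimately have "bot (g \<circ> \<rho>) < bot g"
      using same by (simp add: split)
    then show ?thesis using IH[OF rw td] by simp
  qed
qed

text \<open>Repairing the upper colors may raise \<open>bot\<close>, which the weight of
  \<open>off\<close> in the measure absorbs. Chains are treated once \<open>off\<close> is 0, and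
  that step keeps it 0. Unbalanced words give the zero vector.\<close>

lemma in_span_sym_eps: "g \<in> row_words k \<Longrightarrow> in_span (sym_eps g)"
proof (induction "big * off g + bot g" arbitrary: g rule: less_induct)
  case less
  note g = less.prems
  show ?case
  proof (cases "balanced g")
    case False
    then show ?thesis
      unfolding in_span_def using sym_eps_not_balanced[OF g] by (intro exI[of _ "\<lambda>_. 0"]) simp
  next
    case bal: True
    show ?thesis
    proof (cases "top_diag g")
      case False
      then obtain i0 where i0: "i0 \<in> J" "col i0 < k" "g i0 \<noteq> col i0"
        by (auto simp: top_diag_def)
      show ?thesis
      proof (rule straighten_top[OF g bal i0])
        fix h :: "nat \<times> 'n \<Rightarrow> nat" assume h: "h \<in> row_words k" and "off h < off g"
        then have "big * Suc (off h) \<le> big * off g" by (intro mult_left_mono) auto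
        then have "big * off h + bot h < big * off g + bot g"
          using bot_less_big[OF h] by simp
        then show "in_span (sym_eps h)" using less.hyps h by blast
      qed
    next
      case top: True
      show ?thesis
      proof (cases "good g")
        case True
        have "sym_eps (rep (count_mat g)) = sym_eps g"
          using rep_count_mat[OF True] top g by (intro sym_eps_eq_if_count_mat_eq) (auto simp: good_def)
        moreover have "rep (count_mat g) \<in> basis" using True by (auto simp: basis_def)
        ultimately have "complex_of_int (sym_eps g s) =
            (\<Sum>h\<in>basis. (if h = rep (count_mat g) then 1 else 0) * of_int (sym_eps h s))" for s
          using finite_basis by (simp add: if_distrib[of "\<lambda>x. x * _"] cong: if_cong)
        then show ?thesis
          unfolding in_span_def by (intro exI[of _ "\<lambda>h. if h = rep (count_mat g) then 1 else 0"] allI)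
      next
        case False
        then obtain I where I: "I \<subseteq> bottom" "similar g I" "card I > CARD('n)"
          using g top bal by (auto simp: good_def not_le)
        show ?thesis
        proof (rule straighten_bottom[OF g top I])
          fix h :: "nat \<times> 'n \<Rightarrow> nat" assume h: "h \<in> row_words k" "top_diag h" "bot h < bot g"
          then have "off h = 0" "off g = 0" using top by (simp_all add: off_eq_0_iff)
          then have "big * off h + bot h < big * off g + bot g" using h by simp
          then show "in_span (sym_eps h)" using less.hyps h by blast
        qed
      qed
    qed
  qed
qed

end

section \<open>Independence of the standard vectors\<close>

lemma sum_card_fibers:
  assumes "finite F" "finite T" "\<And>i. i \<in> F \<Longrightarrow> f i \<in> T"
  shows "(\<Sum>t\<in>T. card {i \<in> F. f i = t}) = card F"
proof -
  have "(\<Sum>t\<in>T. \<Sum>i\<in>{i \<in> F. f i = t}. 1 :: nat) = (\<Sum>i\<in>F. 1)"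
    by (rule sum.group) (use assms in auto)
  then show ?thesis by simp
qed

context coloring
begin

text \<open>The letters of s name antichains of bottom cells: within one letter, colors increase
  strictly as the letters of g decrease.\<close>

definition antichain_word :: "(nat \<times> 'n \<Rightarrow> nat) \<Rightarrow> (nat \<times> 'n \<Rightarrow> 'n) \<Rightarrow> bool" where
  "antichain_word g s \<longleftrightarrow> s \<in> col_words k \<and> inj_on (\<lambda>i. (g i, s i)) (J) \<and>
     (\<forall>i\<in>bottom. \<forall>j\<in>bottom. i \<noteq> j \<longrightarrow> s i = s j \<longrightarrow>
        (col i < col j \<and> g j < g i) \<or> (col j < col i \<and> g i < g j))"

lemma good_antichain_word:
  assumes "good g"
  obtains s where "antichain_word g s"
proof -
  have g: "g \<in> row_words k" and top: "\<And>i. i \<in> J \<Longrightarrow> col i < k \<Longrightarrow> g i = col i"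
    and bal: "\<And>j. j < k \<Longrightarrow> card {i \<in> J. g i = j} = CARD('n)"
    and chain: "\<And>I. I \<subseteq> bottom \<Longrightarrow> similar g I \<Longrightarrow> card I \<le> CARD('n)"
    using assms by (auto simp: good_def top_diag_def balanced_def)
  obtain h :: "nat \<times> 'n \<Rightarrow> nat" where h: "inj_on h (J)"
    using finite_imp_inj_to_nat_seg[OF finite_cells] by metis
  \<comment> \<open>The injection \<open>h\<close> breaks ties, so that \<open>R\<close> is strict
    and cells equal in color and letter are still comparable.\<close>
  define R where "R i j \<longleftrightarrow> col i \<le> col j \<and> g i \<le> g j \<and> (col i = col j \<and> g i = g j \<longrightarrow> h i < h j)"
    for i j
  have R_total: "R i j \<or> R j i"
    if "i \<in> bottom" "j \<in> bottom" "i \<noteq> j" "(col i \<le> col j \<and> g i \<le> g j) \<or> (col j \<le> col i \<and> g j \<le> g i)" for i j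
  proof -
    have "h i \<noteq> h j" using h that bottom_subset by (auto simp: inj_on_def)
    show ?thesis
    proof (cases "col i = col j \<and> g i = g j")
      case True
      then have "R i j \<longleftrightarrow> h i < h j" "R j i \<longleftrightarrow> h j < h i" by (simp_all add: R_def)
      with \<open>h i \<noteq> h j\<close> show ?thesis by linarith
    next
      case False
      then have "R i j \<longleftrightarrow> col i \<le> col j \<and> g i \<le> g j" "R j i \<longleftrightarrow> col j \<le> col i \<and> g j \<le> g i"
        unfolding R_def by metis+
      with that(4) show ?thesis by blast
    qed
  qed
  obtain lev where lev: "\<And>i. i \<in> bottom \<Longrightarrow> lev i < CARD('n)"
    "\<And>i j. i \<in> bottom \<Longrightarrow> j \<in> bottom \<Longrightarrow> R i j \<Longrightarrow> lev i < lev j"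
  proof (rule chain_levels[of bottom R "CARD('n)"])
    show "\<not> R x x" for x by (simp add: R_def)
    show "R x z" if "R x y" "R y z" for x y z
      using that by (auto simp: R_def)
    show "card C \<le> CARD('n)" if "C \<subseteq> bottom" and c: "\<And>x y. x \<in> C \<Longrightarrow> y \<in> C \<Longrightarrow> x \<noteq> y \<Longrightarrow> R x y \<or> R y x" for C
    proof (rule chain[OF that(1)])
      show "similar g C"
        unfolding similar_def
      proof (intro ballI)
        fix i j assume "i \<in> C" "j \<in> C"
        then show "(col i \<le> col j \<and> g i \<le> g j) \<or> (col j \<le> col i \<and> g j \<le> g i)"
          using c[of i j] by (cases "i = j") (auto simp: R_def)
      qed
    qed
  qed auto
  obtain e where e: "bij_betw e {..<CARD('n)} (UNIV :: 'n set)"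
    using ex_bij_betw_nat_finite[of "UNIV :: 'n set"] by (auto simp: atLeast0LessThan)
  have incomparable: "(col i < col j \<and> g j < g i) \<or> (col j < col i \<and> g i < g j)"
    if ij: "i \<in> bottom" "j \<in> bottom" "i \<noteq> j" "e (lev i) = e (lev j)" for i j
  proof -
    have "lev i = lev j"
      using bij_betw_imp_inj_on[OF e] lev(1) ij by (auto simp: inj_on_def)
    then have "\<not> R i j" "\<not> R j i" using lev(2) ij by fastforce+
    then have "\<not> ((col i \<le> col j \<and> g i \<le> g j) \<or> (col j \<le> col i \<and> g j \<le> g i))"
      using R_total[OF ij(1-3)] by blast
    then show ?thesis by linarith
  qed
  define B where "B j = {i \<in> bottom. g i = j}" for j
  define T where "T j = {i \<in> J. col i = j}" for j
  have inj_B: "inj_on (\<lambda>i. e (lev i)) (B j)" for j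
    using incomparable by (fastforce simp: inj_on_def B_def)
  have "\<exists>f. bij_betw f (T j) (UNIV - (\<lambda>i. e (lev i)) ` B j)" if j: "j < k" for j
  proof (rule finite_same_card_bij)
    show "finite (T j)" by (simp add: T_def)
    have "{i \<in> J. g i = j} = T j \<union> B j"
    proof (intro equalityI subsetI)
      fix i assume "i \<in> {i \<in> J. g i = j}"
      then show "i \<in> T j \<union> B j"
        using top[of i] by (cases "col i < k") (auto simp: T_def B_def bottom_def)
    next
      fix i assume "i \<in> T j \<union> B j"
      then show "i \<in> {i \<in> J. g i = j}"
        using top[of i] j by (auto simp: T_def B_def bottom_def)
    qed
    moreover have "T j \<inter> B j = {}" using j by (auto simp: T_def B_def bottom_def)
    ultimately have "card (T j) + card (B j) = CARD('n)"
      using bal[OF j] by (simp add: card_Un_disjoint T_def B_def)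
    moreover have "card (UNIV - (\<lambda>i. e (lev i)) ` B j) = CARD('n) - card (B j)"
      by (simp add: card_Diff_subset card_image[OF inj_B])
    ultimately show "card (T j) = card (UNIV - (\<lambda>i. e (lev i)) ` B j)" by simp
  qed simp
  then obtain f where f: "\<And>j. j < k \<Longrightarrow> bij_betw (f j) (T j) (UNIV - (\<lambda>i. e (lev i)) ` B j)"
    by metis
  define s where "s = (\<lambda>i\<in>J. if col i < k then f (col i) i else e (lev i))"
  have s_bot: "s i = e (lev i)" if "i \<in> bottom" for i
    using that by (auto simp: s_def bottom_def)
  have s_top: "s i = f (g i) i" "i \<in> T (g i)" "g i < k" if "i \<in> J" "i \<notin> bottom" for i
    using that top[of i] by (auto simp: s_def bottom_def T_def)
  have top_bot: "s i \<noteq> s j" if "i \<in> J" "i \<notin> bottom" "j \<in> bottom" "g i = g j" for i j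
  proof -
    have "s i \<in> UNIV - (\<lambda>i. e (lev i)) ` B (g i)"
      using s_top[OF that(1,2)] bij_betwE[OF f] by metis
    then show ?thesis using that s_bot by (auto simp: B_def)
  qed
  have "inj_on (\<lambda>i. (g i, s i)) (J)"
  proof (rule inj_onI)
    fix i j assume ij: "i \<in> J" "j \<in> J" "(g i, s i) = (g j, s j)"
    show "i = j"
    proof (cases "i \<in> bottom"; cases "j \<in> bottom")
      assume b: "i \<in> bottom" "j \<in> bottom"
      show ?thesis using incomparable[OF b] ij b by (auto simp: s_bot)
    next
      assume b: "i \<notin> bottom" "j \<notin> bottom"
      have "f (g i) i = f (g i) j" "i \<in> T (g i)" "j \<in> T (g i)" "g i < k"
        using s_top[OF ij(1) b(1)] s_top[OF ij(2) b(2)] ij(3) by auto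
      then show ?thesis using bij_betw_imp_inj_on[OF f] by (metis inj_onD)
    qed (use top_bot ij in fastforce)+
  qed
  moreover have "s \<in> col_words k" by (simp add: s_def col_words_def)
  ultimately have "antichain_word g s"
    using incomparable s_bot by (auto simp: antichain_word_def)
  then show ?thesis by (rule that)
qed

lemma inj_pair_surj:
  assumes g: "g \<in> row_words k" and inj: "inj_on (\<lambda>i. (g i, s i)) (J)" and "j < k"
  obtains i where "i \<in> J" "g i = j" "s i = (q :: 'n)"
proof -
  have p: "pair_map k g s permutes J"
    using pair_map_permutes_iff[OF g] inj by simp
  have "(j, q) \<in> J" using \<open>j < k\<close> by (simp add: cells_def)
  then obtain i where "i \<in> J" "(j, q) = pair_map k g s i"
    using permutes_image[OF p] by blast
  then show ?thesis using that[of i] by (simp add: pair_map_def)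
qed

text \<open>On the bottom cells where s has a fixed letter, g and h take the same set of values.
  There g is ordered opposite to the color, which minimises the weighted sum; the colors are
  distinct, so equality determines the arrangement.\<close>

lemma antichain_word_minimal:
  assumes good: "good g" and s: "antichain_word g s"
    and h: "h \<in> row_words k" "top_diag h" "eps k h s \<noteq> 0"
  shows "bot g \<le> bot h" and "bot g = bot h \<Longrightarrow> i \<in> J \<Longrightarrow> h i = g i"
proof -
  have g: "g \<in> row_words k" "top_diag g" using good by (auto simp: good_def)
  have inj_g: "inj_on (\<lambda>i. (g i, s i)) (J)" using s by (simp add: antichain_word_def)
  have inj_h: "inj_on (\<lambda>i. (h i, s i)) (J)" using eps_nonzero_iff[OF h(1)] h(3) by blast
  define F where "F q = {i \<in> bottom. s i = q}" for q
  have F_cells: "F q \<subseteq> J" for q using bottom_subset by (auto simp: F_def)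
  have finF: "finite (F q)" for q by (simp add: F_def)
  \<comment> \<open>The cell with the pair (j, q) under b cannot be a top cell: a and b agree on top
    cells, so a would have this pair at two cells.\<close>
  have image_sub: "a ` F q \<subseteq> b ` F q"
    if a: "a \<in> row_words k" "top_diag a" "inj_on (\<lambda>i. (a i, s i)) (J)"
      and b: "b \<in> row_words k" "top_diag b" "inj_on (\<lambda>i. (b i, s i)) (J)" for a b q
  proof
    fix j assume "j \<in> a ` F q"
    then obtain i where i: "i \<in> F q" "a i = j" by auto
    have "j < k" using i F_cells a(1) by (auto simp: row_words_def)
    then obtain i' where i': "i' \<in> J" "b i' = j" "s i' = q"
      using inj_pair_surj[OF b(1,3)] by metis
    have "i' \<in> bottom"
    proof (rule ccontr)
      assume nb: "i' \<notin> bottom"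
      then have "a i' = b i'" using i' a(2) b(2) by (auto simp: top_diag_def bottom_def)
      then have "i' = i" using a(3) i i' F_cells by (auto simp: inj_on_def F_def)
      then show False using nb i by (simp add: F_def)
    qed
    then show "j \<in> b ` F q" using i' by (auto simp: F_def)
  qed
  have image_eq: "g ` F q = h ` F q" for q
    using image_sub[OF g inj_g h(1,2) inj_h] image_sub[OF h(1,2) inj_h g inj_g] by blast
  have inj_F: "inj_on a (F q)" if "inj_on (\<lambda>i. (a i, s i)) J" for a :: "nat \<times> 'n \<Rightarrow> nat" and q
  proof (rule inj_onI)
    fix i j assume ij: "i \<in> F q" "j \<in> F q" "a i = a j"
    have "i \<in> J" "j \<in> J" using ij(1,2) F_cells by blast+
    moreover have "s i = q" "s j = q" using ij by (simp_all add: F_def)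
    ultimately show "i = j" using inj_onD[OF that, of i j] ij(3) by simp
  qed
  note injg = inj_F[OF inj_g] and injh = inj_F[OF inj_h]
  have ex_perm: "\<exists>\<rho>. \<rho> permutes F q \<and> (\<forall>i\<in>F q. g (\<rho> i) = h i)" for q
  proof -
    define \<rho> where "\<rho> i = (if i \<in> F q then inv_into (F q) g (h i) else i)" for i
    have \<rho>: "\<rho> i \<in> F q \<and> g (\<rho> i) = h i" if "i \<in> F q" for i
    proof -
      have "h i \<in> g ` F q" using that image_eq by auto
      then show ?thesis using that by (simp add: \<rho>_def inv_into_into f_inv_into_f)
    qed
    have "\<rho> permutes F q"
    proof (rule inj_imp_permutes)
      show "inj_on \<rho> (F q)"
      proof (rule inj_onI)
        fix i j assume ij: "i \<in> F q" "j \<in> F q" "\<rho> i = \<rho> j"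
        then have "h i = h j" using \<rho> by metis
        then show "i = j" using injh ij by (auto simp: inj_on_def)
      qed
    qed (use \<rho> finF in \<open>auto simp: \<rho>_def\<close>)
    then show ?thesis using \<rho> by blast
  qed
  have anti: "(col i \<le> col j \<and> g j \<le> g i) \<or> (col j \<le> col i \<and> g i \<le> g j)" if "i \<in> F q" "j \<in> F q" for i j q
  proof (cases "i = j")
    case False
    moreover have "i \<in> bottom" "j \<in> bottom" "s i = s j" using that by (auto simp: F_def)
    ultimately have "(col i < col j \<and> g j < g i) \<or> (col j < col i \<and> g i < g j)"
      using s unfolding antichain_word_def by blast
    then show ?thesis by linarith
  qed simp
  have inj_col: "inj_on col (F q)" for q
  proof (rule inj_onI)
    fix i j assume "i \<in> F q" "j \<in> F q" "col i = col j"
    then show "i = j"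
      using s unfolding antichain_word_def F_def by (metis (mono_tags, lifting) less_irrefl mem_Collect_eq)
  qed
  have le: "(\<Sum>i\<in>F q. col i * g i) \<le> (\<Sum>i\<in>F q. col i * h i)"
    and eq: "(\<Sum>i\<in>F q. col i * g i) = (\<Sum>i\<in>F q. col i * h i) \<Longrightarrow> i \<in> F q \<Longrightarrow> h i = g i" for q i
  proof -
    obtain \<rho> where \<rho>: "\<rho> permutes F q" "\<And>i. i \<in> F q \<Longrightarrow> g (\<rho> i) = h i" using ex_perm by blast
    have sum_eq: "(\<Sum>i\<in>F q. col i * g (\<rho> i)) = (\<Sum>i\<in>F q. col i * h i)"
      by (intro sum.cong) (simp_all add: \<rho>(2))
    have "(\<Sum>i\<in>F q. col i * g i) \<le> (\<Sum>i\<in>F q. col i * g (\<rho> i))"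
      using anti by (rule rearrangement_anti(1)[OF finF \<rho>(1)])
    then show "(\<Sum>i\<in>F q. col i * g i) \<le> (\<Sum>i\<in>F q. col i * h i)"
      by (simp only: sum_eq)
    show "h i = g i" if eq: "(\<Sum>i\<in>F q. col i * g i) = (\<Sum>i\<in>F q. col i * h i)" and i: "i \<in> F q"
    proof -
      have "(\<Sum>i\<in>F q. col i * g i) = (\<Sum>i\<in>F q. col i * g (\<rho> i))" using eq sum_eq by simp
      with anti inj_col have "g (\<rho> i) = g i"
        using i by (rule rearrangement_anti(2)[OF finF \<rho>(1)])
      then show ?thesis by (simp only: \<rho>(2)[OF i])
    qed
  qed
  have bot: "bot a = (\<Sum>q\<in>UNIV. \<Sum>i\<in>F q. col i * a i)" for a
    unfolding bot_def F_def by (rule sum.group[symmetric]) auto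
  show "bot g \<le> bot h" unfolding bot by (rule sum_mono) (rule le)
  assume "bot g = bot h" and i: "i \<in> J"
  then have "(\<Sum>i\<in>F q. col i * g i) = (\<Sum>i\<in>F q. col i * h i)" for q
    using sum_mono_inv[of "\<lambda>q. \<Sum>i\<in>F q. col i * g i" UNIV "\<lambda>q. \<Sum>i\<in>F q. col i * h i"] le
    by (auto simp: bot)
  then show "h i = g i"
    using eq[of "s i" i] i g(2) h(2) by (cases "i \<in> bottom") (auto simp: F_def top_diag_def bottom_def)
qed

lemma young_col: "p \<in> young \<Longrightarrow> col (p i) = col i"
  unfolding young_def by (metis (mono_tags, lifting) comp_apply mem_Collect_eq)

lemma bot_comp_young:
  assumes p: "p \<in> young"
  shows "bot (g \<circ> p) = bot g"
proof -
  have bot: "bot h = (\<Sum>i\<in>J. if k \<le> col i then col i * h i else 0)" for h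
    unfolding bot_def bottom_def by (simp add: sum.inter_filter)
  note col = young_col[OF p]
  have "bot g = (\<Sum>i\<in>J. if k \<le> col (p i) then col (p i) * g (p i) else 0)"
    using sum.permute[OF young_permutes[OF p], of "\<lambda>i. if k \<le> col i then col i * g i else 0"]
    by (simp add: bot o_def)
  then show ?thesis by (simp add: bot col cong: if_cong)
qed

lemma top_diag_comp_young:
  assumes "p \<in> young" "top_diag g"
  shows "top_diag (g \<circ> p)"
proof -
  have "col (p i) = col i" "p i \<in> J \<longleftrightarrow> i \<in> J" for i
    using young_col[OF assms(1)] permutes_in_image[OF young_permutes[OF assms(1)]] by simp_all
  then show ?thesis
    using assms(2) unfolding top_diag_def by (metis comp_apply)
qed

lemma count_mat_comp_young:
  assumes p: "p \<in> young"
  shows "count_mat (g \<circ> p) = count_mat g"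
proof -
  have "card {i \<in> J. col i = k + r \<and> (g \<circ> p) i = j} = card {i \<in> J. col i = k + r \<and> g i = j}" for r j
    using card_comp_permutes[OF young_permutes[OF p], of "\<lambda>i. col i = k + r \<and> g i = j"]
    by (simp add: young_col[OF p])
  then show ?thesis by (simp only: count_mat_def)
qed

text \<open>An antichain word of g is the witness. By minimality only the permutations that fix g on
  the cells contribute to \<open>sym_eps g s\<close>, all with the same value, so nothing cancels. A
  basis word with nonzero value there and equal \<open>bot\<close> has the same count matrix, hence
  is g.\<close>

lemma basis_triangular:
  assumes g: "g \<in> basis"
  shows "\<exists>s\<in>col_words k. sym_eps g s \<noteq> 0 \<and> (\<forall>h\<in>basis. sym_eps h s \<noteq> 0 \<longrightarrow> h = g \<or> bot g < bot h)"
proof -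
  have good: "good g" using basis_good[OF g] .
  then obtain s where s: "antichain_word g s" by (rule good_antichain_word)
  have rw: "h \<circ> p \<in> row_words k" "top_diag (h \<circ> p)" if "good h" "p \<in> young" for h p
    using that comp_row_words[OF young_permutes] top_diag_comp_young by (auto simp: good_def)
  have "eps k (g \<circ> p) s = (if \<forall>i\<in>J. (g \<circ> p) i = g i then eps k g s else 0)" if p: "p \<in> young" for p
  proof (cases "\<forall>i\<in>J. (g \<circ> p) i = g i")
    case True
    then show ?thesis by (auto intro: eps_cong)
  next
    case False
    then have "eps k (g \<circ> p) s = 0"
      using antichain_word_minimal(2)[OF good s rw[OF good p]] bot_comp_young[OF p, of g] by auto
    then show ?thesis by (simp only: False if_False)
  qed
  then have "sym_eps g s = (\<Sum>p\<in>young. if \<forall>i\<in>J. (g \<circ> p) i = g i then eps k g s else 0)"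
    by (simp add: sym_eps_def)
  also have "\<dots> = int (card {p \<in> young. \<forall>i\<in>J. (g \<circ> p) i = g i}) * eps k g s"
    by (simp add: sum.inter_filter[symmetric])
  finally have sum: "sym_eps g s = int (card {p \<in> young. \<forall>i\<in>J. (g \<circ> p) i = g i}) * eps k g s" .
  define P where "P = {p \<in> young. \<forall>i\<in>J. (g \<circ> p) i = g i}"
  have "finite P" "id \<in> P" by (simp_all add: P_def)
  then have "card P \<noteq> 0" by auto
  moreover have "eps k g s \<noteq> 0"
    using s good eps_nonzero_iff by (auto simp: antichain_word_def good_def)
  moreover have "sym_eps g s = int (card P) * eps k g s"
    using sum by (simp only: P_def)
  ultimately have nz: "sym_eps g s \<noteq> 0" by simp
  have "h = g \<or> bot g < bot h" if h: "h \<in> basis" "sym_eps h s \<noteq> 0" for h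
  proof -
    have good_h: "good h" using basis_good[OF h(1)] .
    obtain p where p: "p \<in> young" "eps k (h \<circ> p) s \<noteq> 0"
      using h(2) unfolding sym_eps_def by (meson sum.not_neutral_contains_not_neutral)
    note m = antichain_word_minimal[OF good s rw[OF good_h p(1)] p(2)]
    show ?thesis
    proof (cases "bot g = bot h")
      case True
      then have "\<And>i. i \<in> J \<Longrightarrow> (h \<circ> p) i = g i" using m(2) by (simp add: bot_comp_young[OF p(1)])
      then have "{i \<in> J. col i = k + r \<and> (h \<circ> p) i = j} = {i \<in> J. col i = k + r \<and> g i = j}" for r j
        by auto
      then have "count_mat (h \<circ> p) = count_mat g" by (simp only: count_mat_def)
      then have "count_mat h = count_mat g" by (simp add: count_mat_comp_young[OF p(1)])
      then show ?thesis using inj_on_count_mat_basis h(1) g by (auto simp: inj_on_def)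
    next
      case False
      then show ?thesis using m(1) by (simp add: bot_comp_young[OF p(1)])
    qed
  qed
  then show ?thesis using s nz by (auto simp: antichain_word_def)
qed

end

section \<open>Chains in matrices\<close>

lemma SE_chain_comparable:
  assumes "SE_chain A ps" "p \<in> set ps" "q \<in> set ps"
  shows "(fst p \<le> fst q \<and> snd p \<le> snd q) \<or> (fst q \<le> fst p \<and> snd q \<le> snd p)"
proof -
  let ?P = "\<lambda>(i :: nat, j :: nat) (i', j'). i \<le> i' \<and> j \<le> j'"
  have "transp ?P" by (auto simp: transp_def)
  then have sorted: "sorted_wrt ?P ps"
    using assms(1) by (simp add: SE_chain_def successively_conv_sorted_wrt)
  obtain a b where ab: "a < length ps" "b < length ps" "p = ps ! a" "q = ps ! b"
    using assms(2,3) by (auto simp: in_set_conv_nth)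
  then show ?thesis
    using sorted by (cases a b rule: linorder_cases)
      (auto simp: sorted_wrt_iff_nth_less case_prod_unfold)
qed

lemma SE_length_distinct: "SE_chain A ps \<Longrightarrow> SE_length A ps = (\<Sum>p\<in>set ps. A $$ p)"
  by (simp add: SE_length_def SE_chain_def sum_list_distinct_conv_sum_set)

lemma finite_SE_lengths: "finite {SE_length A ps | ps. SE_chain A ps}"
proof -
  have "finite {ps. SE_chain A ps}"
    by (rule finite_subset[OF _ finite_subset_distinct[of "{..<dim_row A} \<times> {..<dim_col A}"]])
      (auto simp: SE_chain_def)
  then show ?thesis by simp
qed

lemma SE_length_le_longest: "SE_chain A ps \<Longrightarrow> SE_length A ps \<le> longest_SE_chain A"
  unfolding longest_SE_chain_def by (rule Max_ge[OF finite_SE_lengths]) auto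

lemma longest_SE_chain_le:
  assumes "\<And>ps. SE_chain A ps \<Longrightarrow> SE_length A ps \<le> N"
  shows "longest_SE_chain A \<le> N"
proof -
  have "SE_chain A []" by (simp add: SE_chain_def)
  then show ?thesis
    unfolding longest_SE_chain_def using assms by (intro Max.boundedI[OF finite_SE_lengths]) auto
qed

text \<open>Sorting pairwise comparable positions by the sum of their coordinates lists them as an
  SE-chain.\<close>

lemma comparable_sum_le_longest:
  assumes P: "P \<subseteq> {..<dim_row A} \<times> {..<dim_col A}"
    and comp: "\<And>p q. p \<in> P \<Longrightarrow> q \<in> P \<Longrightarrow> (fst p \<le> fst q \<and> snd p \<le> snd q) \<or> (fst q \<le> fst p \<and> snd q \<le> snd p)"
  shows "(\<Sum>p\<in>P. A $$ p) \<le> longest_SE_chain A"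
proof -
  have "finite P" by (rule finite_subset[OF P]) simp
  then obtain xs where xs: "set xs = P" "distinct xs" using finite_distinct_list by blast
  let ?f = "\<lambda>p :: nat \<times> nat. fst p + snd p"
  define ps where "ps = sort_key ?f xs"
  have ps: "set ps = P" "distinct ps" "sorted (map ?f ps)" using xs by (simp_all add: ps_def)
  have "sorted_wrt (\<lambda>(i, j) (i', j'). i \<le> i' \<and> j \<le> j') ps"
    unfolding sorted_wrt_iff_nth_less
  proof (intro allI impI)
    fix a b assume ab: "a < b" "b < length ps"
    have "?f (ps ! a) \<le> ?f (ps ! b)"
      using sorted_nth_mono[OF ps(3), of a b] ab by simp
    moreover have "ps ! a \<in> P" "ps ! b \<in> P" using ab ps(1) by (metis nth_mem order.strict_trans)+
    ultimately show "(\<lambda>(i, j) (i', j'). i \<le> i' \<and> j \<le> j') (ps ! a) (ps ! b)"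
      using comp[of "ps ! a" "ps ! b"] by (auto simp: case_prod_unfold)
  qed
  then have "SE_chain A ps"
    using ps P by (simp add: SE_chain_def successively_if_sorted_wrt)
  then show ?thesis
    using SE_length_le_longest[of A ps] by (simp add: SE_length_distinct ps(1))
qed

lemma ex_function_with_fibers:
  fixes f :: "nat \<Rightarrow> nat"
  assumes "finite F" "card F = (\<Sum>j<k. f j)"
  shows "\<exists>\<gamma>. (\<forall>i\<in>F. \<gamma> i < k) \<and> (\<forall>j<k. card {i \<in> F. \<gamma> i = j} = f j)"
  using assms
proof (induct k arbitrary: F)
  case 0
  then show ?case by simp
next
  case (Suc k)
  then obtain D where D: "D \<subseteq> F" "card D = f k" "finite D"
    by (metis le_add2 obtain_subset_with_card_n sum.lessThan_Suc)
  then have "card (F - D) = (\<Sum>j<k. f j)"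
    using Suc.prems by (simp add: card_Diff_subset)
  then obtain \<gamma> where \<gamma>: "\<And>i. i \<in> F - D \<Longrightarrow> \<gamma> i < k" "\<And>j. j < k \<Longrightarrow> card {i \<in> F - D. \<gamma> i = j} = f j"
    using Suc.hyps[of "F - D"] Suc.prems(1) by auto
  define \<gamma>' where "\<gamma>' i = (if i \<in> D then k else \<gamma> i)" for i
  have "card {i \<in> F. \<gamma>' i = j} = f j" if "j < Suc k" for j
  proof (cases "j = k")
    case True
    have "{i \<in> F. \<gamma>' i = j} = D"
    proof (intro equalityI subsetI)
      fix i assume i: "i \<in> {i \<in> F. \<gamma>' i = j}"
      show "i \<in> D"
      proof (rule ccontr)
        assume "i \<notin> D"
        then show False using i \<gamma>(1)[of i] True by (simp add: \<gamma>'_def)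
      qed
    qed (use D(1) True in \<open>auto simp: \<gamma>'_def\<close>)
    then show ?thesis using D True by simp
  next
    case False
    have "{i \<in> F. \<gamma>' i = j} = {i \<in> F - D. \<gamma> i = j}"
      using False D(1) by (auto simp: \<gamma>'_def)
    then show ?thesis using \<gamma>(2)[of j] that False by simp
  qed
  moreover have "\<gamma>' i < Suc k" if "i \<in> F" for i
    using \<gamma>(1)[of i] that by (auto simp: \<gamma>'_def less_Suc_eq)
  ultimately show ?case by blast
qed

context coloring
begin

definition margin_mats :: "nat mat set" where
  "margin_mats = {A \<in> carrier_mat k k. longest_SE_chain A \<le> CARD('n) \<and>
     (\<forall>r<k. (\<Sum>j<k. A $$ (r, j)) = card {i \<in> J. col i = k + r}) \<and>
     (\<forall>j<k. card {i \<in> J. col i = j} + (\<Sum>r<k. A $$ (r, j)) = CARD('n))}"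

lemma row_sum_count:
  assumes "g \<in> row_words k"
  shows "(\<Sum>j<k. card {i \<in> J. col i = k + r \<and> g i = j}) = card {i \<in> J. col i = k + r}"
proof -
  have "(\<Sum>j<k. card {i \<in> {i \<in> J. col i = k + r}. g i = j}) = card {i \<in> J. col i = k + r}"
    by (rule sum_card_fibers) (use assms in \<open>auto simp: row_words_def\<close>)
  then show ?thesis by (simp add: conj_assoc)
qed

lemma col_sum_count:
  assumes "top_diag g" "j < k"
  shows "card {i \<in> J. col i = j} + (\<Sum>r<k. card {i \<in> J. col i = k + r \<and> g i = j}) =
    card {i \<in> J. g i = j}"
proof -
  have fib: "{i \<in> {i \<in> bottom. g i = j}. col i - k = r} = {i \<in> J. col i = k + r \<and> g i = j}" for r
    by (auto simp: bottom_def)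
  have "(\<Sum>r<k. card {i \<in> {i \<in> bottom. g i = j}. col i - k = r}) = card {i \<in> bottom. g i = j}"
  proof (rule sum_card_fibers)
    fix i assume "i \<in> {i \<in> bottom. g i = j}"
    then show "col i - k \<in> {..<k}" using col_less[of i] by (auto simp: bottom_def)
  qed auto
  then have "(\<Sum>r<k. card {i \<in> J. col i = k + r \<and> g i = j}) = card {i \<in> bottom. g i = j}"
    by (simp only: fib)
  moreover have "{i \<in> J. g i = j} = {i \<in> J. col i = j} \<union> {i \<in> bottom. g i = j}"
    using assms by (auto simp: top_diag_def bottom_def)
  moreover have "{i \<in> J. col i = j} \<inter> {i \<in> bottom. g i = j} = {}"
    using assms by (auto simp: bottom_def)
  ultimately show ?thesis by (simp add: card_Un_disjoint)
qed

text \<open>The bottom cells counted at the positions of an SE-chain form a \<open>similar\<close>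
  set whose size is the length of the chain.\<close>

lemma count_mat_good:
  assumes "good g"
  shows "count_mat g \<in> margin_mats"
proof -
  have g: "g \<in> row_words k" "top_diag g" "balanced g" using assms by (auto simp: good_def)
  have chain: "\<And>I. I \<subseteq> bottom \<Longrightarrow> similar g I \<Longrightarrow> card I \<le> CARD('n)" using assms by (auto simp: good_def)
  have "longest_SE_chain (count_mat g) \<le> CARD('n)"
  proof (rule longest_SE_chain_le)
    fix ps assume ps: "SE_chain (count_mat g) ps"
    define I where "I = {i \<in> bottom. (col i - k, g i) \<in> set ps}"
    have sub: "set ps \<subseteq> {..<k} \<times> {..<k}" using ps by (simp add: SE_chain_def count_mat_def)
    have "similar g I"
      unfolding similar_def
    proof (intro ballI)
      fix i j assume "i \<in> I" "j \<in> I"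
      then have ij: "(col i - k, g i) \<in> set ps" "(col j - k, g j) \<in> set ps" "k \<le> col i" "k \<le> col j"
        by (auto simp: I_def bottom_def)
      show "(col i \<le> col j \<and> g i \<le> g j) \<or> (col j \<le> col i \<and> g j \<le> g i)"
        using SE_chain_comparable[OF ps ij(1,2)] ij(3,4) by auto
    qed
    then have "card I \<le> CARD('n)" by (intro chain) (auto simp: I_def)
    moreover have "card I = (\<Sum>p\<in>set ps. count_mat g $$ p)"
    proof -
      have "card I = (\<Sum>p\<in>set ps. card {i \<in> I. (col i - k, g i) = p})"
        by (rule sum_card_fibers[symmetric]) (auto simp: I_def)
      also have "\<dots> = (\<Sum>p\<in>set ps. count_mat g $$ p)"
      proof (rule sum.cong[OF refl])
        fix p assume p: "p \<in> set ps"
        obtain r j where rj: "p = (r, j)" by (cases p)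
        have "r < k" "j < k" using p rj sub by auto
        moreover have "{i \<in> I. (col i - k, g i) = p} = {i \<in> J. col i = k + r \<and> g i = j}"
          using p by (auto simp: I_def bottom_def rj)
        ultimately show "card {i \<in> I. (col i - k, g i) = p} = count_mat g $$ p"
          by (simp add: rj count_mat_def)
      qed
      finally show ?thesis .
    qed
    ultimately show "SE_length (count_mat g) ps \<le> CARD('n)" by (simp add: SE_length_distinct[OF ps])
  qed
  moreover have "(\<Sum>j<k. count_mat g $$ (r, j)) = card {i \<in> J. col i = k + r}" if "r < k" for r
    using row_sum_count[OF g(1), of r] that by (simp add: count_mat_def)
  moreover have "card {i \<in> J. col i = j} + (\<Sum>r<k. count_mat g $$ (r, j)) = CARD('n)" if "j < k" for j
    using col_sum_count[OF g(2) that] g(3) that by (simp add: count_mat_def balanced_def)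
  ultimately show ?thesis by (simp add: margin_mats_def count_mat_def)
qed

text \<open>Each row of A tells how to distribute the letters over the cells of one lower color. A
  \<open>similar\<close> set of cells projects to comparable positions, so the chain bound on A
  passes to the word.\<close>

lemma margin_mats_count_mat:
  assumes A: "A \<in> margin_mats"
  shows "\<exists>g. good g \<and> count_mat g = A"
proof -
  have dim: "dim_row A = k" "dim_col A = k" and longest: "longest_SE_chain A \<le> CARD('n)"
    and rows: "\<And>r. r < k \<Longrightarrow> card {i \<in> J. col i = k + r} = (\<Sum>j<k. A $$ (r, j))"
    and cols: "\<And>j. j < k \<Longrightarrow> card {i \<in> J. col i = j} + (\<Sum>r<k. A $$ (r, j)) = CARD('n)"
    using A by (auto simp: margin_mats_def)
  define Q where "Q r \<gamma> \<longleftrightarrow> (\<forall>i\<in>{i \<in> J. col i = k + r}. \<gamma> i < k) \<and>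
      (\<forall>j<k. card {i \<in> {i \<in> J. col i = k + r}. \<gamma> i = j} = A $$ (r, j))" for r \<gamma>
  have "\<exists>\<gamma>. Q r \<gamma>" if "r < k" for r
    unfolding Q_def using rows[OF that] by (intro ex_function_with_fibers) auto
  then obtain \<gamma> where "\<And>r. r < k \<Longrightarrow> Q r (\<gamma> r)"
    by metis
  note G = this[unfolded Q_def]
  have \<gamma>: "\<gamma> r i < k" if "r < k" "i \<in> J" "col i = k + r" for r i
    using G[OF that(1)] that(2,3) by blast
  have \<gamma>_card: "card {i \<in> {i \<in> J. col i = k + r}. \<gamma> r i = j} = A $$ (r, j)" if "r < k" "j < k" for r j
    using G[OF that(1)] that(2) by blast
  define g where "g = (\<lambda>i\<in>J. if col i < k then col i else \<gamma> (col i - k) i)"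
  have "g i < k" if "i \<in> J" for i
    using \<gamma>[of "col i - k" i] col_less[OF that] that by (auto simp: g_def)
  then have rw: "g \<in> row_words k" by (auto simp: row_words_def g_def)
  have top: "top_diag g" by (auto simp: top_diag_def g_def)
  have cnt: "card {i \<in> J. col i = k + r \<and> g i = j} = A $$ (r, j)" if "r < k" "j < k" for r j
  proof -
    have "{i \<in> J. col i = k + r \<and> g i = j} = {i \<in> {i \<in> J. col i = k + r}. \<gamma> r i = j}"
      by (auto simp: g_def)
    then show ?thesis using \<gamma>_card[OF that] by simp
  qed
  have cm: "count_mat g = A"
    by (rule eq_matI) (auto simp: count_mat_def dim cnt)
  have "balanced g"
    unfolding balanced_def
  proof (intro allI impI)
    fix j assume j: "j < k"
    show "card {i \<in> J. g i = j} = CARD('n)"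
      using col_sum_count[OF top j] cols[OF j] j by (simp add: cnt)
  qed
  moreover have "card I \<le> CARD('n)" if I: "I \<subseteq> bottom" "similar g I" for I
  proof -
    define P where "P = (\<lambda>i. (col i - k, g i)) ` I"
    have Ik: "k \<le> col i" "col i < 2 * k" "g i < k" "i \<in> J" if "i \<in> I" for i
    proof -
      show c: "i \<in> J" using I that bottom_subset by blast
      show "k \<le> col i" using I that by (auto simp: bottom_def)
      show "col i < 2 * k" using col_less c by blast
      show "g i < k" using rw c by (auto simp: row_words_def)
    qed
    have finI: "finite I" using I finite_subset by blast
    have P: "P \<subseteq> {..<dim_row A} \<times> {..<dim_col A}" using Ik by (fastforce simp: P_def dim)
    have "card I = (\<Sum>p\<in>P. card {i \<in> I. (col i - k, g i) = p})"
      by (rule sum_card_fibers[symmetric]) (auto simp: P_def finI)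
    also have "\<dots> \<le> (\<Sum>p\<in>P. A $$ p)"
    proof (rule sum_mono)
      fix p assume p: "p \<in> P"
      obtain r j where rj: "p = (r, j)" by (cases p)
      have "r < k" "j < k" using p rj P dim by auto
      then have "A $$ p = card {i \<in> J. col i = k + r \<and> g i = j}" by (simp add: rj cnt)
      moreover have "card {i \<in> I. (col i - k, g i) = p} \<le> card {i \<in> J. col i = k + r \<and> g i = j}"
        by (rule card_mono) (use Ik in \<open>auto simp: rj\<close>)
      ultimately show "card {i \<in> I. (col i - k, g i) = p} \<le> A $$ p" by simp
    qed
    also have "\<dots> \<le> longest_SE_chain A"
    proof (rule comparable_sum_le_longest[OF P])
      fix p q assume "p \<in> P" "q \<in> P"
      then obtain i j where "i \<in> I" "j \<in> I" "p = (col i - k, g i)" "q = (col j - k, g j)"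
        by (auto simp: P_def)
      then show "(fst p \<le> fst q \<and> snd p \<le> snd q) \<or> (fst q \<le> fst p \<and> snd q \<le> snd p)"
        using I(2) unfolding similar_def by (auto intro: diff_le_mono)
    qed
    finally show ?thesis using longest by simp
  qed
  ultimately have "good g" using rw top by (simp add: good_def)
  with cm show ?thesis by blast
qed

lemma card_basis_eq: "card basis = card margin_mats"
proof -
  have "count_mat ` {g. good g} = margin_mats"
    using count_mat_good margin_mats_count_mat by (auto simp: image_iff)
  then show ?thesis by (simp add: card_basis)
qed

end

section \<open>The integral as a trace\<close>

context coloring
begin

lemma color_perms_eq_young: "color_perms col J = young"
proof -
  have "col (p i) = col i" if "p permutes J" "i \<notin> J" for p i
    using permutes_not_in[OF that] by simp
  then show ?thesis
    by (auto simp: color_perms_def young_def fun_eq_iff)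
qed

text \<open>The vector \<open>sym_eps g\<close> is covariant, so the kernel acts on it as c.
  Symmetrising one factor of the kernel applies the signed sum over \<open>young\<close> in s, which
  multiplies \<open>sym_eps g\<close> by the order of \<open>young\<close>.\<close>

lemma sym_eps_repr:
  fixes c :: complex
  assumes c: "\<And>\<tau> s. det_covariant k UNIV \<tau> \<Longrightarrow> s \<in> col_words k \<Longrightarrow>
      (\<Sum>r\<in>col_words k. of_int (kern k s r) * \<tau> r) = c * \<tau> (s :: nat \<times> 'n \<Rightarrow> 'n)"
    and g: "g \<in> row_words k" and s: "s \<in> col_words k"
  shows "(\<Sum>h\<in>row_words k. (\<Sum>r\<in>col_words k. of_int (sym_eps g r) * of_int (eps k h r)) * of_int (sym_eps h s)) =
    c * of_nat (card young) * of_int (sym_eps g s)"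
proof -
  let ?\<tau> = "\<lambda>r. complex_of_int (sym_eps g r)"
  have cov: "det_covariant k UNIV ?\<tau>"
    unfolding det_covariant_def
  proof (intro ballI)
    fix X :: "complex^'n^'n" and s :: "nat \<times> 'n \<Rightarrow> 'n"
    have "(\<Sum>r\<in>col_words k. (\<Prod>i\<in>J. X $ s i $ r i) * ?\<tau> r) =
        (\<Sum>r\<in>col_words k. \<Sum>p\<in>young. (\<Prod>i\<in>J. X $ s i $ r i) * of_int (eps k (g \<circ> p) r))"
      by (simp add: sym_eps_def sum_distrib_left)
    also have "\<dots> = (\<Sum>p\<in>young. \<Sum>r\<in>col_words k. (\<Prod>i\<in>J. X $ s i $ r i) * of_int (eps k (g \<circ> p) r))"
      by (rule sum.swap)
    also have "\<dots> = (\<Sum>p\<in>young. det X ^ k * of_int (eps k (g \<circ> p) s))"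
      by (intro sum.cong refl sum_words_eps comp_row_words young_permutes g)
    finally show "(\<Sum>r\<in>col_words k. (\<Prod>i\<in>J. X $ s i $ r i) * ?\<tau> r) = det X ^ k * ?\<tau> s"
      by (simp add: sym_eps_def sum_distrib_left)
  qed
  define b where "b h = (\<Sum>r\<in>col_words k. ?\<tau> r * of_int (eps k h r))" for h
  have main: "(\<Sum>h\<in>row_words k. b h * of_int (eps k h t)) = c * ?\<tau> t" if t: "t \<in> col_words k" for t
  proof -
    have "c * ?\<tau> t = (\<Sum>r\<in>col_words k. of_int (kern k t r) * ?\<tau> r)"
      by (rule c[OF cov t, symmetric])
    also have "\<dots> = (\<Sum>r\<in>col_words k. \<Sum>h\<in>row_words k. ?\<tau> r * of_int (eps k h r) * of_int (eps k h t))"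
      by (simp only: kern_def of_int_sum of_int_mult sum_distrib_left sum_distrib_right mult_ac)
    also have "\<dots> = (\<Sum>h\<in>row_words k. b h * of_int (eps k h t))"
      by (subst sum.swap) (simp only: b_def sum_distrib_right)
    finally show ?thesis by simp
  qed
  have "(\<Sum>h\<in>row_words k. b h * of_int (sym_eps h s)) =
      (\<Sum>h\<in>row_words k. \<Sum>p\<in>young. of_int (sign p) * (b h * of_int (eps k h (s \<circ> p))))"
    by (intro sum.cong refl) (simp add: sum_sign_eps_young[symmetric] sum_distrib_left mult_ac)
  also have "\<dots> = (\<Sum>p\<in>young. of_int (sign p) * (\<Sum>h\<in>row_words k. b h * of_int (eps k h (s \<circ> p))))"
    by (subst sum.swap) (simp only: sum_distrib_left)
  also have "\<dots> = (\<Sum>p\<in>young. of_int (sign p) * (c * ?\<tau> (s \<circ> p)))"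
    by (intro sum.cong refl arg_cong2[where f = "(*)"] main comp_col_words[OF s] young_permutes)
  also have "\<dots> = (\<Sum>p\<in>young. c * ?\<tau> s)"
  proof (rule sum.cong[OF refl])
    fix p assume p: "p \<in> young"
    have "of_int (sign p) * (c * ?\<tau> (s \<circ> p)) = c * of_int (sign p * sym_eps g (s \<circ> p))"
      by simp
    also have "sign p * sym_eps g (s \<circ> p) = sym_eps g s"
      by (simp add: sym_eps_comp_col[OF p])
    finally show "of_int (sign p) * (c * ?\<tau> (s \<circ> p)) = c * ?\<tau> s" .
  qed
  finally show ?thesis by (simp add: b_def mult_ac)
qed

text \<open>The product of coefficients is a signed sum of moments divided by the order of
  \<open>young\<close>. The moments contribute 1 / c and the trace is c times that order times the
  dimension, so both constants cancel.\<close>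

lemma haar_integral_color:
  fixes M :: "(complex^'n^'n) measure"
  assumes M: "haar_prob_measure M"
  defines "f \<equiv> \<lambda>U :: complex^'n^'n. cnj (det U) ^ k * (\<Prod>x<2 * k. coeff (det_poly U) (card {i \<in> J. col i = x}))"
  shows "integrable M f" and "(LINT U|M. f U) = of_nat (card margin_mats)"
proof -
  obtain c :: complex where c: "c \<noteq> 0"
    "\<And>(M :: (complex^'n^'n) measure) s t. haar_prob_measure M \<Longrightarrow> s \<in> col_words k \<Longrightarrow>
        haar_moment k M s t = of_int (kern k s t) / c"
    "\<And>\<tau> s. det_covariant k UNIV \<tau> \<Longrightarrow> s \<in> col_words k \<Longrightarrow>
        (\<Sum>r\<in>col_words k. of_int (kern k s r) * \<tau> r) = c * \<tau> (s :: nat \<times> 'n \<Rightarrow> 'n)"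
    by (rule haar_moment_eq_kern[of k]) (rule that, assumption+)
  let ?Y = "of_nat (card young) :: complex"
  have "card young \<noteq> 0" using card_young_pos by arith
  then have Y: "?Y \<noteq> 0" by (simp only: of_nat_eq_0_iff not_False_eq_True)
  let ?m = "\<lambda>s p U :: complex^'n^'n. cnj (det U) ^ k * (\<Prod>i\<in>J. U $ s i $ (s \<circ> p) i)"
  have f_eq: "f U = (\<Sum>s\<in>col_words k. \<Sum>p\<in>young. of_int (sign p) * ?m s p U) / ?Y" for U
  proof -
    have "{i \<in> J. col i \<in> {..<2 * k}} = J" using col_less by auto
    then have "word_trace U J young = ?Y * (\<Prod>x<2 * k. coeff (det_poly U) (card {i \<in> J. col i = x}))"
      using word_trace_color_perms[of J "{..<2 * k}" U col] by (simp add: color_perms_eq_young)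
    then have "?Y * f U = cnj (det U) ^ k * word_trace U J young"
      by (simp add: f_def)
    also have "\<dots> = (\<Sum>s\<in>col_words k. \<Sum>p\<in>young. of_int (sign p) * ?m s p U)"
      by (simp add: word_trace_def col_words_def sum_distrib_left mult_ac)
    finally show ?thesis using Y by (simp add: field_simps)
  qed
  have int: "integrable M (\<lambda>U. of_int (sign p) * ?m s p U)" for s p
    by (intro integrable_mult_right integrable_moment[OF M])
  show "integrable M f"
    unfolding f_eq by (intro integrable_divide_zero Bochner_Integration.integrable_sum int)
  have span: "\<exists>L. \<forall>s\<in>col_words k. complex_of_int (sym_eps h s) = (\<Sum>g\<in>basis. L g * of_int (sym_eps g s))"
    if "h \<in> row_words k" for h
    using in_span_sym_eps[OF that] unfolding in_span_def by blast
  have tri: "\<exists>s\<in>col_words k. complex_of_int (sym_eps g s) \<noteq> 0 \<and>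
      (\<forall>g'\<in>basis. complex_of_int (sym_eps g' s) \<noteq> 0 \<longrightarrow> g' = g \<or> bot g < bot g')" if "g \<in> basis" for g
    using basis_triangular[OF that] by (simp only: of_int_eq_0_iff)
  have trace: "(\<Sum>h\<in>row_words k. \<Sum>s\<in>col_words k. complex_of_int (eps k h s) * of_int (sym_eps h s)) =
      c * ?Y * of_nat (card basis)"
    by (rule trace_eq_card[where \<mu> = bot, OF finite_col_words finite_row_words finite_basis _ span tri])
      (use sym_eps_repr[OF c(3)] basis_good good_row_words in blast)+
  have "(LINT U|M. f U) = (\<Sum>s\<in>col_words k. \<Sum>p\<in>young. of_int (sign p) * haar_moment k M s (s \<circ> p)) / ?Y"
    unfolding f_eq haar_moment_def
    by (simp add: Bochner_Integration.integral_sum int Bochner_Integration.integrable_sum del: o_apply)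
  also have "(\<Sum>s\<in>col_words k. \<Sum>p\<in>young. of_int (sign p) * haar_moment k M s (s \<circ> p)) =
      (\<Sum>s\<in>col_words k. \<Sum>p\<in>young. \<Sum>h\<in>row_words k. of_int (eps k h s) * of_int (sign p * eps k h (s \<circ> p)) / c)"
    by (intro sum.cong refl) (simp add: c(2)[OF M] kern_def sum_distrib_left sum_divide_distrib mult_ac)
  also have "\<dots> = (\<Sum>s\<in>col_words k. \<Sum>h\<in>row_words k. \<Sum>p\<in>young. of_int (eps k h s) * of_int (sign p * eps k h (s \<circ> p)) / c)"
    by (rule sum.cong[OF refl sum.swap])
  also have "\<dots> = (\<Sum>s\<in>col_words k. \<Sum>h\<in>row_words k. of_int (eps k h s) * of_int (sym_eps h s) / c)"
    by (simp only: sum_sign_eps_young[symmetric] of_int_sum sum_distrib_left sum_divide_distrib)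
  also have "\<dots> = (\<Sum>h\<in>row_words k. \<Sum>s\<in>col_words k. of_int (eps k h s) * of_int (sym_eps h s)) / c"
    by (subst sum.swap) (simp only: sum_divide_distrib)
  also have "\<dots> = ?Y * of_nat (card margin_mats)"
    unfolding trace using c(1) by (simp add: card_basis_eq)
  finally show "(LINT U|M. f U) = of_nat (card margin_mats)"
    using Y by simp
qed

lemma finite_margin_mats: "finite margin_mats"
proof -
  have "finite {g. good g}"
    by (rule finite_subset[OF _ finite_row_words[of k]]) (auto dest: good_row_words)
  moreover have "margin_mats \<subseteq> count_mat ` {g. good g}"
    using margin_mats_count_mat by blast
  ultimately show ?thesis using finite_surj by blast
qed

end

section \<open>Expansion into compositions and the final count\<close>

lemma coeff_power_eq_sum:
  fixes p :: "complex poly"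
  assumes "degree p \<le> D"
  shows "coeff (p ^ k) m = (\<Sum>a\<in>{a \<in> {..<k} \<rightarrow>\<^sub>E {..D}. (\<Sum>x<k. a x) = m}. \<Prod>x<k. coeff p (a x))"
proof -
  have "p = (\<Sum>d\<le>D. monom (coeff p d) d)"
    by (rule poly_as_sum_of_monoms'[OF assms, symmetric])
  then have "p ^ k = (\<Prod>x<k. \<Sum>d\<le>D. monom (coeff p d) d)"
    by simp
  also have "\<dots> = (\<Sum>a\<in>{..<k} \<rightarrow>\<^sub>E {..D}. \<Prod>x<k. monom (coeff p (a x)) (a x))"
    by (rule prod_sum_PiE) auto
  also have "\<dots> = (\<Sum>a\<in>{..<k} \<rightarrow>\<^sub>E {..D}. monom (\<Prod>x<k. coeff p (a x)) (\<Sum>x<k. a x))"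
  proof (rule sum.cong[OF refl])
    fix a :: "nat \<Rightarrow> nat"
    show "(\<Prod>x<k. monom (coeff p (a x)) (a x)) = monom (\<Prod>x<k. coeff p (a x)) (\<Sum>x<k. a x)"
      by (induction k) (simp_all add: mult_monom mult.commute add.commute)
  qed
  finally have "coeff (p ^ k) m = (\<Sum>a\<in>{..<k} \<rightarrow>\<^sub>E {..D}. if (\<Sum>x<k. a x) = m then \<Prod>x<k. coeff p (a x) else 0)"
    by (simp add: coeff_sum)
  also have "\<dots> = (\<Sum>a\<in>{a \<in> {..<k} \<rightarrow>\<^sub>E {..D}. (\<Sum>x<k. a x) = m}. \<Prod>x<k. coeff p (a x))"
    by (rule sum.inter_filter[symmetric]) (simp add: finite_PiE)
  finally show ?thesis .
qed

lemma degree_det_poly: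
  fixes U :: "complex^'n^'n"
  shows "degree (det_poly U) \<le> CARD('n)"
proof (rule degree_le, intro allI impI)
  fix m assume m: "CARD('n) < m"
  have "card S \<noteq> m" for S :: "'n set"
    using m card_mono[of UNIV S] by auto
  then show "coeff (det_poly U) m = 0" by (simp add: coeff_det_poly)
qed

lemma degree_det_poly_power:
  fixes U :: "complex^'n^'n"
  shows "degree (det_poly U ^ k) \<le> CARD('n) * k"
  by (rule order.trans[OF degree_power_le mult_right_mono[OF degree_det_poly]]) simp

text \<open>The functional equation \<open>x^N conj (det (I + U / x)) = conj (det U) det (I + x U)\<close> for real \<open>x\<close>
  turns the conjugate of a coefficient into a complementary coefficient.\<close>

lemma cnj_coeff_det_poly_power:
  fixes U :: "complex^'n^'n"
  assumes U: "U \<in> unitary_group" and n: "n \<le> CARD('n) * k"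
  shows "cnj (coeff (det_poly U ^ k) n) = cnj (det U) ^ k * coeff (det_poly U ^ k) (CARD('n) * k - n)"
proof -
  let ?P = "det_poly U ^ k" and ?K = "CARD('n) * k"
  \<comment> \<open>The conjugate reciprocal polynomial. It is compared with
    \<open>det_poly U ^ k\<close> at all positive integers, which is enough to identify
    polynomials.\<close>
  define Q where "Q = (\<Sum>m\<le>?K. monom (cnj (coeff ?P m)) (?K - m))"
  have fe: "of_real x ^ CARD('n) * cnj (poly (det_poly U) (1 / of_real x)) = cnj (det U) * poly (det_poly U) (of_real x)"
    if x: "x \<noteq> 0" for x :: real
  proof -
    define A where "A = mat 1 + map_matrix (\<lambda>z. 1 / complex_of_real x * z) U"
    let ?B = "mat 1 + map_matrix (\<lambda>z. complex_of_real x * z) U"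
    have B: "conj_transpose U ** ?B = conj_transpose U + map_matrix (\<lambda>z. complex_of_real x * z) (conj_transpose U ** U)"
      by (simp add: vec_eq_iff matrix_matrix_mult_def map_matrix_def mat_def sum_distrib_left
          distrib_left sum.distrib mult_ac if_distrib[of "(*) _"] cong: if_cong)
    have "(\<Sum>l\<in>UNIV. (if i = l then complex_of_real x else 0) * conj_transpose A $ l $ j) =
        complex_of_real x * conj_transpose A $ i $ j" for i j
    proof -
      have "(\<Sum>l\<in>UNIV. (if i = l then complex_of_real x else 0) * conj_transpose A $ l $ j) =
          (\<Sum>l\<in>UNIV. if l = i then complex_of_real x * conj_transpose A $ i $ j else 0)"
        by (rule sum.cong) auto
      then show ?thesis by simp
    qed
    then have entry: "(diag_matrix (\<lambda>_. complex_of_real x) ** conj_transpose A) $ i $ j =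
        complex_of_real x * conj_transpose A $ i $ j" for i j
      by (simp add: matrix_matrix_mult_def diag_matrix_def)
    have A_entry: "complex_of_real x * conj_transpose A $ i $ j =
        conj_transpose U $ i $ j + complex_of_real x * (mat 1 :: complex^'n^'n) $ i $ j" for i j
      using x by (simp add: A_def conj_transpose_def map_matrix_def transpose_def mat_def field_simps)
    have "diag_matrix (\<lambda>_. complex_of_real x) ** conj_transpose A =
        conj_transpose U + map_matrix (\<lambda>z. complex_of_real x * z) (mat 1)"
      by (simp add: vec_eq_iff entry A_entry map_matrix_def)
    also have "\<dots> = conj_transpose U ** ?B"
      using U B by (simp add: unitary_group_def)
    finally have "det (diag_matrix (\<lambda>_ :: 'n. complex_of_real x)) * det (conj_transpose A) = det (conj_transpose U) * det ?B"
      by (simp only: det_mul[symmetric])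
    then show ?thesis
      by (simp add: det_diag_matrix det_conj_transpose poly_det_poly A_def)
  qed
  have "poly Q (of_real x) = poly (smult (cnj (det U) ^ k) ?P) (of_real x)" if x: "x \<noteq> 0" for x :: real
  proof -
    have "poly Q (of_real x) = (\<Sum>m\<le>?K. cnj (coeff ?P m) * of_real x ^ (?K - m))"
      by (simp add: Q_def poly_sum poly_monom)
    also have "\<dots> = (\<Sum>m\<le>?K. of_real x ^ ?K * cnj (coeff ?P m * (1 / of_real x) ^ m))"
      using x by (intro sum.cong refl) (simp add: power_diff power_divide)
    also have "\<dots> = of_real x ^ ?K * cnj (\<Sum>m\<le>?K. coeff ?P m * (1 / of_real x) ^ m)"
      by (simp only: sum_distrib_left cnj_sum)
    also have "(\<Sum>m\<le>?K. coeff ?P m * (1 / of_real x) ^ m) = poly ?P (1 / of_real x)"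
      unfolding poly_altdef
      by (rule sum.mono_neutral_right) (use degree_det_poly_power[of U k] le_degree[of ?P] in auto)
    also have "of_real x ^ ?K * cnj (poly ?P (1 / of_real x)) =
        (of_real x ^ CARD('n) * cnj (poly (det_poly U) (1 / of_real x))) ^ k"
      by (simp add: poly_power power_mult power_mult_distrib)
    also have "\<dots> = poly (smult (cnj (det U) ^ k) ?P) (of_real x)"
      unfolding fe[OF x] by (simp add: poly_power power_mult_distrib)
    finally show ?thesis .
  qed
  from this[of "real _"] have sub: "complex_of_nat ` {0<..} \<subseteq> {x. poly (Q - smult (cnj (det U) ^ k) ?P) x = 0}"
    by auto
  have "infinite (complex_of_nat ` {0<..})"
    by (subst finite_image_iff) (auto simp: inj_on_def infinite_Ioi)
  then have "Q - smult (cnj (det U) ^ k) ?P = 0"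
    using poly_roots_finite finite_subset[OF sub] by blast
  then have "coeff Q (?K - n) = coeff (smult (cnj (det U) ^ k) ?P) (?K - n)" by simp
  moreover have "coeff Q (?K - n) = cnj (coeff ?P n)"
  proof -
    have "coeff Q (?K - n) = (\<Sum>m\<le>?K. if m = n then cnj (coeff ?P n) else 0)"
      unfolding Q_def coeff_sum using n by (intro sum.cong refl) auto
    then show ?thesis using n by simp
  qed
  ultimately show ?thesis by simp
qed

lemma ex_coloring:
  fixes a b :: "nat \<Rightarrow> nat"
  assumes "(\<Sum>x<k. a x) + (\<Sum>x<k. b x) = k * CARD('n::finite)"
  obtains col :: "nat \<times> 'n::finite \<Rightarrow> nat" where "coloring k col"
    "\<And>x. x < k \<Longrightarrow> card {i \<in> cells k. col i = x} = a x"
    "\<And>x. x < k \<Longrightarrow> card {i \<in> cells k. col i = k + x} = b x"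
proof -
  define f where "f x = (if x < k then a x else b (x - k))" for x
  have "(\<Sum>x<2 * k. f x) = (\<Sum>x<k. f x) + (\<Sum>x<k. f (x + k))"
    using sum.nat_group[of f k 2] by (simp add: lessThan_atLeast0 numeral_2_eq_2 mult.commute sum.shift_bounds_nat_ivl[symmetric] sum.atLeastLessThan_concat)
  then have "card (cells k :: (nat \<times> 'n) set) = (\<Sum>x<2 * k. f x)"
    using assms by (simp add: card_cells f_def)
  from ex_function_with_fibers[OF finite_cells this]
  obtain col :: "nat \<times> 'n \<Rightarrow> nat" where col: "\<And>i. i \<in> cells k \<Longrightarrow> col i < 2 * k"
    "\<And>x. x < 2 * k \<Longrightarrow> card {i \<in> cells k. col i = x} = f x"
    by auto
  show ?thesis
    by (rule that[of col]) (use col in \<open>auto simp: coloring_def f_def\<close>)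
qed

theorem corollary4p2:
  fixes n k :: nat and M :: "(complex^'N^'N) measure"
  assumes "n \<ge> 1" and "k \<ge> 1"
    and "haar_prob_measure M"
  shows "(LINT U|M. (cmod (coeff (det_poly U ^ k) n))\<^sup>2) =
    real (card {A \<in> carrier_mat k k. sum_mat A = n \<and> longest_SE_chain A \<le> CARD('N)})"
proof -
  note M = assms(3)
  let ?N = "CARD('N)"
  define mats where "mats = {A \<in> carrier_mat k k. sum_mat A = n \<and> longest_SE_chain A \<le> ?N}"
  \<comment> \<open>A whole column is an SE-chain.\<close>
  have col_sum_le: "(\<Sum>r<k. A $$ (r, j)) \<le> ?N" if A: "A \<in> mats" "j < k" for A j
  proof -
    have "(\<Sum>p\<in>{..<k} \<times> {j}. A $$ p) \<le> longest_SE_chain A"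
      using A by (intro comparable_sum_le_longest) (auto simp: mats_def)
    moreover have "(\<Sum>p\<in>{..<k} \<times> {j}. A $$ p) = (\<Sum>r<k. A $$ (r, j))"
    proof -
      have "{..<k} \<times> {j} = (\<lambda>r. (r, j)) ` {..<k}" by auto
      then show ?thesis by (simp add: sum.reindex inj_on_def)
    qed
    ultimately show ?thesis using A by (simp add: mats_def)
  qed
  have total: "(\<Sum>r<k. \<Sum>j<k. A $$ (r, j)) = n" if "A \<in> mats" for A
    using that by (auto simp: mats_def sum_mat_def lessThan_atLeast0 sum.cartesian_product)
  have total': "(\<Sum>j<k. \<Sum>r<k. A $$ (r, j)) = n" if "A \<in> mats" for A
    using total[OF that] by (subst sum.swap)
  show ?thesis
  proof (cases "n \<le> ?N * k")
    \<comment> \<open>Here n exceeds the degree, so the integrand vanishes; the column bounds leave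
      no matrix with sum n either.\<close>
    case False
    have "coeff (det_poly U ^ k) n = 0" for U :: "complex^'N^'N"
      using degree_det_poly_power[of U k] False by (intro coeff_eq_0) simp
    moreover have "mats = {}"
    proof -
      have False if A: "A \<in> mats" for A
      proof -
        have "n \<le> (\<Sum>j<k. ?N)"
          unfolding total'[OF A, symmetric] using col_sum_le[OF A] by (intro sum_mono) simp
        then show False using \<open>\<not> n \<le> ?N * k\<close> by (simp add: mult.commute)
      qed
      then show ?thesis by auto
    qed
    ultimately show ?thesis unfolding mats_def[symmetric] by simp
  next
    case n: True
    \<comment> \<open>Large enough for the degree of \<open>det_poly\<close> and for the row sums,
      which are at most n; thus the margins of every matrix fall into \<open>Z\<close>.\<close>
    define D where "D = ?N + n"
    define comps where "comps m = {a \<in> {..<k} \<rightarrow>\<^sub>E {..D}. (\<Sum>x<k. a x) = m}" for m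
    have finc: "finite (comps m)" for m
      by (rule finite_subset[of _ "{..<k} \<rightarrow>\<^sub>E {..D}"]) (auto simp: comps_def finite_PiE)
    define Z where "Z = comps (?N * k - n) \<times> comps n"
    have finZ: "finite Z" by (simp add: Z_def finc)
    define F where "F z U = cnj (det U) ^ k * ((\<Prod>x<k. coeff (det_poly U) (fst z x)) * (\<Prod>x<k. coeff (det_poly U) (snd z x)))"
      for z :: "(nat \<Rightarrow> nat) \<times> (nat \<Rightarrow> nat)" and U :: "complex^'N^'N"
    \<comment> \<open>The subtraction is exact by \<open>col_sum_le\<close>, so the first component
      determines the column sums.\<close>
    define margins where "margins A = (\<lambda>j\<in>{..<k}. ?N - (\<Sum>r<k. A $$ (r, j)), \<lambda>r\<in>{..<k}. \<Sum>j<k. A $$ (r, j))"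
      for A :: "nat mat"
    \<comment> \<open>A pair of compositions prescribes the color sizes of a coloring, and the
      matrices with these margins are its \<open>margin_mats\<close>.\<close>
    have fiber: "integrable M (F z) \<and> (LINT U|M. F z U) = of_nat (card {A \<in> mats. margins A = z}) \<and>
        finite {A \<in> mats. margins A = z}" if z: "z \<in> Z" for z
    proof -
      obtain a b where ab: "z = (a, b)" by (cases z)
      have a: "a \<in> {..<k} \<rightarrow>\<^sub>E {..D}" "(\<Sum>x<k. a x) = ?N * k - n" and b: "b \<in> {..<k} \<rightarrow>\<^sub>E {..D}" "(\<Sum>x<k. b x) = n"
        using z by (auto simp: Z_def comps_def ab)
      have "(\<Sum>x<k. a x) + (\<Sum>x<k. b x) = k * CARD('N)"
        using a(2) b(2) n by (simp add: mult.commute)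
      then obtain col :: "nat \<times> 'N \<Rightarrow> nat" where col: "coloring k col"
        "\<And>x. x < k \<Longrightarrow> card {i \<in> cells k. col i = x} = a x"
        "\<And>x. x < k \<Longrightarrow> card {i \<in> cells k. col i = k + x} = b x"
        by (rule ex_coloring) (rule that, assumption+)
      interpret coloring k col by (rule col(1))
      have "(\<Prod>x<2 * k. coeff (det_poly U) (card {i \<in> cells k. col i = x})) =
          (\<Prod>x<k. coeff (det_poly U) (a x)) * (\<Prod>x<k. coeff (det_poly U) (b x))" for U :: "complex^'N^'N"
      proof -
        let ?h = "\<lambda>x. coeff (det_poly U) (card {i \<in> cells k. col i = x})"
        have "{..<2 * k} = {..<k} \<union> (\<lambda>x. k + x) ` {..<k}"
        proof -
          have "x \<in> (\<lambda>x. k + x) ` {..<k}" if "x < 2 * k" "\<not> x < k" for x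
            using that by (intro image_eqI[of _ _ "x - k"]) auto
          then show ?thesis by auto
        qed
        then have "prod ?h {..<2 * k} = prod ?h {..<k} * prod ?h ((\<lambda>x. k + x) ` {..<k})"
          by (simp only:) (rule prod.union_disjoint, auto)
        also have "prod ?h ((\<lambda>x. k + x) ` {..<k}) = (\<Prod>x<k. ?h (k + x))"
          by (subst prod.reindex) (auto simp: inj_on_def)
        finally show ?thesis by (simp add: col)
      qed
      then have F: "F z = (\<lambda>U. cnj (det U) ^ k * (\<Prod>x<2 * k. coeff (det_poly U) (card {i \<in> cells k. col i = x})))"
        by (simp add: F_def ab fun_eq_iff)
      have "{A \<in> mats. margins A = z} = margin_mats"
      proof (intro equalityI subsetI)
        fix A assume "A \<in> {A \<in> mats. margins A = z}"
        then have A: "A \<in> mats" and m: "margins A = (a, b)" by (auto simp: ab)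
        have "(\<Sum>j<k. A $$ (r, j)) = b r" if "r < k" for r
        proof -
          have "snd (margins A) r = b r" using m by simp
          then show ?thesis using that by (simp add: margins_def)
        qed
        moreover have "a j + (\<Sum>r<k. A $$ (r, j)) = ?N" if j: "j < k" for j
        proof -
          have "fst (margins A) j = a j" using m by simp
          then have "a j = ?N - (\<Sum>r<k. A $$ (r, j))" using j by (simp add: margins_def)
          then show ?thesis using col_sum_le[OF A j] by simp
        qed
        ultimately show "A \<in> margin_mats"
          using A by (simp add: margin_mats_def mats_def col)
      next
        fix A assume A: "A \<in> margin_mats"
        then have rows: "(\<Sum>j<k. A $$ (r, j)) = b r" if "r < k" for r
          using that by (simp add: margin_mats_def col)
        have cols: "a j = ?N - (\<Sum>r<k. A $$ (r, j))" if "j < k" for j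
        proof -
          have "a j + (\<Sum>r<k. A $$ (r, j)) = ?N"
            using A that by (simp add: margin_mats_def col)
          then show ?thesis by simp
        qed
        have "(\<Sum>r<k. \<Sum>j<k. A $$ (r, j)) = n"
          using b(2) by (simp add: rows)
        then have "A \<in> mats"
          using A by (auto simp: margin_mats_def mats_def sum_mat_def lessThan_atLeast0 sum.cartesian_product)
        moreover have "margins A = (a, b)"
          using a(1) b(1) by (auto simp: margins_def fun_eq_iff restrict_def rows cols[symmetric] PiE_iff extensional_def)
        ultimately show "A \<in> {A \<in> mats. margins A = z}" by (simp add: ab)
      qed
      then show ?thesis
        using haar_integral_color[OF M] finite_margin_mats by (simp add: F)
    qed
    have margins_Z: "margins A \<in> Z" if A: "A \<in> mats" for A
    proof -
      have "(\<Sum>j<k. ?N - (\<Sum>r<k. A $$ (r, j))) = (\<Sum>j<k. ?N) - (\<Sum>j<k. \<Sum>r<k. A $$ (r, j))"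
        using col_sum_le[OF A] by (intro sum_subtractf_nat) simp
      also have "\<dots> = ?N * k - n" by (simp add: total'[OF A] mult.commute)
      finally have "(\<Sum>j<k. ?N - (\<Sum>r<k. A $$ (r, j))) = ?N * k - n" .
      moreover have "(\<Sum>j<k. A $$ (r, j)) \<le> D" if "r < k" for r
      proof -
        have "(\<Sum>j<k. A $$ (r, j)) \<le> (\<Sum>r<k. \<Sum>j<k. A $$ (r, j))"
          using that by (intro member_le_sum) auto
        then show ?thesis by (simp add: total[OF A] D_def)
      qed
      ultimately show ?thesis
        by (auto simp: Z_def comps_def margins_def total[OF A] D_def)
    qed
    have finm: "finite mats"
    proof -
      have "mats = (\<Union>z\<in>Z. {A \<in> mats. margins A = z})" using margins_Z by blast
      moreover have "finite (\<Union>z\<in>Z. {A \<in> mats. margins A = z})" using finZ fiber by blast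
      ultimately show ?thesis by metis
    qed
    have expand: "complex_of_real ((cmod (coeff (det_poly U ^ k) n))\<^sup>2) = (\<Sum>z\<in>Z. F z U)"
      if "U \<in> unitary_group" for U :: "complex^'N^'N"
    proof -
      have deg: "degree (det_poly U) \<le> D" using degree_det_poly[of U] by (simp add: D_def)
      have "complex_of_real ((cmod (coeff (det_poly U ^ k) n))\<^sup>2) =
          cnj (coeff (det_poly U ^ k) n) * coeff (det_poly U ^ k) n"
        by (simp only: complex_norm_square mult.commute)
      also have "\<dots> = cnj (det U) ^ k * (coeff (det_poly U ^ k) (?N * k - n) * coeff (det_poly U ^ k) n)"
        by (simp add: cnj_coeff_det_poly_power[OF that n])
      also have "\<dots> = (\<Sum>z\<in>Z. F z U)"
        unfolding coeff_power_eq_sum[OF deg] comps_def[symmetric] sum_product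
        by (simp add: Z_def F_def sum_distrib_left sum.cartesian_product case_prod_unfold)
      finally show ?thesis .
    qed
    have "complex_of_real (LINT U|M. (cmod (coeff (det_poly U ^ k) n))\<^sup>2) =
        (LINT U|M. complex_of_real ((cmod (coeff (det_poly U ^ k) n))\<^sup>2))"
      by (rule integral_complex_of_real[symmetric])
    also have "\<dots> = (LINT U|M. (\<Sum>z\<in>Z. F z U))"
      using M by (intro Bochner_Integration.integral_cong refl expand) (simp add: haar_prob_measure_def)
    also have "\<dots> = (\<Sum>z\<in>Z. LINT U|M. F z U)"
      using fiber by (intro Bochner_Integration.integral_sum) blast
    also have "\<dots> = (\<Sum>z\<in>Z. of_nat (card {A \<in> mats. margins A = z}))"
      using fiber by (intro sum.cong refl) blast
    also have "\<dots> = of_nat (card mats)"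
      using sum_card_fibers[OF finm finZ margins_Z] by (simp only: of_nat_sum[symmetric])
    finally have "complex_of_real (LINT U|M. (cmod (coeff (det_poly U ^ k) n))\<^sup>2) = complex_of_real (real (card mats))"
      by simp
    then show ?thesis
      unfolding mats_def[symmetric] by (simp only: of_real_eq_iff)
  qed
qed

end
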